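(* Let $(\mathcal M,\tau)$ be a finite von Neumann algebra satisfying the weak Dixmier property and let $|\!|\!|\cdot|\!|\!|$ be a tracial gauge norm on $\mathcal M$. Then the dual norm $|\!|\!|\cdot|\!|\!|^\#$ is also a tracial gauge norm on $\mathcal M$ and $|\!|\!|\cdot|\!|\!|^{\#\#}=|\!|\!|\cdot|\!|\!|$.
   Context: A finite von Neumann algebra $(\mathcal M,\tau)$ means a von Neumann algebra $\mathcal M$ with a faithful normal tracial state $\tau$. Positive operators $S,T\in\mathcal M$ are equi-measurable if $\tau(S^n)=\tau(T^n)$ for all $n=0,1,2,\dots$. $(\mathcal M,\tau)$ satisfies the weak Dixmier property if for every positive $T\in\mathcal M$, $\tau(T)1$ is in the operator norm closure of the convex hull of the set of (positive) $S\in\mathcal M$ that are equi-measurable with $T$. A tracial gauge norm on $(\mathcal M,\tau)$ is a norm $|\!|\!|\cdot|\!|\!|$ on $\mathcal M$ with $|\!|\!|T|\!|\!|=|\!|\!|\,|T|\,|\!|\!|$ for all $T\in\mathcal M$, where $|T|=(T^*T)^{1/2}$, and $|\!|\!|S|\!|\!|=|\!|\!|T|\!|\!|$ whenever $S,T$ are equi-measurable positive operators in $\mathcal M$. For a norm $|\!|\!|\cdot|\!|\!|$ on $\mathcal M$ the dual norm is $|\!|\!|T|\!|\!|^\#=\sup\{|\tau(TX)|:\ X\in\mathcal M,\ |\!|\!|X|\!|\!|\le 1\}$, $T\in\mathcal M$; $|\!|\!|\cdot|\!|\!|^{\#\#}$ is the dual norm of $|\!|\!|\cdot|\!|\!|^\#$.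 *)

theory Defs
  imports "HOL-Analysis.Analysis"
begin

subsection \<open>Complex Hilbert spaces\<close>

class complex_vector = real_vector +
  fixes scaleC :: "complex \<Rightarrow> 'a \<Rightarrow> 'a" (infixr \<open>*\<^sub>C\<close> 75)
  assumes scaleC_add_right: "c *\<^sub>C (x + y) = c *\<^sub>C x + c *\<^sub>C y"
    and scaleC_add_left: "(c + d) *\<^sub>C x = c *\<^sub>C x + d *\<^sub>C x"
    and scaleC_scaleC: "c *\<^sub>C d *\<^sub>C x = (c * d) *\<^sub>C x"
    and scaleC_of_real: "complex_of_real r *\<^sub>C x = r *\<^sub>R x"

text \<open>The complex inner product is linear in its first argument.  Its real part is the
  inner product of the underlying real inner product space, which determines the norm;
  positive definiteness is inherited from there.\<close>

class complex_inner = complex_vector + real_inner +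
  fixes cinner :: "'a \<Rightarrow> 'a \<Rightarrow> complex"
  assumes cinner_commute: "cinner x y = cnj (cinner y x)"
    and cinner_add_left: "cinner (x + y) z = cinner x z + cinner y z"
    and cinner_scaleC_left: "cinner (c *\<^sub>C x) y = c * cinner x y"
    and Re_cinner: "Re (cinner x y) = inner x y"

class chilbert_space = complex_inner + complete_space

lemma cinner_self: "cinner x x = complex_of_real ((norm x)\<^sup>2)" for x :: "'a::complex_inner"
proof (rule complex_eqI)
  show "Re (cinner x x) = Re (complex_of_real ((norm x)\<^sup>2))"
    by (simp add: Re_cinner power2_norm_eq_inner)
  have "Im (cinner x x) = - Im (cinner x x)"
    using arg_cong[OF cinner_commute[of x x], of Im] by simp
  then show "Im (cinner x x) = Im (complex_of_real ((norm x)\<^sup>2))"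
    by simp
qed

lemma norm_scaleC: "norm (c *\<^sub>C x) = cmod c * norm x" for x :: "'a::complex_inner"
proof -
  have "cinner (c *\<^sub>C x) (c *\<^sub>C x) = c * cnj (cinner (c *\<^sub>C x) x)"
    by (metis cinner_scaleC_left cinner_commute)
  also have "\<dots> = (c * cnj c) * cinner x x"
    by (simp add: cinner_scaleC_left cinner_self)
  also have "\<dots> = complex_of_real ((cmod c * norm x)\<^sup>2)"
    unfolding cinner_self complex_norm_square[symmetric]
    by (simp add: power_mult_distrib)
  finally have "(norm (c *\<^sub>C x))\<^sup>2 = (cmod c * norm x)\<^sup>2"
    unfolding cinner_self using of_real_eq_iff by blast
  then show ?thesis
    by (simp add: power2_eq_iff_nonneg)
qed

lemma bounded_linear_scaleC: "bounded_linear (\<lambda>x :: 'a::complex_inner. c *\<^sub>C x)"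
proof (rule bounded_linear_intro[where K = "cmod c"])
  fix r :: real and x :: 'a
  show "c *\<^sub>C r *\<^sub>R x = r *\<^sub>R c *\<^sub>C x"
    by (metis scaleC_of_real scaleC_scaleC mult.commute)
qed (simp_all add: scaleC_add_right norm_scaleC mult.commute)

instantiation complex :: chilbert_space
begin

definition scaleC_complex :: "complex \<Rightarrow> complex \<Rightarrow> complex"
  where "scaleC_complex c x = c * x"

definition cinner_complex :: "complex \<Rightarrow> complex \<Rightarrow> complex"
  where "cinner_complex x y = x * cnj y"

instance
  by standard
    (simp_all add: scaleC_complex_def cinner_complex_def algebra_simps scaleR_conv_of_real
      inner_complex_def)

end


subsection \<open>Bounded operators\<close>

text \<open>The type \<open>'h \<Rightarrow>\<^sub>L 'h\<close> consists of the real-linear bounded maps, with the operator norm;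
  \<open>bounded_operators\<close> singles out the complex-linear ones.\<close>

definition bounded_operators :: "('h::chilbert_space \<Rightarrow>\<^sub>L 'h) set"
  where "bounded_operators = {A. \<forall>c x. blinfun_apply A (c *\<^sub>C x) = c *\<^sub>C blinfun_apply A x}"

instantiation blinfun :: (real_normed_vector, complex_inner) complex_vector
begin

definition scaleC_blinfun :: "complex \<Rightarrow> ('a \<Rightarrow>\<^sub>L 'b) \<Rightarrow> ('a \<Rightarrow>\<^sub>L 'b)"
  where "scaleC_blinfun c A = Blinfun (\<lambda>x. c *\<^sub>C blinfun_apply A x)"

lemma blinfun_apply_scaleC: "blinfun_apply (c *\<^sub>C A) x = c *\<^sub>C blinfun_apply A x"
  for A :: "'a \<Rightarrow>\<^sub>L 'b"
  unfolding scaleC_blinfun_def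
  by (subst bounded_linear_Blinfun_apply)
    (auto intro: bounded_linear_compose[OF bounded_linear_scaleC] blinfun.bounded_linear_right)

instance
  by standard
    (auto intro!: blinfun_eqI simp: blinfun_apply_scaleC blinfun.add_left blinfun.scaleR_left
      scaleC_add_right scaleC_add_left scaleC_scaleC scaleC_of_real)

end

definition op_adjoint :: "('h::chilbert_space \<Rightarrow>\<^sub>L 'h) \<Rightarrow> ('h \<Rightarrow>\<^sub>L 'h)"
  where "op_adjoint A =
    (THE B. \<forall>x y. cinner (blinfun_apply A x) y = cinner x (blinfun_apply B y))"

definition op_power :: "('h::chilbert_space \<Rightarrow>\<^sub>L 'h) \<Rightarrow> nat \<Rightarrow> ('h \<Rightarrow>\<^sub>L 'h)"
  where "op_power A n = ((\<lambda>B. A o\<^sub>L B) ^^ n) id_blinfun"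

definition positive_op :: "('h::chilbert_space \<Rightarrow>\<^sub>L 'h) \<Rightarrow> bool"
  where "positive_op A \<longleftrightarrow>
    A \<in> bounded_operators \<and> (\<forall>x. cinner (blinfun_apply A x) x \<in> \<real>\<^sub>\<ge>\<^sub>0)"

definition op_le :: "('h::chilbert_space \<Rightarrow>\<^sub>L 'h) \<Rightarrow> ('h \<Rightarrow>\<^sub>L 'h) \<Rightarrow> bool"
  where "op_le A B \<longleftrightarrow> positive_op (B - A)"

text \<open>The absolute value \<open>(T\<^sup>* T)\<^sup>1\<^sup>/\<^sup>2\<close>, where the square root is the unique positive one.\<close>

definition op_abs :: "('h::chilbert_space \<Rightarrow>\<^sub>L 'h) \<Rightarrow> ('h \<Rightarrow>\<^sub>L 'h)"
  where "op_abs T = (THE R. positive_op R \<and> R o\<^sub>L R = op_adjoint T o\<^sub>L T)"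


subsection \<open>Finite von Neumann algebras\<close>

definition commutant :: "('h::chilbert_space \<Rightarrow>\<^sub>L 'h) set \<Rightarrow> ('h \<Rightarrow>\<^sub>L 'h) set"
  where "commutant M = {B \<in> bounded_operators. \<forall>A\<in>M. A o\<^sub>L B = B o\<^sub>L A}"

definition von_neumann_algebra :: "('h::chilbert_space \<Rightarrow>\<^sub>L 'h) set \<Rightarrow> bool"
  where "von_neumann_algebra M \<longleftrightarrow>
    M \<subseteq> bounded_operators \<and> (\<forall>A\<in>M. op_adjoint A \<in> M) \<and> commutant (commutant M) = M"

text \<open>A state is a unital positive linear functional.  Only the values of \<open>\<tau>\<close> on \<open>M\<close> matter.\<close>

definition state_on ::
    "('h::chilbert_space \<Rightarrow>\<^sub>L 'h) set \<Rightarrow> (('h \<Rightarrow>\<^sub>L 'h) \<Rightarrow> complex) \<Rightarrow> bool"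
  where "state_on M \<tau> \<longleftrightarrow>
    (\<forall>A\<in>M. \<forall>B\<in>M. \<tau> (A + B) = \<tau> A + \<tau> B) \<and>
    (\<forall>A\<in>M. \<forall>c. \<tau> (c *\<^sub>C A) = c * \<tau> A) \<and>
    (\<forall>A\<in>M. positive_op A \<longrightarrow> \<tau> A \<in> \<real>\<^sub>\<ge>\<^sub>0) \<and>
    \<tau> id_blinfun = 1"

definition tracial_on ::
    "('h::chilbert_space \<Rightarrow>\<^sub>L 'h) set \<Rightarrow> (('h \<Rightarrow>\<^sub>L 'h) \<Rightarrow> complex) \<Rightarrow> bool"
  where "tracial_on M \<tau> \<longleftrightarrow> (\<forall>A\<in>M. \<forall>B\<in>M. \<tau> (A o\<^sub>L B) = \<tau> (B o\<^sub>L A))"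

definition faithful_on ::
    "('h::chilbert_space \<Rightarrow>\<^sub>L 'h) set \<Rightarrow> (('h \<Rightarrow>\<^sub>L 'h) \<Rightarrow> complex) \<Rightarrow> bool"
  where "faithful_on M \<tau> \<longleftrightarrow> (\<forall>A\<in>M. positive_op A \<and> \<tau> A = 0 \<longrightarrow> A = 0)"

text \<open>Normality: \<open>\<tau>\<close> preserves least upper bounds of upward directed sets of positive
  elements.\<close>

definition normal_on ::
    "('h::chilbert_space \<Rightarrow>\<^sub>L 'h) set \<Rightarrow> (('h \<Rightarrow>\<^sub>L 'h) \<Rightarrow> complex) \<Rightarrow> bool"
  where "normal_on M \<tau> \<longleftrightarrow>
    (\<forall>D S. D \<subseteq> {A \<in> M. positive_op A} \<and> D \<noteq> {} \<and>
       (\<forall>A\<in>D. \<forall>B\<in>D. \<exists>C\<in>D. op_le A C \<and> op_le B C) \<and>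
       S \<in> M \<and> (\<forall>A\<in>D. op_le A S) \<and>
       (\<forall>B\<in>M. (\<forall>A\<in>D. op_le A B) \<longrightarrow> op_le S B)
     \<longrightarrow> \<tau> S = complex_of_real (SUP A\<in>D. Re (\<tau> A)))"

definition finite_von_neumann_algebra ::
    "('h::chilbert_space \<Rightarrow>\<^sub>L 'h) set \<Rightarrow> (('h \<Rightarrow>\<^sub>L 'h) \<Rightarrow> complex) \<Rightarrow> bool"
  where "finite_von_neumann_algebra M \<tau> \<longleftrightarrow>
    von_neumann_algebra M \<and> state_on M \<tau> \<and> tracial_on M \<tau> \<and> faithful_on M \<tau> \<and> normal_on M \<tau>"


subsection \<open>Equi-measurability, gauge norms and dual norms\<close>

definition equi_measurable ::
    "(('h::chilbert_space \<Rightarrow>\<^sub>L 'h) \<Rightarrow> complex) \<Rightarrow> ('h \<Rightarrow>\<^sub>L 'h) \<Rightarrow> ('h \<Rightarrow>\<^sub>L 'h) \<Rightarrow> bool"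
  where "equi_measurable \<tau> S T \<longleftrightarrow> (\<forall>n. \<tau> (op_power S n) = \<tau> (op_power T n))"

definition weak_Dixmier ::
    "('h::chilbert_space \<Rightarrow>\<^sub>L 'h) set \<Rightarrow> (('h \<Rightarrow>\<^sub>L 'h) \<Rightarrow> complex) \<Rightarrow> bool"
  where "weak_Dixmier M \<tau> \<longleftrightarrow>
    (\<forall>T\<in>M. positive_op T \<longrightarrow>
      \<tau> T *\<^sub>C id_blinfun
        \<in> closure (convex hull {S \<in> M. positive_op S \<and> equi_measurable \<tau> S T}))"

definition norm_on ::
    "('h::chilbert_space \<Rightarrow>\<^sub>L 'h) set \<Rightarrow> (('h \<Rightarrow>\<^sub>L 'h) \<Rightarrow> real) \<Rightarrow> bool"
  where "norm_on M N \<longleftrightarrow>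
    (\<forall>A\<in>M. 0 \<le> N A) \<and>
    (\<forall>A\<in>M. N A = 0 \<longleftrightarrow> A = 0) \<and>
    (\<forall>A\<in>M. \<forall>c. N (c *\<^sub>C A) = cmod c * N A) \<and>
    (\<forall>A\<in>M. \<forall>B\<in>M. N (A + B) \<le> N A + N B)"

definition tracial_gauge_norm ::
    "('h::chilbert_space \<Rightarrow>\<^sub>L 'h) set \<Rightarrow> (('h \<Rightarrow>\<^sub>L 'h) \<Rightarrow> complex) \<Rightarrow> (('h \<Rightarrow>\<^sub>L 'h) \<Rightarrow> real) \<Rightarrow> bool"
  where "tracial_gauge_norm M \<tau> N \<longleftrightarrow>
    norm_on M N \<and>
    (\<forall>T\<in>M. N T = N (op_abs T)) \<and>
    (\<forall>S\<in>M. \<forall>T\<in>M. positive_op S \<and> positive_op T \<and> equi_measurable \<tau> S T \<longrightarrow> N S = N T)"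

text \<open>The dual norm is the supremum of the following set.  A real \<open>Sup\<close> is only meaningful
  for a set that is bounded above, so finiteness has to be asserted separately, as
  \<open>bdd_above (dual_values M \<tau> N T)\<close>.\<close>

definition dual_values ::
    "('h::chilbert_space \<Rightarrow>\<^sub>L 'h) set \<Rightarrow> (('h \<Rightarrow>\<^sub>L 'h) \<Rightarrow> complex) \<Rightarrow> (('h \<Rightarrow>\<^sub>L 'h) \<Rightarrow> real)
      \<Rightarrow> ('h \<Rightarrow>\<^sub>L 'h) \<Rightarrow> real set"
  where "dual_values M \<tau> N T = {cmod (\<tau> (T o\<^sub>L X)) | X. X \<in> M \<and> N X \<le> 1}"

definition dual_norm ::
    "('h::chilbert_space \<Rightarrow>\<^sub>L 'h) set \<Rightarrow> (('h \<Rightarrow>\<^sub>L 'h) \<Rightarrow> complex) \<Rightarrow> (('h \<Rightarrow>\<^sub>L 'h) \<Rightarrow> real)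
      \<Rightarrow> ('h \<Rightarrow>\<^sub>L 'h) \<Rightarrow> real"
  where "dual_norm M \<tau> N T = Sup (dual_values M \<tau> N T)"

end

theory Submission
  imports Defs
begin

text \<open>Let \<open>P 0, \<dots>, P (K - 1)\<close> be orthogonal projections in \<open>M\<close> with sum \<open>1\<close>.  The theorem rests
  on one fact about a tracial gauge norm \<open>N\<close>: replacing \<open>X\<close> by its conditional expectation onto
  the span of the \<open>P i\<close> does not increase the norm (\<open>conditional_expectation\<close>).  Given this,
  duality becomes a finite-dimensional matter.  By spectral theory a positive operator is a norm
  limit of combinations \<open>S = \<Sum> c i P i\<close> with \<open>c i \<ge> 0\<close>, and \<open>N\<close> is continuous in the operator
  norm.  Pairing such an \<open>S\<close> with \<open>X\<close> gives no more than pairing it with the expectation of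
  \<open>|Y|\<close>, where \<open>Y = \<Sum> P i X P i\<close> and \<open>N |Y| \<le> N X\<close>.  So the dual norm of \<open>S\<close> depends only on the
  numbers \<open>c i\<close> and the traces of the \<open>P i\<close>, that is, on the moments of \<open>S\<close> (\<open>dual_equi_le\<close>).  A
  functional on the span of the \<open>P i\<close> that norms \<open>S\<close> is the pairing with an element of that
  span, whose dual norm on all of \<open>M\<close> is again at most \<open>1\<close> (\<open>norming_element\<close>); this gives the
  bidual.

  For positive \<open>X\<close> commuting with the \<open>P i\<close>, the expectation is an average.  If the part of \<open>X\<close>
  below one \<open>P\<close> is a combination of orthogonal projections of equal trace, permuting the
  coefficients does not affect the moments, so it does not affect \<open>N\<close>, and the mean over cyclic
  permutations replaces \<open>X\<close> by a multiple of \<open>P\<close> there.  The difficulty is to cut projections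
  into pieces of equal trace, and this is where the weak Dixmier property is used
  (\<open>fine_division\<close>).  If there is a minimal projection \<open>P\<close>, that property places, inside a
  projection with the same trace as any given \<open>R \<noteq> 0\<close>, a projection of trace \<open>\<tau>(P)\<close>; so all
  traces of projections are multiples of \<open>\<tau>(P)\<close>, and every projection is a sum of minimal ones.
  If there is none, then by normality any trace value below \<open>\<tau>(F)\<close> is attained by a
  subprojection of \<open>F\<close>.

  Moments determine the trace of everything that is built from an operator by polynomials, norm
  limits and square roots (\<open>moment_pairs_tau\<close>), and, through normality, the traces of its
  spectral projections (\<open>tr_spec_eq\<close>).  That a gauge norm is invariant under adjoints, and not
  increased by multiplication with contractions, follows from the same principle, since \<open>T T\<^sup>*\<close>
  and \<open>T\<^sup>* T\<close> have equal moments and a self-adjoint contraction is the mean of two unitaries.\<close>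

section \<open>Hilbert space: projections and adjoints\<close>

type_synonym 'h endo = "'h \<Rightarrow>\<^sub>L 'h"

text \<open>The library symbol for composition binds weaker than addition; this one binds like a product.\<close>

notation blinfun_compose (infixl \<open>\<odot>\<close> 70)

lemma blinfun_compose_assoc: "(A \<odot> B) \<odot> C = A \<odot> (B \<odot> C)"
  by (rule blinfun_eqI) simp

lemma id_blinfun_compose [simp]: "id_blinfun \<odot> A = A" "A \<odot> id_blinfun = A"
  by (auto intro: blinfun_eqI)

lemmas blinfun_compose_distribs =
  bounded_bilinear.add_left[OF bounded_bilinear_blinfun_compose]
  bounded_bilinear.add_right[OF bounded_bilinear_blinfun_compose]
  bounded_bilinear.diff_left[OF bounded_bilinear_blinfun_compose]
  bounded_bilinear.diff_right[OF bounded_bilinear_blinfun_compose]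
  bounded_bilinear.scaleR_left[OF bounded_bilinear_blinfun_compose]
  bounded_bilinear.scaleR_right[OF bounded_bilinear_blinfun_compose]
  bounded_bilinear.minus_left[OF bounded_bilinear_blinfun_compose]
  bounded_bilinear.minus_right[OF bounded_bilinear_blinfun_compose]

lemmas blinfun_compose_sum_left = bounded_bilinear.sum_left[OF bounded_bilinear_blinfun_compose]
lemmas blinfun_compose_sum_right = bounded_bilinear.sum_right[OF bounded_bilinear_blinfun_compose]
lemmas tendsto_blinfun_compose = bounded_bilinear.tendsto[OF bounded_bilinear_blinfun_compose]

lemmas blinfun_lin = blinfun.bilinear_simps

lemma closest_point_exists:
  fixes S :: "'a::{real_inner,complete_space} set"
  assumes "closed S" "convex S" "S \<noteq> {}"
  obtains x where "x \<in> S" "\<And>y. y \<in> S \<Longrightarrow> norm (a - x) \<le> norm (a - y)"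
proof -
  define d where "d = (INF y\<in>S. (norm (a - y))\<^sup>2)"
  have bdd: "bdd_below ((\<lambda>y. (norm (a - y))\<^sup>2) ` S)" by (rule bdd_belowI[of _ 0]) auto
  have dle: "d \<le> (norm (a - y))\<^sup>2" if "y \<in> S" for y
    unfolding d_def by (rule cINF_lower[OF bdd that])
  have ex: "\<exists>y\<in>S. (norm (a - y))\<^sup>2 < d + inverse (Suc n)" for n
  proof -
    have "(INF y\<in>S. (norm (a - y))\<^sup>2) < d + inverse (Suc n)" by (simp add: d_def)
    then show ?thesis using cINF_less_iff[OF assms(3) bdd] by blast
  qed
  then obtain f where f: "\<And>n. f n \<in> S" "\<And>n. (norm (a - f n))\<^sup>2 < d + inverse (Suc n)" by metis
  \<comment> \<open>the parallelogram law turns a minimising sequence into a Cauchy sequence\<close>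
  have par: "(norm (x - y))\<^sup>2 \<le> 2 * ((norm (a - x))\<^sup>2 - d) + 2 * ((norm (a - y))\<^sup>2 - d)"
    if "x \<in> S" "y \<in> S" for x y
  proof -
    have "(1/2) *\<^sub>R x + (1/2) *\<^sub>R y \<in> S" using convexD[OF assms(2) that, of "1/2" "1/2"] by simp
    from dle[OF this] have "4 * d \<le> 4 * (norm (a - ((1/2) *\<^sub>R x + (1/2) *\<^sub>R y)))\<^sup>2" by simp
    also have "\<dots> + (norm (x - y))\<^sup>2 = 2 * (norm (a - x))\<^sup>2 + 2 * (norm (a - y))\<^sup>2"
      unfolding power2_norm_eq_inner
      by (simp add: inner_simps inner_commute algebra_simps)
    finally show ?thesis by (simp add: algebra_simps)
  qed
  have "Cauchy f"
  proof (rule metric_CauchyI)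
    fix e :: real assume "e > 0"
    then obtain N where N: "inverse (real (Suc N)) < e\<^sup>2 / 4"
      using reals_Archimedean[of "e\<^sup>2 / 4"] by auto
    have "dist (f m) (f n) < e" if "m \<ge> N" "n \<ge> N" for m n
    proof -
      have i: "inverse (real (Suc m)) \<le> inverse (Suc N)" "inverse (real (Suc n)) \<le> inverse (Suc N)"
        using that by (auto simp: field_simps)
      have "(norm (f m - f n))\<^sup>2 < e\<^sup>2"
      proof -
        have "(norm (a - f m))\<^sup>2 - d < e\<^sup>2 / 4" "(norm (a - f n))\<^sup>2 - d < e\<^sup>2 / 4"
          using f(2)[of m] f(2)[of n] i N by (smt (verit))+
        then have "2 * ((norm (a - f m))\<^sup>2 - d) + 2 * ((norm (a - f n))\<^sup>2 - d)
            < 2 * (e\<^sup>2 / 4) + 2 * (e\<^sup>2 / 4)"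
          by (intro add_strict_mono mult_strict_left_mono) auto
        then show ?thesis using par[OF f(1)[of m] f(1)[of n]] by simp
      qed
      then show ?thesis using \<open>e > 0\<close> by (simp add: dist_norm power2_less_imp_less)
    qed
    then show "\<exists>M. \<forall>m\<ge>M. \<forall>n\<ge>M. dist (f m) (f n) < e" by blast
  qed
  then obtain x where x: "f \<longlonglongrightarrow> x" using convergent_eq_Cauchy by blast
  have xS: "x \<in> S" using closed_sequentially[OF assms(1) f(1) x] .
  have "(norm (a - x))\<^sup>2 \<le> d"
  proof (rule LIMSEQ_le)
    show "(\<lambda>n. (norm (a - f n))\<^sup>2) \<longlonglongrightarrow> (norm (a - x))\<^sup>2" by (intro tendsto_intros x)
    show "(\<lambda>n. d + inverse (Suc n)) \<longlonglongrightarrow> d"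
      using LIMSEQ_inverse_real_of_nat_add[of d] by simp
  qed (use f(2) less_imp_le in blast)
  then have "norm (a - x) \<le> norm (a - y)" if "y \<in> S" for y
    using dle[OF that] by (meson norm_ge_zero order_trans power2_le_imp_le)
  with xS show ?thesis using that by blast
qed

lemma orthogonal_projection_exists:
  fixes K :: "'a::{real_inner,complete_space} set"
  assumes "closed K" "subspace K"
  obtains P :: "'a endo" where "\<And>x. P x \<in> K" "\<And>x y. y \<in> K \<Longrightarrow> inner (x - P x) y = 0"
proof -
  have "\<exists>p\<in>K. \<forall>y\<in>K. inner (x - p) y = 0" for x
  proof -
    have "K \<noteq> {}" using subspace_0[OF assms(2)] by blast
    with assms obtain p where p: "p \<in> K" "\<And>y. y \<in> K \<Longrightarrow> norm (x - p) \<le> norm (x - y)"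
      using closest_point_exists[of K x] subspace_imp_convex by metis
    have "inner (x - p) y = 0" if y: "y \<in> K" for y
    proof (cases "y = 0")
      case False
      define t where "t = inner (x - p) y / inner y y"
      have yy: "inner y y > 0" using False by simp
      have "p + t *\<^sub>R y \<in> K" using p(1) y assms(2) by (simp add: subspace_add subspace_scale)
      from p(2)[OF this] have "(norm (x - p))\<^sup>2 \<le> (norm (x - (p + t *\<^sub>R y)))\<^sup>2"
        by (rule power_mono) simp
      also have "\<dots> = (norm ((x - p) - t *\<^sub>R y))\<^sup>2" by (simp add: algebra_simps)
      also have "\<dots> = (norm (x - p))\<^sup>2 - 2 * t * inner (x - p) y + t\<^sup>2 * inner y y"
        unfolding power2_norm_eq_inner inner_diff_left inner_diff_right inner_scaleR_left
          inner_scaleR_right by (simp add: inner_commute power2_eq_square algebra_simps)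
      also have "\<dots> = (norm (x - p))\<^sup>2 - (inner (x - p) y)\<^sup>2 / inner y y"
        using yy by (simp add: t_def power2_eq_square field_simps)
      finally have "(inner (x - p) y)\<^sup>2 / inner y y \<le> 0" by simp
      then have "(inner (x - p) y)\<^sup>2 \<le> 0" using yy by (simp add: divide_le_0_iff not_le[symmetric])
      then show ?thesis by simp
    qed simp
    with p(1) show ?thesis by blast
  qed
  then obtain p where p: "\<And>x. p x \<in> K" "\<And>x y. y \<in> K \<Longrightarrow> inner (x - p x) y = 0" by metis
  have uniq: "p x = z" if "z \<in> K" "\<And>y. y \<in> K \<Longrightarrow> inner (x - z) y = 0" for x z
  proof -
    have K: "p x - z \<in> K" using p(1) that(1) assms(2) subspace_diff by blast
    have "inner (p x - z) (p x - z) = inner (x - z) (p x - z) - inner (x - p x) (p x - z)"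
      by (simp add: inner_diff_left)
    also have "\<dots> = 0" using that(2)[OF K] p(2)[OF K] by simp
    finally show ?thesis by simp
  qed
  have "bounded_linear p"
  proof (rule bounded_linear_intro[where K = 1])
    show "p (x + y) = p x + p y" for x y
    proof (rule uniq)
      show "p x + p y \<in> K" using p(1) assms(2) subspace_add by blast
      show "inner (x + y - (p x + p y)) z = 0" if "z \<in> K" for z
        using p(2)[OF that, of x] p(2)[OF that, of y] by (simp add: inner_simps)
    qed
    show "p (r *\<^sub>R x) = r *\<^sub>R p x" for r x
    proof (rule uniq)
      show "r *\<^sub>R p x \<in> K" using p(1) assms(2) subspace_scale by blast
      show "inner (r *\<^sub>R x - r *\<^sub>R p x) z = 0" if "z \<in> K" for z
        using p(2)[OF that, of x] by (simp add: inner_simps)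
    qed
    show "norm (p x) \<le> norm x * 1" for x
    proof -
      have "(norm (p x))\<^sup>2 = inner x (p x)"
        using p(2)[OF p(1)[of x], of x] by (simp add: inner_diff_left power2_norm_eq_inner)
      also have "\<dots> \<le> norm x * norm (p x)" by (rule norm_cauchy_schwarz)
      finally show ?thesis by (cases "p x = 0") (auto simp: power2_eq_square)
    qed
  qed
  then have "blinfun_apply (Blinfun p) = p" by (rule bounded_linear_Blinfun_apply)
  with p show ?thesis using that[of "Blinfun p"] by simp
qed

lemma riesz_representation:
  fixes f :: "'a::{real_inner,complete_space} \<Rightarrow> real"
  assumes "bounded_linear f"
  obtains z where "\<And>x. f x = inner x z"
proof (cases "\<forall>x. f x = 0")
  case True
  then show ?thesis using that[of 0] by simp
next
  case False
  then obtain a where a: "f a \<noteq> 0" by blast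
  interpret f: bounded_linear f by fact
  define K where "K = {x. f x = 0}"
  have "closed K" unfolding K_def
    by (intro closed_Collect_eq continuous_intros linear_continuous_on assms)
  moreover have "subspace K" unfolding K_def subspace_def by (simp add: f.zero f.add f.scaleR)
  ultimately obtain P :: "'a endo"
    where P: "\<And>x. P x \<in> K" "\<And>x y. y \<in> K \<Longrightarrow> inner (x - P x) y = 0"
    using orthogonal_projection_exists by blast
  define u where "u = a - P a"
  have fu: "f u = f a" using P(1)[of a] by (simp add: u_def f.diff K_def)
  then have u0: "u \<noteq> 0" using a f.zero by auto
  have "f x = inner x ((f u / inner u u) *\<^sub>R u)" for x
  proof -
    have "f u *\<^sub>R x - f x *\<^sub>R u \<in> K" by (simp add: K_def f.diff f.scaleR)
    then have "inner u (f u *\<^sub>R x - f x *\<^sub>R u) = 0" using P(2) by (simp add: u_def)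
    then show ?thesis using u0 by (simp add: inner_diff_right inner_commute field_simps)
  qed
  then show ?thesis using that by blast
qed

lemma real_adjoint_exists:
  fixes A :: "'a::{real_inner,complete_space} endo"
  obtains B :: "'a endo" where "\<And>x y. inner (A x) y = inner x (B y)"
proof -
  have "\<exists>z. \<forall>x. inner (A x) y = inner x z" for y
    using riesz_representation[of "\<lambda>x. inner (A x) y"]
      bounded_linear_compose[OF bounded_linear_inner_left blinfun.bounded_linear_right] by metis
  then obtain b where b: "\<And>x y. inner (A x) y = inner x (b y)" by metis
  have uniq: "b y = z" if "\<And>x. inner (A x) y = inner x z" for y z
    using that b by (metis vector_eq_ldot)
  have "bounded_linear b"
  proof (rule bounded_linear_intro[where K = "norm A"])
    show "b (x + y) = b x + b y" for x y
      by (rule uniq) (simp add: inner_add_right b)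
    show "b (r *\<^sub>R x) = r *\<^sub>R b x" for r x
      by (rule uniq) (simp add: b)
    show "norm (b x) \<le> norm x * norm A" for x
    proof -
      have "(norm (b x))\<^sup>2 = inner (A (b x)) x" by (simp add: b power2_norm_eq_inner)
      also have "\<dots> \<le> norm (A (b x)) * norm x" by (rule norm_cauchy_schwarz)
      also have "\<dots> \<le> norm A * norm (b x) * norm x" by (intro mult_right_mono norm_blinfun) simp
      finally show ?thesis by (cases "b x = 0") (auto simp: power2_eq_square mult_ac)
    qed
  qed
  then have "blinfun_apply (Blinfun b) = b" by (rule bounded_linear_Blinfun_apply)
  with b show ?thesis using that[of "Blinfun b"] by simp
qed

text \<open>Multiplication by \<open>\<i>\<close> recovers the imaginary part of the complex inner product from its
  real part.  Hence, for complex-linear operators, adjoints and symmetry can be tested with the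
  real inner product alone, and everything below is done with the latter.\<close>

lemma cinner_eq_inner: "cinner x y = Complex (inner x y) (- inner (\<i> *\<^sub>C x) y)"
  for x :: "'a::complex_inner"
proof -
  have "inner (\<i> *\<^sub>C x) y = Re (\<i> * cinner x y)" by (metis Re_cinner cinner_scaleC_left)
  then show ?thesis by (simp add: complex_eq_iff Re_cinner)
qed

lemma inner_scaleC_right: "inner x (c *\<^sub>C y) = inner (cnj c *\<^sub>C x) y" for x :: "'a::complex_inner"
proof -
  have "cinner x (c *\<^sub>C y) = cinner (cnj c *\<^sub>C x) y"
    by (metis cinner_commute cinner_scaleC_left complex_cnj_mult complex_cnj_cnj)
  then show ?thesis by (metis Re_cinner)
qed

lemma bopD: "A \<in> bounded_operators \<Longrightarrow> A (c *\<^sub>C x) = c *\<^sub>C A x"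
  by (simp add: bounded_operators_def)

lemma scaleC_i_i: "\<i> *\<^sub>C \<i> *\<^sub>C x = - x" for x :: "'a::complex_vector"
proof -
  have "\<i> *\<^sub>C \<i> *\<^sub>C x = complex_of_real (-1) *\<^sub>C x" by (simp add: scaleC_scaleC)
  also have "\<dots> = - x" by (simp only: scaleC_of_real) simp
  finally show ?thesis .
qed

lemma scaleC_add_zero: "(c::complex) *\<^sub>C (0::'a::complex_vector) = 0"
  using scaleC_add_right[of c 0 0] by simp

lemma scaleC_minus_right: "c *\<^sub>C (- x) = - (c *\<^sub>C x)" for x :: "'a::complex_vector"
  using scaleC_add_right[of c x "-x"] by (simp add: scaleC_add_zero eq_neg_iff_add_eq_0 add.commute)

lemma scaleC_diff_right: "c *\<^sub>C (x - y) = c *\<^sub>C x - c *\<^sub>C y" for x :: "'a::complex_vector"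
  using scaleC_add_right[of c x "-y"] by (simp add: scaleC_minus_right)

lemma scaleC_scaleR: "c *\<^sub>C r *\<^sub>R x = r *\<^sub>R c *\<^sub>C x" for x :: "'a::complex_vector"
  by (metis scaleC_of_real scaleC_scaleC mult.commute)

lemma bounded_operators_closed_algebra:
  shows bop_id: "id_blinfun \<in> bounded_operators"
    and bop_zero: "(0 :: ('h::chilbert_space) endo) \<in> bounded_operators"
    and bop_add: "\<And>A B :: ('h::chilbert_space) endo. A \<in> bounded_operators \<Longrightarrow> B \<in> bounded_operators \<Longrightarrow> A + B \<in> bounded_operators"
    and bop_diff: "\<And>A B :: ('h::chilbert_space) endo. A \<in> bounded_operators \<Longrightarrow> B \<in> bounded_operators \<Longrightarrow> A - B \<in> bounded_operators"
    and bop_scaleR: "\<And>A :: ('h::chilbert_space) endo. A \<in> bounded_operators \<Longrightarrow> r *\<^sub>R A \<in> bounded_operators"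
    and bop_scaleC: "\<And>A :: ('h::chilbert_space) endo. A \<in> bounded_operators \<Longrightarrow> c *\<^sub>C A \<in> bounded_operators"
    and bop_compose: "\<And>A B :: ('h::chilbert_space) endo. A \<in> bounded_operators \<Longrightarrow> B \<in> bounded_operators \<Longrightarrow> A \<odot> B \<in> bounded_operators"
  by (auto simp: bounded_operators_def blinfun_lin scaleC_add_right scaleC_diff_right scaleC_scaleR
      scaleC_add_zero blinfun_apply_scaleC scaleC_scaleC mult.commute)

lemma op_adjoint_exists:
  fixes A :: "'h::chilbert_space endo"
  assumes "A \<in> bounded_operators"
  obtains B :: "'h endo" where "B \<in> bounded_operators" "op_adjoint A = B"
    "\<And>x y. inner (A x) y = inner x (B y)"
proof -
  obtain B :: "'h endo" where B: "\<And>x y. inner (A x) y = inner x (B y)"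
    using real_adjoint_exists[of A] by blast
  have "B (c *\<^sub>C y) = c *\<^sub>C B y" for c y
  proof -
    have "inner x (B (c *\<^sub>C y)) = inner x (c *\<^sub>C B y)" for x
      by (metis B inner_scaleC_right bopD[OF assms])
    then show ?thesis by (metis vector_eq_ldot)
  qed
  then have bop: "B \<in> bounded_operators" by (simp add: bounded_operators_def)
  have cin: "\<forall>x y. cinner (A x) y = cinner x (B y)"
    unfolding cinner_eq_inner by (metis B bopD[OF assms])
  have "op_adjoint A = B" unfolding op_adjoint_def
  proof (rule the_equality)
    fix C :: "'h endo" assume C: "\<forall>x y. cinner (A x) y = cinner x (C y)"
    have "C y = B y" for y using C B by (metis Re_cinner vector_eq_ldot)
    then show "C = B" by (rule blinfun_eqI)
  qed (use cin in blast)
  with bop B show ?thesis using that by blast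
qed

lemma op_adjoint_bop: "A \<in> bounded_operators \<Longrightarrow> op_adjoint A \<in> bounded_operators"
  by (metis op_adjoint_exists)

lemma inner_op_adjoint: "A \<in> bounded_operators \<Longrightarrow> inner (A x) y = inner x (op_adjoint A y)"
  by (metis op_adjoint_exists)

lemma inner_op_adjoint': "A \<in> bounded_operators \<Longrightarrow> inner x (A y) = inner (op_adjoint A x) y"
  by (metis op_adjoint_exists inner_commute)

lemma op_adjoint_eqI:
  fixes A B :: "'h::chilbert_space endo"
  assumes "A \<in> bounded_operators" "\<And>x y. inner (A x) y = inner x (B y)"
  shows "op_adjoint A = B"
  by (rule blinfun_eqI) (metis assms inner_op_adjoint vector_eq_ldot)

lemma op_adjoint_involutive: "A \<in> bounded_operators \<Longrightarrow> op_adjoint (op_adjoint A) = A"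
  by (intro op_adjoint_eqI op_adjoint_bop) (simp_all add: inner_op_adjoint')

lemma op_adjoint_compose: "A \<in> bounded_operators \<Longrightarrow> B \<in> bounded_operators \<Longrightarrow>
    op_adjoint (A \<odot> B) = op_adjoint B \<odot> op_adjoint A"
  by (intro op_adjoint_eqI bop_compose) (simp_all add: inner_op_adjoint)

lemma op_adjoint_add: "A \<in> bounded_operators \<Longrightarrow> B \<in> bounded_operators \<Longrightarrow>
    op_adjoint (A + B) = op_adjoint A + op_adjoint B"
  by (intro op_adjoint_eqI bop_add) (simp_all add: inner_op_adjoint blinfun_lin inner_simps)

lemma op_adjoint_diff: "A \<in> bounded_operators \<Longrightarrow> B \<in> bounded_operators \<Longrightarrow>
    op_adjoint (A - B) = op_adjoint A - op_adjoint B"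
  by (intro op_adjoint_eqI bop_diff) (simp_all add: inner_op_adjoint blinfun_lin inner_simps)

lemma op_adjoint_scaleR: "A \<in> bounded_operators \<Longrightarrow> op_adjoint (r *\<^sub>R A) = r *\<^sub>R op_adjoint A"
  by (intro op_adjoint_eqI bop_scaleR) (simp_all add: inner_op_adjoint blinfun_lin)

lemma op_adjoint_scaleC: "A \<in> bounded_operators \<Longrightarrow> op_adjoint (c *\<^sub>C A) = cnj c *\<^sub>C op_adjoint A"
  by (intro op_adjoint_eqI bop_scaleC)
    (simp_all add: inner_op_adjoint[symmetric] blinfun_apply_scaleC inner_scaleC_right bopD)

section \<open>Positive operators\<close>

definition selfadj :: "('h::chilbert_space) endo \<Rightarrow> bool"
  where "selfadj A \<longleftrightarrow> A \<in> bounded_operators \<and> (\<forall>x y. inner (A x) y = inner x (A y))"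

lemma selfadj_iff: "selfadj A \<longleftrightarrow> A \<in> bounded_operators \<and> op_adjoint A = A"
  unfolding selfadj_def by (metis op_adjoint_eqI inner_op_adjoint)

lemma selfadjD: "selfadj A \<Longrightarrow> inner (A x) y = inner x (A y)"
  and selfadj_bop: "selfadj A \<Longrightarrow> A \<in> bounded_operators"
  by (simp_all add: selfadj_def)

lemma selfadj_id: "selfadj id_blinfun"
  and selfadj_zero: "selfadj 0"
  and selfadj_add: "selfadj A \<Longrightarrow> selfadj B \<Longrightarrow> selfadj (A + B)"
  and selfadj_diff: "selfadj A \<Longrightarrow> selfadj B \<Longrightarrow> selfadj (A - B)"
  and selfadj_scaleR: "selfadj A \<Longrightarrow> selfadj (r *\<^sub>R A)"
  and selfadj_compose: "selfadj A \<Longrightarrow> selfadj B \<Longrightarrow> A \<odot> B = B \<odot> A \<Longrightarrow> selfadj (A \<odot> B)"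
  by (auto simp: selfadj_iff bop_id bop_zero bop_add bop_diff bop_scaleR bop_compose
      op_adjoint_add op_adjoint_diff op_adjoint_scaleR op_adjoint_compose
      intro!: op_adjoint_eqI[of id_blinfun id_blinfun] op_adjoint_eqI[of 0 0])

text \<open>Over the complex numbers a real quadratic form forces symmetry (polarisation).\<close>

lemma positive_op_iff: "positive_op A \<longleftrightarrow> selfadj A \<and> (\<forall>x. 0 \<le> inner (A x) x)"
proof
  assume A: "positive_op A"
  then have bop: "A \<in> bounded_operators" by (simp add: positive_op_def)
  have re: "0 \<le> inner (A x) x" and im: "inner (\<i> *\<^sub>C A x) x = 0" for x
    using A by (auto simp: positive_op_def complex_nonneg_Reals_iff cinner_eq_inner)
  have pol: "inner (\<i> *\<^sub>C A x) y = - inner (\<i> *\<^sub>C A y) x" for x y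
    using im[of "x + y"] im[of x] im[of y]
    by (simp add: blinfun_lin scaleC_add_right inner_simps)
  have "inner (A x) y = inner x (A y)" for x y
  proof -
    have "inner (A x) y = inner (\<i> *\<^sub>C A x) (\<i> *\<^sub>C y)"
      by (simp add: inner_scaleC_right scaleC_scaleC) (metis complex_i_mult_minus mult_minus_left mult.right_neutral scaleC_of_real of_real_1 scaleR_one)
    also have "\<dots> = - inner (\<i> *\<^sub>C A (\<i> *\<^sub>C y)) x" by (rule pol)
    also have "\<dots> = inner x (A y)" by (simp add: bopD[OF bop] scaleC_i_i inner_commute)
    finally show ?thesis .
  qed
  with bop re show "selfadj A \<and> (\<forall>x. 0 \<le> inner (A x) x)" by (simp add: selfadj_def)
next
  assume A: "selfadj A \<and> (\<forall>x. 0 \<le> inner (A x) x)"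
  have "inner (\<i> *\<^sub>C A x) x = 0" for x
  proof -
    have "inner (\<i> *\<^sub>C A x) x = inner (\<i> *\<^sub>C x) (A x)"
      using A by (metis selfadjD selfadj_bop bopD)
    also have "\<dots> = inner (cnj (- \<i>) *\<^sub>C x) (A x)" by simp
    also have "\<dots> = inner x ((- \<i>) *\<^sub>C A x)" by (simp only: inner_scaleC_right)
    also have "(- \<i>) *\<^sub>C A x = - (\<i> *\<^sub>C A x)"
      by (metis mult_minus1 scaleC_scaleC scaleC_of_real of_real_minus of_real_1 scaleR_minus1_left)
    finally show ?thesis by (simp add: inner_commute)
  qed
  with A show "positive_op A"
    by (auto simp: positive_op_def selfadj_bop complex_nonneg_Reals_iff cinner_eq_inner)
qed

subclass (in chilbert_space) banach ..

lemma positive_selfadj: "positive_op A \<Longrightarrow> selfadj A"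
  and positive_bop: "positive_op A \<Longrightarrow> A \<in> bounded_operators"
  and positive_nonneg: "positive_op A \<Longrightarrow> 0 \<le> inner (A x) x"
  by (simp_all add: positive_op_iff selfadj_bop)

lemma positive_id: "positive_op id_blinfun"
  and positive_zero: "positive_op 0"
  and positive_add: "positive_op A \<Longrightarrow> positive_op B \<Longrightarrow> positive_op (A + B)"
  and positive_scaleR: "positive_op A \<Longrightarrow> 0 \<le> r \<Longrightarrow> positive_op (r *\<^sub>R A)"
  by (simp_all add: positive_op_iff selfadj_id selfadj_zero selfadj_add selfadj_scaleR blinfun_lin
      inner_simps)

lemma selfadj_sum: "(\<And>i. i \<in> I \<Longrightarrow> selfadj (f i)) \<Longrightarrow> selfadj (\<Sum>i\<in>I. f i)"
  by (induction I rule: infinite_finite_induct) (auto simp: selfadj_zero selfadj_add)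

lemma positive_sum: "(\<And>i. i \<in> I \<Longrightarrow> positive_op (f i)) \<Longrightarrow> positive_op (\<Sum>i\<in>I. f i)"
  by (induction I rule: infinite_finite_induct) (auto simp: positive_zero positive_add)

lemma positive_conjugate:
  assumes "positive_op A" "X \<in> bounded_operators"
  shows "positive_op (op_adjoint X \<odot> A \<odot> X)"
proof -
  have "selfadj (op_adjoint X \<odot> A \<odot> X)"
    using assms by (auto simp: selfadj_def op_adjoint_bop bop_compose positive_bop
        inner_op_adjoint[symmetric] inner_op_adjoint'[symmetric] positive_selfadj selfadjD
        dest: positive_selfadj)
  then show ?thesis using assms
    by (auto simp: positive_op_iff inner_op_adjoint'[symmetric])
qed

lemma positive_adjoint_self:
  "X \<in> bounded_operators \<Longrightarrow> positive_op (op_adjoint X \<odot> X)"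
  using positive_conjugate[OF positive_id, of X] by simp

lemma positive_square: "selfadj A \<Longrightarrow> positive_op (A \<odot> A)"
  using positive_adjoint_self[of A] by (simp add: selfadj_iff)

lemma positive_sandwich: "positive_op A \<Longrightarrow> selfadj X \<Longrightarrow> positive_op (X \<odot> A \<odot> X)"
  using positive_conjugate[of A X] by (simp add: selfadj_iff)

text \<open>Cauchy--Schwarz for the semi-inner product \<open>\<langle>A x, y\<rangle>\<close>.\<close>

lemma positive_cauchy_schwarz:
  assumes "positive_op A"
  shows "(inner (A x) y)\<^sup>2 \<le> inner (A x) x * inner (A y) y"
proof -
  have sym: "inner (A y) x = inner (A x) y"
    by (metis assms positive_selfadj selfadjD inner_commute)
  have q: "0 \<le> inner (A x) x * t\<^sup>2 + 2 * inner (A x) y * t + inner (A y) y" for t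
  proof -
    have "0 \<le> inner (A (t *\<^sub>R x + y)) (t *\<^sub>R x + y)" by (rule positive_nonneg[OF assms])
    also have "\<dots> = inner (A x) x * t\<^sup>2 + 2 * inner (A x) y * t + inner (A y) y"
      by (simp add: blinfun_lin inner_simps sym power2_eq_square algebra_simps)
    finally show ?thesis .
  qed
  show ?thesis
  proof (cases "inner (A x) x = 0")
    case True
    have "inner (A x) y = 0"
    proof (rule ccontr)
      assume b: "inner (A x) y \<noteq> 0"
      have "0 \<le> 2 * inner (A x) y * (- (inner (A y) y + 1) / (2 * inner (A x) y)) + inner (A y) y"
        using q[of "- (inner (A y) y + 1) / (2 * inner (A x) y)"] True by simp
      also have "\<dots> = -1" using b by (simp add: field_simps)
      finally show False by simp
    qed
    then show ?thesis using True by simp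
  next
    case False
    then have a: "inner (A x) x > 0" using positive_nonneg[OF assms, of x] by simp
    have "0 \<le> inner (A x) x * (- inner (A x) y / inner (A x) x)\<^sup>2
        + 2 * inner (A x) y * (- inner (A x) y / inner (A x) x) + inner (A y) y" by (rule q)
    also have "\<dots> = inner (A y) y - (inner (A x) y)\<^sup>2 / inner (A x) x"
      using a by (simp add: power2_eq_square field_simps)
    finally show ?thesis using a by (simp add: field_simps)
  qed
qed

lemma positive_zero_on:
  assumes "positive_op A" "inner (A x) x = 0"
  shows "A x = 0"
  using positive_cauchy_schwarz[OF assms(1), of x "A x"] assms(2) by simp

lemma inner_le_norm_blinfun:
  fixes A :: "'a::real_inner endo"
  shows "inner (A x) x \<le> norm A * (norm x)\<^sup>2"
proof -
  have "inner (A x) x \<le> norm (A x) * norm x" by (rule norm_cauchy_schwarz)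
  also have "\<dots> \<le> norm A * norm x * norm x" by (intro mult_right_mono norm_blinfun) simp
  finally show ?thesis by (simp add: power2_eq_square mult_ac)
qed

text \<open>Cauchy--Schwarz with \<open>y = A x\<close>.\<close>

lemma norm_square_le_of_positive_le:
  assumes A: "positive_op A" and K: "\<And>x. inner (A x) x \<le> K * (norm x)\<^sup>2"
  shows "(norm (A x))\<^sup>2 \<le> K * inner (A x) x"
proof (cases "A x = 0")
  case False
  have "((norm (A x))\<^sup>2)\<^sup>2 \<le> inner (A x) x * inner (A (A x)) (A x)"
    using positive_cauchy_schwarz[OF A, of x "A x"] by (simp add: power2_norm_eq_inner)
  also have "\<dots> \<le> inner (A x) x * (K * (norm (A x))\<^sup>2)"
    by (intro mult_left_mono K positive_nonneg[OF A])
  finally show ?thesis using False by (simp add: power2_eq_square mult.commute)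
qed (use positive_nonneg[OF A, of x] in auto)

lemma norm_le_of_positive_le:
  assumes A: "positive_op A" and K: "\<And>x. inner (A x) x \<le> K * (norm x)\<^sup>2" and "0 \<le> K"
  shows "norm A \<le> K"
proof (rule norm_blinfun_bound[OF \<open>0 \<le> K\<close>])
  fix x
  have "(norm (A x))\<^sup>2 \<le> K * (K * (norm x)\<^sup>2)"
    using norm_square_le_of_positive_le[OF A K, of x] K[of x] \<open>0 \<le> K\<close>
    by (meson mult_left_mono order_trans)
  also have "\<dots> = (K * norm x)\<^sup>2" by (simp add: power2_eq_square)
  finally show "norm (A x) \<le> K * norm x"
    by (rule power2_le_imp_le) (use \<open>0 \<le> K\<close> in auto)
qed

lemma positive_id_minus_iff:
  "selfadj A \<Longrightarrow> positive_op (c *\<^sub>R id_blinfun - A) \<longleftrightarrow> (\<forall>x. inner (A x) x \<le> c * (norm x)\<^sup>2)"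
  by (auto simp: positive_op_iff selfadj_diff selfadj_scaleR selfadj_id blinfun_lin inner_simps
      power2_norm_eq_inner)

lemma positive_norm_minus:
  assumes "selfadj A" "norm A \<le> c" shows "positive_op (c *\<^sub>R id_blinfun - A)"
  unfolding positive_id_minus_iff[OF assms(1)]
  using inner_le_norm_blinfun[of A] assms(2) by (meson mult_right_mono order_trans zero_le_power2)

section \<open>Square roots and approximate polar decomposition\<close>

text \<open>Square roots and inverses are norm limits of polynomials in the given operators, so they
  stay in every closed unital algebra.  The principle is stated for algebras of pairs: this is what
  later transports constructions between two operators with equal moments.\<close>

definition closed_algebra :: "(('h::chilbert_space) endo) set \<Rightarrow> bool"
  where "closed_algebra \<A> \<longleftrightarrow> closed \<A> \<and> id_blinfun \<in> \<A> \<and>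
    (\<forall>A\<in>\<A>. \<forall>B\<in>\<A>. A + B \<in> \<A> \<and> A \<odot> B \<in> \<A>) \<and> (\<forall>A\<in>\<A>. \<forall>r. r *\<^sub>R A \<in> \<A>)"

definition closed_pair_algebra :: "(('h::chilbert_space) endo \<times> 'h endo) set \<Rightarrow> bool"
  where "closed_pair_algebra J \<longleftrightarrow> closed J \<and> (id_blinfun, id_blinfun) \<in> J \<and>
    (\<forall>A B C D. (A, B) \<in> J \<longrightarrow> (C, D) \<in> J \<longrightarrow> (A + C, B + D) \<in> J \<and> (A \<odot> C, B \<odot> D) \<in> J) \<and>
    (\<forall>A B r. (A, B) \<in> J \<longrightarrow> (r *\<^sub>R A, r *\<^sub>R B) \<in> J)"

lemma closed_pair_algebraD:
  assumes "closed_pair_algebra J"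
  shows "closed J" "(id_blinfun, id_blinfun) \<in> J"
    "(A, B) \<in> J \<Longrightarrow> (C, D) \<in> J \<Longrightarrow> (A + C, B + D) \<in> J"
    "(A, B) \<in> J \<Longrightarrow> (C, D) \<in> J \<Longrightarrow> (A - C, B - D) \<in> J"
    "(A, B) \<in> J \<Longrightarrow> (C, D) \<in> J \<Longrightarrow> (A \<odot> C, B \<odot> D) \<in> J"
    "(A, B) \<in> J \<Longrightarrow> (r *\<^sub>R A, r *\<^sub>R B) \<in> J"
proof -
  show scale: "(A, B) \<in> J \<Longrightarrow> (r *\<^sub>R A, r *\<^sub>R B) \<in> J" for A B r
    using assms by (auto simp: closed_pair_algebra_def)
  show "(A, B) \<in> J \<Longrightarrow> (C, D) \<in> J \<Longrightarrow> (A - C, B - D) \<in> J"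
    using assms scale[of C D "-1"] unfolding closed_pair_algebra_def
    by (metis (no_types) scaleR_minus1_left uminus_add_conv_diff add.commute)
qed (use assms in \<open>auto simp: closed_pair_algebra_def\<close>)

lemma closed_algebraD:
  assumes "closed_algebra \<A>"
  shows "closed \<A>" "id_blinfun \<in> \<A>"
    "A \<in> \<A> \<Longrightarrow> B \<in> \<A> \<Longrightarrow> A + B \<in> \<A>"
    "A \<in> \<A> \<Longrightarrow> B \<in> \<A> \<Longrightarrow> A - B \<in> \<A>"
    "A \<in> \<A> \<Longrightarrow> B \<in> \<A> \<Longrightarrow> A \<odot> B \<in> \<A>"
    "A \<in> \<A> \<Longrightarrow> r *\<^sub>R A \<in> \<A>"
proof -
  show scale: "A \<in> \<A> \<Longrightarrow> r *\<^sub>R A \<in> \<A>" for A r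
    using assms by (auto simp: closed_algebra_def)
  show "A \<in> \<A> \<Longrightarrow> B \<in> \<A> \<Longrightarrow> A - B \<in> \<A>"
    using assms scale[of B "-1"] unfolding closed_algebra_def
    by (metis (no_types) scaleR_minus1_left uminus_add_conv_diff add.commute)
qed (use assms in \<open>auto simp: closed_algebra_def\<close>)

lemma closed_pair_algebra_Times:
  "closed_algebra \<A> \<Longrightarrow> closed_algebra \<B> \<Longrightarrow> closed_pair_algebra (\<A> \<times> \<B>)"
  by (auto simp: closed_algebra_def closed_pair_algebra_def intro: closed_Times)

lemma closed_algebra_Int:
  "closed_algebra \<A> \<Longrightarrow> closed_algebra \<B> \<Longrightarrow> closed_algebra (\<A> \<inter> \<B>)"
  by (auto simp: closed_algebra_def)

lemma closed_Collect_commute: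
  "closed {A :: ('h::chilbert_space) endo. A \<odot> B = B \<odot> A}"
  by (intro closed_Collect_eq bounded_bilinear.continuous_on[OF bounded_bilinear_blinfun_compose]
      continuous_intros)

lemma closed_algebra_commute:
  "closed_algebra {A :: ('h::chilbert_space) endo. A \<odot> B = B \<odot> A}"
  unfolding closed_algebra_def
  by (auto simp: closed_Collect_commute blinfun_compose_distribs)
    (metis blinfun_compose_assoc)

lemma closed_algebra_bounded_operators: "closed_algebra (bounded_operators :: 'a::chilbert_space endo set)"
proof -
  have "closed {A :: 'a endo. A (c *\<^sub>C x) = c *\<^sub>C A x}" for c and x :: "'a::chilbert_space"
    by (intro closed_Collect_eq bounded_linear.continuous_on[OF bounded_linear_scaleC]
        continuous_intros)
  then have "closed (\<Inter>c. \<Inter>x::'a. {A :: 'a endo. A (c *\<^sub>C x) = c *\<^sub>C A x})" by (intro closed_INT ballI)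
  also have "(\<Inter>c. \<Inter>x::'a. {A :: 'a endo. A (c *\<^sub>C x) = c *\<^sub>C A x}) = bounded_operators"
    by (auto simp: bounded_operators_def)
  finally show ?thesis by (simp add: closed_algebra_def bop_id bop_add bop_compose bop_scaleR)
qed

lemma closed_positive: "closed {A :: 'a::chilbert_space endo. positive_op A}"
proof -
  have "closed (\<Inter>x y :: 'a. bounded_operators \<inter> {A :: 'a endo. inner (A x) y = inner x (A y)} \<inter> {A :: 'a endo. 0 \<le> inner (A x) x})"
    by (intro closed_INT ballI closed_Int closed_Collect_eq closed_Collect_le continuous_intros
        closed_algebraD(1)[OF closed_algebra_bounded_operators])
  also have "\<dots> = {A. positive_op A}" by (auto simp: positive_op_iff selfadj_def)
  finally show ?thesis .
qed

text \<open>For \<open>0 \<le> A \<le> 1\<close> the equation \<open>(1 - Y)\<^sup>2 = A\<close> is the fixed point equation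
  \<open>Y = (1 - A + Y\<^sup>2) / 2\<close>.  Its iteration from \<open>0\<close> is dominated, step by step and in norm, by
  the iteration for the scalar \<open>A = 0\<close>, which increases and is bounded.\<close>

primrec sqrt_iter :: "('h::chilbert_space) endo \<Rightarrow> nat \<Rightarrow> 'h endo" where
  "sqrt_iter A 0 = 0"
| "sqrt_iter A (Suc n) = (1/2) *\<^sub>R (id_blinfun - A + sqrt_iter A n \<odot> sqrt_iter A n)"

primrec sqrt_iter_bound :: "nat \<Rightarrow> real" where
  "sqrt_iter_bound 0 = 0"
| "sqrt_iter_bound (Suc n) = (1 + (sqrt_iter_bound n)\<^sup>2) / 2"

lemma sqrt_iter_bound_range: "0 \<le> sqrt_iter_bound n \<and> sqrt_iter_bound n \<le> 1"
  by (induction n) (auto simp: power_le_one)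

lemma sqrt_iter_bound_mono: "sqrt_iter_bound n \<le> sqrt_iter_bound (Suc n)"
proof -
  have "0 \<le> (1 - sqrt_iter_bound n)\<^sup>2" by simp
  then show ?thesis by (simp add: power2_eq_square algebra_simps)
qed

lemma sqrt_iter_in_pair:
  assumes "closed_pair_algebra J" "(A, B) \<in> J"
  shows "(sqrt_iter A n, sqrt_iter B n) \<in> J"
  using assms closed_pair_algebraD(6)[OF assms(1) assms(2), of 0]
  by (induction n) (auto intro!: closed_pair_algebraD[OF assms(1)])

lemma sqrt_iter_in:
  "closed_algebra \<A> \<Longrightarrow> A \<in> \<A> \<Longrightarrow> sqrt_iter A n \<in> \<A>"
  using sqrt_iter_in_pair[OF closed_pair_algebra_Times, of \<A> \<A> A A n] by auto

lemma sqrt_iter_commute: "sqrt_iter A m \<odot> sqrt_iter A n = sqrt_iter A n \<odot> sqrt_iter A m"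
proof -
  have *: "sqrt_iter A n \<odot> A = A \<odot> sqrt_iter A n" for n
    using sqrt_iter_in[OF closed_algebra_commute, of A A n] by simp
  show ?thesis
    using sqrt_iter_in[OF closed_algebra_commute, of A "sqrt_iter A n" m] *[of n] by simp
qed

lemma norm_sqrt_iter:
  assumes "norm (id_blinfun - A) \<le> 1"
  shows "norm (sqrt_iter A n) \<le> sqrt_iter_bound n"
proof (induction n)
  case (Suc n)
  have "norm (sqrt_iter A n \<odot> sqrt_iter A n) \<le> (sqrt_iter_bound n)\<^sup>2"
    using norm_blinfun_compose[of "sqrt_iter A n" "sqrt_iter A n"] Suc
    by (smt (verit) mult_mono norm_ge_zero power2_eq_square)
  then show ?case using assms norm_triangle_ineq[of "id_blinfun - A" "sqrt_iter A n \<odot> sqrt_iter A n"]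
    by (simp add: divide_right_mono)
qed simp

lemma norm_sqrt_iter_step:
  fixes A :: "'a::chilbert_space endo"
  assumes "norm (id_blinfun - A) \<le> 1"
  shows "norm (sqrt_iter A (Suc n) - sqrt_iter A n) \<le> sqrt_iter_bound (Suc n) - sqrt_iter_bound n"
proof (induction n)
  case 0
  then show ?case using assms by simp
next
  case (Suc n)
  let ?Y = "sqrt_iter A" and ?y = sqrt_iter_bound
  have halves: "x = (1/2) *\<^sub>R (c + u) \<Longrightarrow> y = (1/2) *\<^sub>R (c + v) \<Longrightarrow> x - y = (1/2) *\<^sub>R (u - v)"
    for x y c u v :: "'a endo" by (simp add: scaleR_diff_right[symmetric])
  have bound: "x = (1 + q\<^sup>2) / 2 \<Longrightarrow> y = (1 + p\<^sup>2) / 2 \<Longrightarrow> (q - p) * (q + p) / 2 = x - y"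
    for x y p q :: real by (simp add: power2_eq_square field_simps)
  have "?Y (Suc (Suc n)) - ?Y (Suc n) = (1/2) *\<^sub>R (?Y (Suc n) \<odot> ?Y (Suc n) - ?Y n \<odot> ?Y n)"
    by (rule halves[OF sqrt_iter.simps(2) sqrt_iter.simps(2)])
  also have "\<dots> = (1/2) *\<^sub>R ((?Y (Suc n) - ?Y n) \<odot> (?Y (Suc n) + ?Y n))"
    by (simp only: blinfun_compose_distribs sqrt_iter_commute[of A "Suc n" n]) simp
  finally have eq: "?Y (Suc (Suc n)) - ?Y (Suc n) = \<dots>" .
  have "norm ((?Y (Suc n) - ?Y n) \<odot> (?Y (Suc n) + ?Y n))
      \<le> (?y (Suc n) - ?y n) * (?y (Suc n) + ?y n)"
    by (rule order_trans[OF norm_blinfun_compose])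
      (intro mult_mono Suc norm_triangle_le add_mono norm_sqrt_iter assms norm_ge_zero,
        use sqrt_iter_bound_mono[of n] in simp)
  also have "\<dots> / 2 = ?y (Suc (Suc n)) - ?y (Suc n)"
    by (rule bound[OF sqrt_iter_bound.simps(2) sqrt_iter_bound.simps(2)])
  finally show ?case unfolding eq by simp
qed

text \<open>The iterates form a Cauchy sequence because their differences are dominated by those of a
  convergent sequence of numbers.\<close>

lemma sqrt_iter_limit:
  fixes A :: "'h::chilbert_space endo"
  assumes "positive_op A" "positive_op (id_blinfun - A)"
  obtains S where "positive_op S" "S \<odot> S = A" "(\<lambda>n. id_blinfun - sqrt_iter A n) \<longlonglongrightarrow> S"
proof -
  let ?Y = "sqrt_iter A" and ?y = sqrt_iter_bound
  have n1: "norm (id_blinfun - A) \<le> 1"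
    by (rule norm_le_of_positive_le[OF assms(2)])
      (use positive_nonneg[OF assms(1)] in \<open>auto simp: blinfun_lin inner_simps power2_norm_eq_inner\<close>)
  have step: "norm (?Y (n + k) - ?Y n) \<le> ?y (n + k) - ?y n" for n k
  proof (induction k)
    case (Suc k)
    have "norm (?Y (n + Suc k) - ?Y n) = norm ((?Y (Suc (n + k)) - ?Y (n + k)) + (?Y (n + k) - ?Y n))"
      by simp
    also have "\<dots> \<le> (?y (Suc (n + k)) - ?y (n + k)) + (?y (n + k) - ?y n)"
      by (intro norm_triangle_le add_mono norm_sqrt_iter_step n1 Suc)
    finally show ?case by simp
  qed simp
  have inc: "incseq ?y" by (intro incseq_SucI sqrt_iter_bound_mono)
  have "convergent ?y"
    by (rule Bseq_mono_convergent)
      (use sqrt_iter_bound_range inc in \<open>auto intro!: BseqI'[of _ 1] simp: incseq_def\<close>)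
  then have "Cauchy ?y" by (rule convergent_Cauchy)
  have d: "dist (?Y m) (?Y n) \<le> dist (?y m) (?y n)" for m n
  proof (cases "n \<le> m")
    case True
    then show ?thesis using step[of n "m - n"] by (simp add: dist_norm abs_if)
  next
    case False
    then show ?thesis using step[of m "n - m"] by (simp add: dist_norm abs_if norm_minus_commute)
  qed
  have "Cauchy ?Y" unfolding Cauchy_def
    using \<open>Cauchy ?y\<close> d by (meson Cauchy_def le_less_trans)
  then obtain Y where Y: "?Y \<longlonglongrightarrow> Y" using convergent_eq_Cauchy by blast
  have "(\<lambda>n. ?Y (Suc n)) \<longlonglongrightarrow> (1/2) *\<^sub>R (id_blinfun - A + Y \<odot> Y)"
    unfolding sqrt_iter.simps by (intro tendsto_intros tendsto_blinfun_compose Y)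
  moreover have "(\<lambda>n. ?Y (Suc n)) \<longlonglongrightarrow> Y" by (rule LIMSEQ_Suc[OF Y])
  ultimately have fp: "Y = (1/2) *\<^sub>R (id_blinfun - A + Y \<odot> Y)" using LIMSEQ_unique by blast
  have "2 *\<^sub>R Y = id_blinfun - A + Y \<odot> Y" by (subst fp) simp
  then have sq: "(id_blinfun - Y) \<odot> (id_blinfun - Y) = A"
    by (simp add: blinfun_compose_distribs scaleR_2 algebra_simps)
  have nY: "norm Y \<le> 1"
    using Lim_norm_ubound[OF _ Y, of 1] norm_sqrt_iter[OF n1] sqrt_iter_bound_range
    by (meson always_eventually order_trans trivial_limit_sequentially)
  have sa: "selfadj (?Y n)" for n
  proof (induction n)
    case (Suc n)
    then show ?case
      by (auto intro!: selfadj_scaleR selfadj_add selfadj_diff selfadj_compose selfadj_id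
          positive_selfadj[OF assms(1)])
  qed (simp add: selfadj_zero)
  have posn: "positive_op (id_blinfun - ?Y n)" for n
    using positive_norm_minus[OF sa[of n], of 1] norm_sqrt_iter[OF n1, of n] sqrt_iter_bound_range[of n]
    by auto
  have lim: "(\<lambda>n. id_blinfun - ?Y n) \<longlonglongrightarrow> id_blinfun - Y" by (intro tendsto_intros Y)
  have "positive_op (id_blinfun - Y)"
    using closed_sequentially[OF closed_positive _ lim] posn by blast
  then show ?thesis using sq lim that by blast
qed

definition op_sqrt :: "('h::chilbert_space) endo \<Rightarrow> 'h endo"
  where "op_sqrt A = (THE R. positive_op R \<and> R \<odot> R = A)"

lemma op_abs_eq_sqrt: "op_abs T = op_sqrt (op_adjoint T \<odot> T)"
  by (simp add: op_abs_def op_sqrt_def)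

text \<open>With \<open>y = R x - S x\<close> one has \<open>(R + S) y = 0\<close>; positivity splits this into \<open>R y = S y = 0\<close>, so
  \<open>\<parallel>y\<parallel>\<^sup>2 = \<langle>x, (R - S) y\<rangle> = 0\<close>.\<close>

lemma positive_square_unique:
  assumes R: "positive_op R" and S: "positive_op S" and eq: "R \<odot> R = S \<odot> S"
    and comm: "R \<odot> S = S \<odot> R"
  shows "R = S"
proof (rule blinfun_eqI)
  fix x
  let ?y = "R x - S x"
  have "(R + S) ?y = 0"
    using arg_cong[OF eq, of "\<lambda>A. A x"] arg_cong[OF comm, of "\<lambda>A. A x"] by (simp add: blinfun_lin)
  then have "inner (R ?y) ?y + inner (S ?y) ?y = 0"
    by (metis blinfun.add_left inner_add_left inner_zero_left)
  then have "inner (R ?y) ?y = 0" "inner (S ?y) ?y = 0"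
    using positive_nonneg[OF R, of ?y] positive_nonneg[OF S, of ?y] by auto
  then have z: "R ?y = 0" "S ?y = 0" using positive_zero_on R S by blast+
  have "inner ?y ?y = inner x (R ?y - S ?y)"
    by (simp add: inner_simps selfadjD[OF positive_selfadj[OF R]] selfadjD[OF positive_selfadj[OF S]] blinfun_lin)
  then show "R x = S x" using z by simp
qed

text \<open>Dividing by a bound \<open>c\<close> of the norm reduces to \<open>0 \<le> A \<le> 1\<close>.  The bound is left free so that one
  sequence of polynomials can serve two operators at once.\<close>

lemma op_sqrt_aux:
  fixes A :: "'h::chilbert_space endo"
  assumes A: "positive_op A" and c: "norm A \<le> c" "0 < c"
  shows "positive_op (op_sqrt A) \<and> op_sqrt A \<odot> op_sqrt A = A \<and>
    (\<lambda>n. sqrt c *\<^sub>R (id_blinfun - sqrt_iter ((1/c) *\<^sub>R A) n)) \<longlonglongrightarrow> op_sqrt A"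
proof -
  let ?A = "(1/c) *\<^sub>R A"
  have "positive_op ?A" using A c by (intro positive_scaleR) auto
  moreover have "positive_op (id_blinfun - ?A)"
    using positive_norm_minus[of ?A 1] \<open>positive_op ?A\<close> c by (simp add: positive_selfadj)
  ultimately obtain S where S: "positive_op S" "S \<odot> S = ?A"
    "(\<lambda>n. id_blinfun - sqrt_iter ?A n) \<longlonglongrightarrow> S" by (rule sqrt_iter_limit)
  let ?S = "sqrt c *\<^sub>R S"
  have lim: "(\<lambda>n. sqrt c *\<^sub>R (id_blinfun - sqrt_iter ?A n)) \<longlonglongrightarrow> ?S" by (intro tendsto_intros S)
  have pos: "positive_op ?S" using S c by (intro positive_scaleR) auto
  have sq: "?S \<odot> ?S = A" using c S(2) by (simp add: blinfun_compose_distribs)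
  have "op_sqrt A = ?S" unfolding op_sqrt_def
  proof (rule the_equality)
    fix R assume R: "positive_op R \<and> R \<odot> R = A"
    then have "A \<odot> R = R \<odot> A" by (metis blinfun_compose_assoc)
    then have "sqrt_iter ?A n \<in> {B. B \<odot> R = R \<odot> B}" for n
      by (intro sqrt_iter_in closed_algebra_commute) (simp add: blinfun_compose_distribs)
    then have "sqrt c *\<^sub>R (id_blinfun - sqrt_iter ?A n) \<in> {B. B \<odot> R = R \<odot> B}" for n
      by (simp add: blinfun_compose_distribs)
    from closed_sequentially[OF closed_Collect_commute this lim]
    have "R \<odot> ?S = ?S \<odot> R" by simp
    then show "R = ?S" using positive_square_unique pos sq R by metis
  qed (use pos sq in blast)
  with pos sq lim show ?thesis by simp
qed

lemma positive_op_sqrt: "positive_op A \<Longrightarrow> positive_op (op_sqrt A)"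
  and op_sqrt_square: "positive_op A \<Longrightarrow> op_sqrt A \<odot> op_sqrt A = A"
  using op_sqrt_aux[of A "norm A + 1"] by (auto simp: add_nonneg_pos)

lemma op_sqrt_in_pair:
  assumes "closed_pair_algebra J" "(A, B) \<in> J" "positive_op A" "positive_op B"
  shows "(op_sqrt A, op_sqrt B) \<in> J"
proof (rule closed_sequentially[OF closed_pair_algebraD(1)[OF assms(1)]])
  let ?c = "norm A + norm B + 1"
  have c: "norm A \<le> ?c" "norm B \<le> ?c" "0 < ?c" by (auto simp: add_nonneg_pos)
  show "(\<lambda>n. (sqrt ?c *\<^sub>R (id_blinfun - sqrt_iter ((1/?c) *\<^sub>R A) n),
      sqrt ?c *\<^sub>R (id_blinfun - sqrt_iter ((1/?c) *\<^sub>R B) n))) \<longlonglongrightarrow> (op_sqrt A, op_sqrt B)"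
    using op_sqrt_aux[OF assms(3) c(1,3)] op_sqrt_aux[OF assms(4) c(2,3)] by (intro tendsto_Pair) auto
  show "(sqrt ?c *\<^sub>R (id_blinfun - sqrt_iter ((1/?c) *\<^sub>R A) n),
      sqrt ?c *\<^sub>R (id_blinfun - sqrt_iter ((1/?c) *\<^sub>R B) n)) \<in> J" for n
    by (intro closed_pair_algebraD[OF assms(1)] sqrt_iter_in_pair assms)
qed

lemma op_sqrt_in:
  "closed_algebra \<A> \<Longrightarrow> A \<in> \<A> \<Longrightarrow> positive_op A \<Longrightarrow> op_sqrt A \<in> \<A>"
  using op_sqrt_in_pair[OF closed_pair_algebra_Times, of \<A> \<A> A A] by auto

lemma op_sqrt_commute:
  "positive_op A \<Longrightarrow> A \<odot> B = B \<odot> A \<Longrightarrow> op_sqrt A \<odot> B = B \<odot> op_sqrt A"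
  using op_sqrt_in[OF closed_algebra_commute, of A B] by simp

lemma op_sqrt_eqI:
  assumes "positive_op R" "R \<odot> R = A"
  shows "op_sqrt A = R"
proof -
  have A: "positive_op A" using assms positive_square positive_selfadj by blast
  have "A \<odot> R = R \<odot> A" using assms by (metis blinfun_compose_assoc)
  then show ?thesis
    by (intro positive_square_unique[OF positive_op_sqrt[OF A] assms(1) _ op_sqrt_commute[OF A]])
      (simp_all only: op_sqrt_square[OF A] assms(2))
qed

text \<open>\<open>A B = A\<^sup>1\<^sup>/\<^sup>2 B A\<^sup>1\<^sup>/\<^sup>2\<close>.\<close>

lemma positive_compose_commuting:
  assumes A: "positive_op A" and B: "positive_op B" and comm: "A \<odot> B = B \<odot> A"
  shows "positive_op (A \<odot> B)"
proof -
  let ?R = "op_sqrt A"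
  have "?R \<odot> B \<odot> ?R = A \<odot> B"
    using op_sqrt_commute[OF A comm] op_sqrt_square[OF A] by (metis blinfun_compose_assoc)
  then show ?thesis
    using positive_sandwich[OF B positive_selfadj[OF positive_op_sqrt[OF A]]] by simp
qed

lemma positive_op_abs: "T \<in> bounded_operators \<Longrightarrow> positive_op (op_abs T)"
  and op_abs_square: "T \<in> bounded_operators \<Longrightarrow> op_abs T \<odot> op_abs T = op_adjoint T \<odot> T"
  by (simp_all add: op_abs_eq_sqrt positive_op_sqrt op_sqrt_square positive_adjoint_self)

lemma op_abs_eqI: "positive_op R \<Longrightarrow> R \<odot> R = op_adjoint T \<odot> T \<Longrightarrow> op_abs T = R"
  by (simp add: op_abs_eq_sqrt op_sqrt_eqI)

lemma norm_op_abs_apply: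
  assumes "T \<in> bounded_operators" shows "norm (op_abs T x) = norm (T x)"
proof -
  have "inner (op_abs T x) (op_abs T x) = inner x ((op_abs T \<odot> op_abs T) x)"
    using selfadjD[OF positive_selfadj[OF positive_op_abs[OF assms]], of x "op_abs T x"] by simp
  also have "\<dots> = inner (T x) (T x)"
    by (simp add: op_abs_square assms inner_op_adjoint[OF assms])
  finally show ?thesis by (simp add: norm_eq_sqrt_inner)
qed

lemma norm_op_abs: "T \<in> bounded_operators \<Longrightarrow> norm (op_abs T) = norm T"
  by (intro antisym norm_blinfun_bound) (simp_all add: norm_op_abs_apply norm_blinfun, metis norm_op_abs_apply norm_blinfun)

text \<open>With \<open>c = K + e\<close> and \<open>K = \<parallel>A\<parallel>\<close>, the equation \<open>(A + e) G = 1\<close> reads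
  \<open>G = (1 + (K - A) G) / c\<close>, a fixed point of a map that contracts by \<open>K / c\<close>.\<close>

lemma inverse_shifted_positive:
  fixes A :: "'h::chilbert_space endo"
  assumes A: "positive_op A" and e: "0 < e" and alg: "closed_algebra \<A>" "A \<in> \<A>"
  obtains G where "G \<in> \<A>" "(A + e *\<^sub>R id_blinfun) \<odot> G = id_blinfun"
    "G \<odot> (A + e *\<^sub>R id_blinfun) = id_blinfun"
proof -
  define K where "K = norm A"
  define c where "c = K + e"
  have K: "0 \<le> K" "c > 0" "K < c" using e by (auto simp: K_def c_def add_nonneg_pos)
  let ?D = "K *\<^sub>R id_blinfun - A"
  have D: "norm ?D \<le> K"
    by (rule norm_le_of_positive_le[OF positive_norm_minus])
      (use A K positive_nonneg[OF A] in \<open>auto simp: K_def positive_selfadj blinfun_lin inner_simps power2_norm_eq_inner\<close>)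
  define B where "B = \<A> \<inter> {G. G \<odot> A = A \<odot> G}"
  have B: "closed_algebra B" unfolding B_def by (intro closed_algebra_Int alg closed_algebra_commute)
  have AB: "A \<in> B" using alg by (simp add: B_def)
  have "\<exists>!G. G \<in> B \<and> (1/c) *\<^sub>R (id_blinfun + ?D \<odot> G) = G"
  proof (rule Banach_fix[of B "K / c"])
    show "complete B" using closed_algebraD(1)[OF B] by (simp add: complete_eq_closed)
    show "B \<noteq> {}" using AB by blast
    show "0 \<le> K / c" "K / c < 1" using K by auto
    show "(\<lambda>G. (1/c) *\<^sub>R (id_blinfun + ?D \<odot> G)) ` B \<subseteq> B"
      using AB by (auto intro!: closed_algebraD(2-)[OF B])
    fix G H
    have "dist ((1/c) *\<^sub>R (id_blinfun + ?D \<odot> G)) ((1/c) *\<^sub>R (id_blinfun + ?D \<odot> H))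
        = norm (?D \<odot> (G - H)) / c"
      using K by (simp add: dist_norm scaleR_diff_right[symmetric] blinfun_compose_distribs)
    also have "\<dots> \<le> K * norm (G - H) / c"
      by (intro divide_right_mono order_trans[OF norm_blinfun_compose] mult_right_mono D)
        (use K in auto)
    finally show "dist ((1/c) *\<^sub>R (id_blinfun + ?D \<odot> G)) ((1/c) *\<^sub>R (id_blinfun + ?D \<odot> H))
        \<le> K / c * dist G H" by (simp add: dist_norm)
  qed
  then obtain G where G: "G \<in> B" "(1/c) *\<^sub>R (id_blinfun + ?D \<odot> G) = G" by blast
  then have "c *\<^sub>R G = id_blinfun + ?D \<odot> G"
    by (metis (no_types, lifting) K(2) divide_inverse less_numeral_extra(3) mult_1 scaleR_right_imp_eq right_inverse scaleR_one scaleR_scaleR)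
  then have 1: "(A + e *\<^sub>R id_blinfun) \<odot> G = id_blinfun"
    by (simp add: c_def blinfun_compose_distribs scaleR_left_distrib algebra_simps)
  moreover have "G \<odot> (A + e *\<^sub>R id_blinfun) = id_blinfun"
    using 1 G(1) by (simp add: B_def blinfun_compose_distribs)
  ultimately show ?thesis using G(1) that unfolding B_def by blast
qed

text \<open>\<open>V = T (|T| + e)\<^sup>-\<^sup>1\<close> replaces the partial isometry of the polar decomposition; unlike the
  latter it lies in every closed algebra that contains \<open>T\<close> and \<open>|T|\<close>.\<close>

lemma approximate_polar_decomposition:
  fixes T :: "'h::chilbert_space endo"
  assumes T: "T \<in> bounded_operators" and e: "0 < e" and alg: "closed_algebra \<A>" "T \<in> \<A>" "op_abs T \<in> \<A>"
  obtains V where "V \<in> \<A>" "V \<in> bounded_operators" "norm V \<le> 1"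
    "norm (T - V \<odot> op_abs T) \<le> e" "norm (op_abs T - op_adjoint V \<odot> T) \<le> e"
proof -
  let ?R = "op_abs T"
  have R: "positive_op ?R" using T by (rule positive_op_abs)
  have bop: "closed_algebra (\<A> \<inter> bounded_operators)"
    by (intro closed_algebra_Int alg closed_algebra_bounded_operators)
  obtain G where G: "G \<in> \<A>" "G \<in> bounded_operators" "(?R + e *\<^sub>R id_blinfun) \<odot> G = id_blinfun"
    "G \<odot> (?R + e *\<^sub>R id_blinfun) = id_blinfun"
    using inverse_shifted_positive[OF R e bop] alg positive_bop[OF R] by blast
  have RG: "?R (G x) + e *\<^sub>R G x = x" "G (?R x) + e *\<^sub>R G x = x" for x
    using arg_cong[OF G(3), of "\<lambda>A. A x"] arg_cong[OF G(4), of "\<lambda>A. A x"] by (simp_all add: blinfun_lin)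
  have saR: "inner (?R x) y = inner x (?R y)" for x y using R positive_selfadj selfadjD by blast
  have Gsa: "op_adjoint G = G"
  proof (rule op_adjoint_eqI[OF G(2)])
    fix x y
    have "inner (G x) y = inner (G x) (?R (G y) + e *\<^sub>R G y)" by (simp only: RG)
    also have "\<dots> = inner (?R (G x) + e *\<^sub>R G x) (G y)" by (simp add: inner_simps saR)
    finally show "inner (G x) y = inner x (G y)" by (simp only: RG)
  qed
  have bd: "norm (?R (G x)) \<le> norm x \<and> e * norm (G x) \<le> norm x" for x
  proof -
    let ?y = "G x"
    have "(norm x)\<^sup>2 = (norm (?R ?y + e *\<^sub>R ?y))\<^sup>2" by (simp only: RG)
    also have "\<dots> = (norm (?R ?y))\<^sup>2 + 2 * e * inner (?R ?y) ?y + (e * norm ?y)\<^sup>2"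
      unfolding power_mult_distrib power2_norm_eq_inner
      by (simp add: inner_simps inner_commute power2_eq_square algebra_simps)
    finally have "(norm x)\<^sup>2 = (norm (?R ?y))\<^sup>2 + 2 * e * inner (?R ?y) ?y + (e * norm ?y)\<^sup>2" .
    moreover have "0 \<le> 2 * e * inner (?R ?y) ?y" using e positive_nonneg[OF R, of ?y] by simp
    ultimately have "(norm (?R ?y))\<^sup>2 \<le> (norm x)\<^sup>2" "(e * norm ?y)\<^sup>2 \<le> (norm x)\<^sup>2"
      using zero_le_power2[of "norm (?R ?y)"] zero_le_power2[of "e * norm ?y"] by linarith+
    then show ?thesis using power2_le_imp_le norm_ge_zero by blast
  qed
  let ?V = "T \<odot> G"
  have V1: "norm ?V \<le> 1"
    by (rule norm_blinfun_bound) (use bd norm_op_abs_apply[OF T] in auto)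
  have "T - ?V \<odot> ?R = e *\<^sub>R ?V"
  proof (rule blinfun_eqI)
    fix x
    have "T x = T (G (?R x) + e *\<^sub>R G x)" by (simp only: RG)
    then show "(T - ?V \<odot> ?R) x = (e *\<^sub>R ?V) x" by (simp add: blinfun_lin)
  qed
  then have 1: "norm (T - ?V \<odot> ?R) \<le> e" using V1 e by simp
  have "?R - op_adjoint ?V \<odot> T = e *\<^sub>R (?R \<odot> G)"
  proof (rule blinfun_eqI)
    fix x
    have comm: "?R (G y) = G (?R y)" for y using RG[of y] by (metis add_right_cancel)
    have "op_adjoint T (T x) = ?R (?R x)"
      using arg_cong[OF op_abs_square[OF T], of "\<lambda>A. A x"] by simp
    then have "(?R - op_adjoint ?V \<odot> T) x = ?R x - G (?R (?R x))"
      by (simp add: op_adjoint_compose[OF T G(2)] Gsa blinfun_lin)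
    also have "\<dots> = e *\<^sub>R ?R (G x)" using RG(2)[of "?R x"] comm[of x] by (metis add_diff_cancel_left')
    finally show "(?R - op_adjoint ?V \<odot> T) x = (e *\<^sub>R (?R \<odot> G)) x"
      by (simp add: blinfun_lin)
  qed
  moreover have "norm (?R \<odot> G) \<le> 1" by (rule norm_blinfun_bound) (use bd in auto)
  ultimately have 2: "norm (?R - op_adjoint ?V \<odot> T) \<le> e" using e by simp
  show ?thesis
    using that[of ?V] 1 2 V1 G alg T by (simp add: closed_algebraD(5)[OF alg(1)] bop_compose)
qed

section \<open>Finite von Neumann algebras: closure properties and the trace\<close>

lemma subspace_closure:
  fixes S :: "'a::real_normed_vector set"
  assumes "subspace S" shows "subspace (closure S)"
  unfolding subspace_def
proof (intro conjI ballI allI)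
  show "0 \<in> closure S" using subspace_0[OF assms] closure_subset by blast
  fix x y assume "x \<in> closure S" "y \<in> closure S"
  then obtain f g where "\<forall>n. f n \<in> S" "f \<longlonglongrightarrow> x" "\<forall>n. g n \<in> S" "g \<longlonglongrightarrow> y"
    unfolding closure_sequential by blast
  then show "x + y \<in> closure S" unfolding closure_sequential
    by (intro exI[of _ "\<lambda>n. f n + g n"]) (auto intro: tendsto_add subspace_add[OF assms])
next
  fix c x assume "x \<in> closure S"
  then obtain f where "\<forall>n. f n \<in> S" "f \<longlonglongrightarrow> x" unfolding closure_sequential by blast
  then show "c *\<^sub>R x \<in> closure S" unfolding closure_sequential
    by (intro exI[of _ "\<lambda>n. c *\<^sub>R f n"]) (auto intro: tendsto_scaleR subspace_scale[OF assms])
qed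

lemma norm_op_adjoint_le:
  assumes "A \<in> bounded_operators" shows "norm (op_adjoint A) \<le> norm A"
proof (rule norm_blinfun_bound)
  fix x
  let ?y = "op_adjoint A x"
  have "(norm ?y)\<^sup>2 = inner (A ?y) x"
    by (simp add: inner_op_adjoint[OF assms] power2_norm_eq_inner)
  also have "\<dots> \<le> norm (A ?y) * norm x" by (rule norm_cauchy_schwarz)
  also have "\<dots> \<le> norm A * norm ?y * norm x" by (intro mult_right_mono norm_blinfun) simp
  finally show "norm ?y \<le> norm A * norm x"
    by (cases "?y = 0") (auto simp: power2_eq_square mult_ac)
qed simp

lemma commutant_adjoint:
  assumes "M \<subseteq> bounded_operators" "\<And>A. A \<in> M \<Longrightarrow> op_adjoint A \<in> M" "B \<in> commutant M"
  shows "op_adjoint B \<in> commutant M"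
proof -
  have B: "B \<in> bounded_operators" "\<And>A. A \<in> M \<Longrightarrow> A \<odot> B = B \<odot> A"
    using assms(3) by (auto simp: commutant_def)
  have "A \<odot> op_adjoint B = op_adjoint B \<odot> A" if "A \<in> M" for A
  proof -
    have "op_adjoint (op_adjoint A \<odot> B) = op_adjoint (B \<odot> op_adjoint A)"
      using B(2)[OF assms(2)[OF that]] by simp
    then show ?thesis using assms(1) that B(1)
      by (simp add: op_adjoint_compose op_adjoint_involutive op_adjoint_bop subset_iff)
  qed
  with B(1) show ?thesis by (simp add: commutant_def op_adjoint_bop)
qed

lemma closed_algebra_INT: "(\<And>i. i \<in> I \<Longrightarrow> closed_algebra (F i)) \<Longrightarrow> closed_algebra (\<Inter>i\<in>I. F i)"
  by (auto simp: closed_algebra_def)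

lemma closed_algebra_commutant: "closed_algebra (commutant M)"
proof -
  have "commutant M = bounded_operators \<inter> (\<Inter>A\<in>M. {B. B \<odot> A = A \<odot> B})"
    by (auto simp: commutant_def)
  moreover have "closed_algebra (\<Inter>A\<in>M. {B. B \<odot> A = A \<odot> B})"
    by (intro closed_algebra_INT closed_algebra_commute)
  ultimately show ?thesis by (simp add: closed_algebra_Int closed_algebra_bounded_operators)
qed

locale finite_vn_algebra =
  fixes M :: "('h::chilbert_space \<Rightarrow>\<^sub>L 'h) set" and \<tau> :: "('h \<Rightarrow>\<^sub>L 'h) \<Rightarrow> complex"
  assumes fvn: "finite_von_neumann_algebra M \<tau>"
begin

definition tr :: "'h endo \<Rightarrow> real" where "tr A = Re (\<tau> A)"

definition proj :: "'h endo \<Rightarrow> bool" where "proj P \<longleftrightarrow> P \<in> M \<and> selfadj P \<and> P \<odot> P = P"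

lemma bop: "A \<in> M \<Longrightarrow> A \<in> bounded_operators"
  and adj_in: "A \<in> M \<Longrightarrow> op_adjoint A \<in> M"
  and bicommutant: "commutant (commutant M) = M"
  using fvn by (auto simp: finite_von_neumann_algebra_def von_neumann_algebra_def)

lemma alg: "closed_algebra M"
  using closed_algebra_commutant[of "commutant M"] by (simp add: bicommutant)

lemma M_closed: "closed M" by (rule closed_algebraD(1)[OF alg])
lemma id_in: "id_blinfun \<in> M" by (rule closed_algebraD(2)[OF alg])
lemma add_in: "A \<in> M \<Longrightarrow> B \<in> M \<Longrightarrow> A + B \<in> M" by (rule closed_algebraD(3)[OF alg])
lemma diff_in: "A \<in> M \<Longrightarrow> B \<in> M \<Longrightarrow> A - B \<in> M" by (rule closed_algebraD(4)[OF alg])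
lemma compose_in: "A \<in> M \<Longrightarrow> B \<in> M \<Longrightarrow> A \<odot> B \<in> M" by (rule closed_algebraD(5)[OF alg])
lemma scaleR_in: "A \<in> M \<Longrightarrow> r *\<^sub>R A \<in> M" by (rule closed_algebraD(6)[OF alg])
lemma zero_in: "0 \<in> M" using scaleR_in[OF id_in, of 0] by simp
lemma sum_in: "(\<And>i. i \<in> I \<Longrightarrow> f i \<in> M) \<Longrightarrow> (\<Sum>i\<in>I. f i) \<in> M"
  by (induction I rule: infinite_finite_induct) (auto simp: zero_in add_in)

lemma scaleC_id_commutant: "c *\<^sub>C id_blinfun \<in> commutant M"
  by (auto simp: commutant_def bop_scaleC bop_id blinfun_apply_scaleC bopD bop intro!: blinfun_eqI)

lemma scaleC_in: assumes "A \<in> M" shows "c *\<^sub>C A \<in> M"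
proof -
  have "B \<odot> (c *\<^sub>C A) = (c *\<^sub>C A) \<odot> B" if "B \<in> commutant M" for B
  proof (rule blinfun_eqI)
    fix x
    have "B \<in> bounded_operators" "A \<odot> B = B \<odot> A" using that assms by (auto simp: commutant_def)
    then show "(B \<odot> (c *\<^sub>C A)) x = ((c *\<^sub>C A) \<odot> B) x"
      by (metis blinfun_apply_blinfun_compose blinfun_apply_scaleC bopD)
  qed
  then have "c *\<^sub>C A \<in> commutant (commutant M)"
    using bop_scaleC[OF bop[OF assms]] by (simp add: commutant_def)
  then show ?thesis by (simp add: bicommutant)
qed

lemma sqrt_in: "A \<in> M \<Longrightarrow> positive_op A \<Longrightarrow> op_sqrt A \<in> M"
  by (rule op_sqrt_in[OF alg])

lemma abs_in: "A \<in> M \<Longrightarrow> op_abs A \<in> M"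
  unfolding op_abs_eq_sqrt by (intro sqrt_in compose_in adj_in positive_adjoint_self bop)

lemmas in_M = id_in zero_in add_in diff_in compose_in scaleR_in scaleC_in sum_in adj_in abs_in

lemma projD: "proj P \<Longrightarrow> P \<in> M" "proj P \<Longrightarrow> selfadj P" "proj P \<Longrightarrow> P \<odot> P = P"
  by (simp_all add: proj_def)

lemma proj_apply: "proj P \<Longrightarrow> P (P x) = P x"
  by (metis projD(3) blinfun_apply_blinfun_compose)

lemma proj_positive: "proj P \<Longrightarrow> positive_op P"
  using positive_square[of P] by (simp add: proj_def)

lemma proj_id: "proj id_blinfun" and proj_zero: "proj 0"
  by (simp_all add: proj_def id_in selfadj_id zero_in selfadj_zero)

lemma proj_compl: "proj P \<Longrightarrow> proj (id_blinfun - P)"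
  by (auto simp: proj_def in_M selfadj_diff selfadj_id blinfun_compose_distribs)

lemma proj_compose: assumes "proj P" "proj Q" "P \<odot> Q = Q \<odot> P" shows "proj (P \<odot> Q)"
proof -
  have "(P \<odot> Q) \<odot> (P \<odot> Q) = (P \<odot> P) \<odot> (Q \<odot> Q)"
    using assms(3) by (metis blinfun_compose_assoc)
  then show ?thesis using assms by (simp add: proj_def in_M selfadj_compose)
qed

lemma proj_le_commute:
  assumes "proj P" "proj Q" "P \<odot> Q = Q" shows "Q \<odot> P = Q"
  using arg_cong[OF assms(3), of op_adjoint] assms(1,2)
  by (simp add: op_adjoint_compose proj_def selfadj_iff)

lemma proj_orth_commute:
  assumes "proj P" "proj Q" "P \<odot> Q = 0" shows "Q \<odot> P = 0"
proof -
  have "op_adjoint (0 :: 'h endo) = 0" using selfadj_zero unfolding selfadj_iff by blast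
  then show ?thesis using arg_cong[OF assms(3), of op_adjoint] assms(1,2)
    by (simp add: op_adjoint_compose proj_def selfadj_iff)
qed

lemma proj_diff:
  assumes "proj P" "proj Q" "P \<odot> Q = Q" shows "proj (P - Q)"
  using assms proj_le_commute[OF assms]
  by (simp add: proj_def in_M selfadj_diff blinfun_compose_distribs)

lemma proj_add:
  assumes "proj P" "proj Q" "P \<odot> Q = 0" shows "proj (P + Q)"
  using assms proj_orth_commute[OF assms]
  by (simp add: proj_def in_M selfadj_add blinfun_compose_distribs)

lemma proj_norm: assumes "proj P" shows "norm P \<le> 1"
proof (rule norm_le_of_positive_le[OF proj_positive[OF assms]])
  fix x
  show "inner (P x) x \<le> 1 * (norm x)\<^sup>2"
    using positive_nonneg[OF proj_positive[OF proj_compl[OF assms]], of x]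
    by (simp add: blinfun_lin inner_simps power2_norm_eq_inner)
qed simp

text \<open>The multiplication by \<open>\<i>\<close> lies in the commutant, so invariance under the commutant
  includes complex linearity of the projection.\<close>

lemma proj_onto_closure:
  assumes S: "subspace S" and inv: "\<And>B x. B \<in> commutant M \<Longrightarrow> x \<in> S \<Longrightarrow> B x \<in> S"
  obtains P where "proj P" "\<And>x. P x \<in> closure S" "\<And>x. x \<in> S \<Longrightarrow> P x = x"
proof -
  obtain P :: "'h endo" where P: "\<And>x. P x \<in> closure S" "\<And>x y. y \<in> closure S \<Longrightarrow> inner (x - P x) y = 0"
    using orthogonal_projection_exists[of "closure S"] S by (metis closed_closure subspace_closure)
  have cl: "B x \<in> closure S" if "B \<in> commutant M" "x \<in> closure S" for B x
  proof -
    have "blinfun_apply B ` closure S \<subseteq> closure (blinfun_apply B ` S)"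
      by (intro continuous_image_closure_subset[of UNIV] continuous_intros) auto
    also have "\<dots> \<subseteq> closure S" using inv[OF that(1)] by (intro closure_mono) auto
    finally show ?thesis using that(2) by blast
  qed
  have sub: "subspace (closure S)" using S by (rule subspace_closure)
  have fixed: "P x = x" if "x \<in> closure S" for x
  proof -
    have "x - P x \<in> closure S" using P(1) that sub by (simp add: subspace_diff)
    then have "inner (x - P x) (x - P x) = 0" by (rule P(2))
    then show ?thesis by simp
  qed
  have zero: "P x = 0" if "\<And>y. y \<in> closure S \<Longrightarrow> inner x y = 0" for x
  proof -
    have "inner (P x) (P x) = 0"
      using P(2)[OF P(1)[of x], of x] that[OF P(1)[of x]] by (simp add: inner_diff_left)
    then show ?thesis by simp
  qed
  have comm: "P (B x) = B (P x)" if B: "B \<in> commutant M" for B x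
  proof -
    have Bb: "B \<in> bounded_operators" using B by (simp add: commutant_def)
    have Ba: "op_adjoint B \<in> commutant M"
      using commutant_adjoint[OF _ _ B] bop adj_in by blast
    have "P (B (x - P x)) = 0"
      by (rule zero) (simp add: inner_op_adjoint[OF Bb] P(2) cl[OF Ba])
    moreover have "P (B (P x)) = B (P x)" by (intro fixed cl[OF B] P(1))
    ultimately show ?thesis by (simp add: blinfun_lin)
  qed
  have "P \<in> bounded_operators"
    using comm[OF scaleC_id_commutant] by (auto simp: bounded_operators_def blinfun_apply_scaleC)
  moreover have "inner (P x) y = inner x (P y)" for x y
  proof -
    have "inner (P x) y = inner (P x) (P y)"
      using P(2)[OF P(1)[of x], of y] by (simp add: inner_diff_left inner_diff_right inner_commute[of _ "P x"])
    also have "\<dots> = inner x (P y)" using P(2)[OF P(1)[of y], of x] by (simp add: inner_diff_left)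
    finally show ?thesis .
  qed
  ultimately have sa: "selfadj P" by (simp add: selfadj_def)
  have "P \<in> commutant (commutant M)"
    using comm selfadj_bop[OF sa] by (auto simp: commutant_def intro!: blinfun_eqI)
  then have "P \<in> M" by (simp add: bicommutant)
  moreover have "P \<odot> P = P" by (rule blinfun_eqI) (simp add: fixed P(1))
  ultimately have "proj P" using sa by (simp add: proj_def)
  moreover have "P x = x" if "x \<in> S" for x using fixed closure_subset that by blast
  ultimately show ?thesis using that P(1) by blast
qed

text \<open>The three conditions determine the projection, so the choice is not arbitrary.\<close>

definition range_proj :: "'h endo \<Rightarrow> 'h endo"
  where "range_proj C = (SOME P. proj P \<and> (\<forall>x. P x \<in> closure (range C)) \<and> P \<odot> C = C)"

lemma range_proj:
  assumes "C \<in> M"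
  shows "proj (range_proj C)" "range_proj C x \<in> closure (range C)" "range_proj C \<odot> C = C"
proof -
  have "subspace (range C)"
    by (intro linear_subspace_image) (auto intro: bounded_linear.linear blinfun.bounded_linear_right)
  moreover have "B x \<in> range C" if B: "B \<in> commutant M" and x: "x \<in> range C" for B x
  proof -
    obtain y where y: "x = C y" using x by blast
    have "C \<odot> B = B \<odot> C" using B assms by (simp add: commutant_def)
    then show ?thesis using y by (metis blinfun_apply_blinfun_compose rangeI)
  qed
  ultimately obtain P where "proj P" "\<And>x. P x \<in> closure (range C)" "\<And>x. x \<in> range C \<Longrightarrow> P x = x"
    using proj_onto_closure by blast
  then have "\<exists>P. proj P \<and> (\<forall>x. P x \<in> closure (range C)) \<and> P \<odot> C = C"
    by (intro exI[of _ P]) (auto intro!: blinfun_eqI)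
  from someI_ex[OF this] show "proj (range_proj C)" "range_proj C x \<in> closure (range C)"
    "range_proj C \<odot> C = C" unfolding range_proj_def by blast+
qed

lemma range_proj_selfadj:
  assumes "C \<in> M" "selfadj C" shows "C \<odot> range_proj C = C"
  using arg_cong[OF range_proj(3)[OF assms(1)], of op_adjoint] assms projD(1,2)[OF range_proj(1)[OF assms(1)]]
  by (simp add: op_adjoint_compose selfadj_iff bop)

lemma range_proj_kernel:
  assumes "C \<in> M" "D \<odot> C = 0" shows "D \<odot> range_proj C = 0"
proof (rule blinfun_eqI)
  fix x
  have "closed {y. D y = 0}" by (intro closed_Collect_eq continuous_intros)
  moreover have "range C \<subseteq> {y. D y = 0}"
    using arg_cong[OF assms(2), of "\<lambda>A. A z" for z] by auto
  ultimately have "closure (range C) \<subseteq> {y. D y = 0}" by (rule closure_minimal[rotated])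
  then show "(D \<odot> range_proj C) x = blinfun_apply 0 x" using range_proj(2)[OF assms(1), of x] by auto
qed

text \<open>\<open>B\<close> maps the range of \<open>C\<close> into itself; taking adjoints turns invariance into commutation.\<close>

lemma range_proj_commute:
  assumes C: "C \<in> M" "selfadj C" and B: "B \<in> M" "selfadj B" "B \<odot> C = C \<odot> B"
  shows "B \<odot> range_proj C = range_proj C \<odot> B"
proof -
  let ?e = "range_proj C"
  have "(?e \<odot> B) \<odot> C = B \<odot> C"
    using B(3) range_proj(3)[OF C(1)] by (metis blinfun_compose_assoc)
  then have "((id_blinfun - ?e) \<odot> B) \<odot> C = 0" by (simp add: blinfun_compose_distribs)
  from range_proj_kernel[OF C(1) this] have 1: "?e \<odot> B \<odot> ?e = B \<odot> ?e"
    by (simp add: blinfun_compose_distribs)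
  have e: "selfadj ?e" using range_proj(1)[OF C(1)] by (simp add: proj_def)
  have "op_adjoint (?e \<odot> B \<odot> ?e) = op_adjoint (B \<odot> ?e)" using 1 by simp
  then have "?e \<odot> B \<odot> ?e = ?e \<odot> B" using e B(2)
    by (simp add: op_adjoint_compose selfadj_iff bop_compose blinfun_compose_assoc)
  with 1 show ?thesis by simp
qed

subsection \<open>The trace\<close>

lemma state: "state_on M \<tau>" and tracial: "tracial_on M \<tau>" and faithful: "faithful_on M \<tau>"
  using fvn by (simp_all add: finite_von_neumann_algebra_def)

lemma tau_add: "A \<in> M \<Longrightarrow> B \<in> M \<Longrightarrow> \<tau> (A + B) = \<tau> A + \<tau> B"
  and tau_scaleC: "A \<in> M \<Longrightarrow> \<tau> (c *\<^sub>C A) = c * \<tau> A"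
  and tau_pos: "A \<in> M \<Longrightarrow> positive_op A \<Longrightarrow> \<tau> A \<in> \<real>\<^sub>\<ge>\<^sub>0"
  and tau_id: "\<tau> id_blinfun = 1"
  using state by (simp_all add: state_on_def)

lemma tau_commute: "A \<in> M \<Longrightarrow> B \<in> M \<Longrightarrow> \<tau> (A \<odot> B) = \<tau> (B \<odot> A)"
  using tracial unfolding tracial_on_def by blast

lemma tau_faithful: "A \<in> M \<Longrightarrow> positive_op A \<Longrightarrow> \<tau> A = 0 \<Longrightarrow> A = 0"
  using faithful unfolding faithful_on_def by blast

lemma tau_scaleR: "A \<in> M \<Longrightarrow> \<tau> (r *\<^sub>R A) = of_real r * \<tau> A"
  by (metis scaleC_of_real tau_scaleC)

lemma tau_zero: "\<tau> 0 = 0" using tau_scaleR[OF id_in, of 0] by simp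

lemma tau_diff: "A \<in> M \<Longrightarrow> B \<in> M \<Longrightarrow> \<tau> (A - B) = \<tau> A - \<tau> B"
  using tau_add[of A "(-1) *\<^sub>R B"] tau_scaleR[of B "-1"] scaleR_in[of B "-1"] by simp

lemma tau_sum: "(\<And>i. i \<in> I \<Longrightarrow> f i \<in> M) \<Longrightarrow> \<tau> (\<Sum>i\<in>I. f i) = (\<Sum>i\<in>I. \<tau> (f i))"
  by (induction I rule: infinite_finite_induct) (auto simp: tau_zero tau_add sum_in)

lemmas tau_simps = tau_add tau_diff tau_scaleR tau_zero tau_id tau_sum

lemma tr_add: "A \<in> M \<Longrightarrow> B \<in> M \<Longrightarrow> tr (A + B) = tr A + tr B"
  and tr_diff: "A \<in> M \<Longrightarrow> B \<in> M \<Longrightarrow> tr (A - B) = tr A - tr B"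
  and tr_scaleR: "A \<in> M \<Longrightarrow> tr (r *\<^sub>R A) = r * tr A"
  and tr_zero: "tr 0 = 0" and tr_id: "tr id_blinfun = 1"
  and tr_sum: "(\<And>i. i \<in> I \<Longrightarrow> f i \<in> M) \<Longrightarrow> tr (\<Sum>i\<in>I. f i) = (\<Sum>i\<in>I. tr (f i))"
  and tr_commute: "A \<in> M \<Longrightarrow> B \<in> M \<Longrightarrow> tr (A \<odot> B) = tr (B \<odot> A)"
  by (simp_all add: tr_def tau_simps tau_commute[of A B])

lemma tau_positive: "A \<in> M \<Longrightarrow> positive_op A \<Longrightarrow> \<tau> A = of_real (tr A)"
  using tau_pos by (simp add: tr_def complex_nonneg_Reals_iff complex_eq_iff)

lemma tr_nonneg: "A \<in> M \<Longrightarrow> positive_op A \<Longrightarrow> 0 \<le> tr A"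
  using tau_pos by (simp add: tr_def complex_nonneg_Reals_iff)

lemma tr_mono: "A \<in> M \<Longrightarrow> B \<in> M \<Longrightarrow> positive_op (B - A) \<Longrightarrow> tr A \<le> tr B"
  using tr_nonneg[of "B - A"] by (simp add: diff_in tr_diff)

lemma tr_faithful: "A \<in> M \<Longrightarrow> positive_op A \<Longrightarrow> tr A = 0 \<Longrightarrow> A = 0"
  using tau_faithful[of A] tau_positive[of A] by simp

text \<open>\<open>A = \<parallel>A\<parallel> - (\<parallel>A\<parallel> - A)\<close> is a difference of positive elements.\<close>

lemma tau_selfadj: assumes "A \<in> M" "selfadj A" shows "\<tau> A = of_real (tr A)"
proof -
  let ?c = "norm A *\<^sub>R id_blinfun"
  have "\<tau> (?c - A) = of_real (tr (?c - A))"
    using assms by (intro tau_positive positive_norm_minus) (auto simp: in_M)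
  then show ?thesis using assms by (simp add: tau_simps tr_diff tr_scaleR tr_id in_M)
qed

text \<open>\<open>A + A\<^sup>*\<close> and \<open>\<i> (A - A\<^sup>*)\<close> are self-adjoint, so their traces are real.\<close>

lemma tau_adjoint: assumes "A \<in> M" shows "\<tau> (op_adjoint A) = cnj (\<tau> A)"
proof -
  have A: "op_adjoint A \<in> M" "A \<in> bounded_operators" "op_adjoint A \<in> bounded_operators"
    using assms by (simp_all add: adj_in bop)
  have "selfadj (A + op_adjoint A)" using A
    by (simp add: selfadj_iff bop_add op_adjoint_add op_adjoint_involutive add.commute)
  from tau_selfadj[OF _ this] have 1: "Im (\<tau> A) + Im (\<tau> (op_adjoint A)) = 0"
    using assms A by (simp add: add_in tau_add complex_eq_iff)
  let ?D = "\<i> *\<^sub>C (A - op_adjoint A)"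
  have "op_adjoint ?D = ?D"
  proof -
    have "op_adjoint ?D = (- \<i>) *\<^sub>C (op_adjoint A - A)"
      using A by (simp add: op_adjoint_scaleC bop_diff op_adjoint_diff op_adjoint_involutive)
    also have "\<dots> = ?D"
    proof (rule blinfun_eqI)
      fix x
      have "(- \<i>) *\<^sub>C y = - (\<i> *\<^sub>C y)" for y :: 'h
        by (metis mult_minus1 scaleC_scaleC scaleC_of_real of_real_minus of_real_1 scaleR_minus1_left)
      then show "blinfun_apply ((- \<i>) *\<^sub>C (op_adjoint A - A)) x = ?D x"
        by (simp add: blinfun_apply_scaleC blinfun_lin scaleC_diff_right)
    qed
    finally show ?thesis .
  qed
  then have "selfadj ?D" using A by (simp add: selfadj_iff bop_diff bop_scaleC)
  from tau_selfadj[OF _ this] have "Re (\<tau> A) = Re (\<tau> (op_adjoint A))"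
    using assms A by (simp add: diff_in scaleC_in tau_scaleC tau_diff complex_eq_iff)
  with 1 show ?thesis by (simp add: complex_eq_iff)
qed

text \<open>A unimodular factor \<open>w\<close> makes the trace of \<open>w C R = D R\<close> real.  Written as the trace of \<open>S D S\<close> with
  \<open>S = R\<^sup>1\<^sup>/\<^sup>2\<close>, it depends only on the self-adjoint part \<open>H\<close> of \<open>D\<close>, and \<open>H \<le> \<parallel>C\<parallel>\<close>.\<close>

lemma tau_compose_positive_bound:
  assumes C: "C \<in> M" and R: "R \<in> M" "positive_op R"
  shows "cmod (\<tau> (C \<odot> R)) \<le> norm C * tr R"
proof (cases "\<tau> (C \<odot> R) = 0")
  case True
  then show ?thesis using tr_nonneg[OF R] by simp
next
  case False
  define z where "z = \<tau> (C \<odot> R)"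
  define w where "w = cnj z / cmod z"
  define D where "D = w *\<^sub>C C"
  have w: "cmod w = 1" using False by (simp add: w_def z_def norm_divide)
  have D: "D \<in> M" "norm D \<le> norm C"
  proof -
    show "D \<in> M" using C by (simp add: D_def scaleC_in)
    show "norm D \<le> norm C"
      by (rule norm_blinfun_bound) (simp_all add: D_def blinfun_apply_scaleC norm_scaleC w norm_blinfun)
  qed
  define S where "S = op_sqrt R"
  have S: "S \<in> M" "selfadj S" "S \<odot> S = R" "op_adjoint S = S"
    using sqrt_in[OF R] op_sqrt_square[OF R(2)] positive_selfadj[OF positive_op_sqrt[OF R(2)]]
    by (auto simp: S_def selfadj_iff)
  have "D \<odot> R = w *\<^sub>C (C \<odot> R)"
    by (rule blinfun_eqI) (simp add: D_def blinfun_apply_scaleC)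
  then have "\<tau> (D \<odot> R) = w * z" using C R by (simp add: z_def tau_scaleC compose_in)
  also have "\<dots> = of_real (cmod z)"
  proof -
    have "w * z = of_real ((cmod z)\<^sup>2) / of_real (cmod z)"
      by (simp only: w_def complex_norm_square) (simp add: mult.commute)
    then show ?thesis using False by (simp add: z_def power2_eq_square)
  qed
  finally have 1: "cmod z = tr (D \<odot> R)" by (simp add: tr_def)
  also have "\<dots> = tr (S \<odot> D \<odot> S)"
    using tr_commute[of S "D \<odot> S"] D S by (simp add: compose_in blinfun_compose_assoc)
  finally have 1: "cmod z = tr (S \<odot> D \<odot> S)" .
  let ?Da = "op_adjoint D"
  have Da: "?Da \<in> M" "norm ?Da \<le> norm C" using D norm_op_adjoint_le[OF bop[OF D(1)]] by (auto simp: adj_in)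
  have "op_adjoint (S \<odot> D \<odot> S) = S \<odot> ?Da \<odot> S"
    using S D by (simp add: op_adjoint_compose bop compose_in blinfun_compose_assoc)
  then have 2: "tr (S \<odot> D \<odot> S) = tr (S \<odot> ?Da \<odot> S)"
    using tau_adjoint[of "S \<odot> D \<odot> S"] S D by (simp add: tr_def compose_in)
  define H where "H = (1/2) *\<^sub>R (D + ?Da)"
  have H: "H \<in> M" "selfadj H" "norm H \<le> norm C"
  proof -
    show "H \<in> M" using D Da by (simp add: H_def in_M)
    show "selfadj H" unfolding H_def using D Da
      by (intro selfadj_scaleR) (simp add: selfadj_iff bop add_in op_adjoint_add op_adjoint_involutive add.commute)
    show "norm H \<le> norm C" using norm_triangle_ineq[of D ?Da] D Da by (simp add: H_def)
  qed
  have "tr (S \<odot> H \<odot> S) = (tr (S \<odot> D \<odot> S) + tr (S \<odot> ?Da \<odot> S)) / 2"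
    using S D Da by (simp add: H_def blinfun_compose_distribs tr_add tr_scaleR in_M)
  with 1 2 have 3: "cmod z = tr (S \<odot> H \<odot> S)" by simp
  have "positive_op (S \<odot> (norm C *\<^sub>R id_blinfun - H) \<odot> S)"
    by (intro positive_sandwich positive_norm_minus H S)
  moreover have "S \<odot> (norm C *\<^sub>R id_blinfun - H) \<odot> S = norm C *\<^sub>R R - S \<odot> H \<odot> S"
    using S(3) by (simp add: blinfun_compose_distribs)
  ultimately have "tr (S \<odot> H \<odot> S) \<le> tr (norm C *\<^sub>R R)"
    using S H R by (intro tr_mono) (auto simp: in_M)
  with 3 show ?thesis using R by (simp add: z_def tr_scaleR)
qed

lemma tau_norm_bound: "C \<in> M \<Longrightarrow> cmod (\<tau> C) \<le> norm C"
  using tau_compose_positive_bound[OF _ id_in positive_id, of C] by (simp add: tr_id)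

text \<open>Up to \<open>d\<close>, \<open>B\<close> is \<open>V |B|\<close> with a contraction \<open>V\<close>, which can be absorbed into \<open>A\<close>.\<close>

lemma tau_compose_abs_bound:
  assumes A: "A \<in> M" and B: "B \<in> M"
  shows "cmod (\<tau> (A \<odot> B)) \<le> norm A * tr (op_abs B)"
proof (rule field_le_epsilon)
  fix e :: real assume "0 < e"
  define d where "d = e / (norm A + 1)"
  have d: "0 < d" using \<open>0 < e\<close> by (simp add: d_def add_nonneg_pos)
  obtain V where V: "V \<in> M" "norm V \<le> 1" "norm (B - V \<odot> op_abs B) \<le> d"
    using approximate_polar_decomposition[OF bop[OF B] d alg B abs_in[OF B]] by blast
  let ?E = "B - V \<odot> op_abs B"
  have "A \<odot> B = (A \<odot> V) \<odot> op_abs B + A \<odot> ?E"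
    by (simp add: blinfun_compose_distribs blinfun_compose_assoc)
  then have "cmod (\<tau> (A \<odot> B)) \<le> cmod (\<tau> ((A \<odot> V) \<odot> op_abs B)) + cmod (\<tau> (A \<odot> ?E))"
    using A B V by (simp add: tau_add in_M norm_triangle_ineq)
  also have "cmod (\<tau> ((A \<odot> V) \<odot> op_abs B)) \<le> norm (A \<odot> V) * tr (op_abs B)"
    using A B V by (intro tau_compose_positive_bound) (auto simp: in_M bop positive_op_abs)
  also have "\<dots> \<le> norm A * tr (op_abs B)"
  proof (rule mult_right_mono)
    show "norm (A \<odot> V) \<le> norm A"
      using norm_blinfun_compose[of A V] mult_left_mono[OF V(2), of "norm A"] by simp
  qed (use B in \<open>auto intro!: tr_nonneg simp: in_M bop positive_op_abs\<close>)
  also have "cmod (\<tau> (A \<odot> ?E)) \<le> norm (A \<odot> ?E)" using A B V by (intro tau_norm_bound) (auto simp: in_M)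
  also have "\<dots> \<le> norm A * d"
    using norm_blinfun_compose[of A ?E] mult_left_mono[OF V(3), of "norm A"] by simp
  also have "\<dots> \<le> (norm A + 1) * d" using d by simp
  also have "\<dots> = e" by (simp add: d_def add_nonneg_eq_0_iff)
  finally show "cmod (\<tau> (A \<odot> B)) \<le> norm A * tr (op_abs B) + e" by simp
qed

lemma tau_tendsto:
  assumes "\<And>n. A n \<in> M" "A \<longlonglongrightarrow> B" shows "(\<lambda>n. \<tau> (A n)) \<longlonglongrightarrow> \<tau> B"
proof -
  have B: "B \<in> M" using closed_sequentially[OF M_closed] assms by blast
  have "(\<lambda>n. norm (A n - B)) \<longlonglongrightarrow> 0" using assms(2) by (simp add: LIM_zero tendsto_norm_zero)
  then have "(\<lambda>n. \<tau> (A n) - \<tau> B) \<longlonglongrightarrow> 0"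
    by (rule Lim_null_comparison[rotated])
      (use tau_norm_bound[of "A n - B" for n] assms B in \<open>auto simp: tau_diff diff_in\<close>)
  then show ?thesis by (simp add: LIM_zero_iff)
qed

text \<open>Normality in the form in which it is used: an upper bound that is also the weak limit of an
  increasing sequence is its least upper bound.\<close>

lemma tr_increasing_limit:
  assumes f: "\<And>n::nat. f n \<in> M" "\<And>n. positive_op (f n)" "\<And>m n. m \<le> n \<Longrightarrow> op_le (f m) (f n)"
    and g: "g \<in> M" "selfadj g" "\<And>n. op_le (f n) g"
    and lim: "\<And>x. (\<lambda>n. inner (f n x) x) \<longlonglongrightarrow> inner (g x) x"
  shows "tr g = (SUP n. tr (f n))"
proof -
  have least: "op_le g B" if B: "B \<in> M" "\<And>n. op_le (f n) B" for B
  proof -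
    have "positive_op (B - f 0 + f 0)" using B(2)[of 0] unfolding op_le_def by (intro positive_add f(2))
    then have sa: "selfadj (B - g)" using g(2) by (auto intro: selfadj_diff dest: positive_selfadj)
    have "inner (f n x) x \<le> inner (B x) x" for n x
      using B(2)[of n] positive_nonneg[of "B - f n" x] by (simp add: op_le_def blinfun_lin inner_simps)
    then have "inner (g x) x \<le> inner (B x) x" for x
      by (intro LIMSEQ_le_const2[OF lim]) auto
    with sa show ?thesis by (simp add: op_le_def positive_op_iff blinfun_lin inner_simps)
  qed
  have "normal_on M \<tau>" using fvn by (simp add: finite_von_neumann_algebra_def)
  moreover have "\<exists>k. op_le (f m) (f k) \<and> op_le (f n) (f k)" for m n
    by (intro exI[of _ "max m n"]) (auto intro!: f(3))
  ultimately have "\<tau> g = complex_of_real (SUP A\<in>range f. Re (\<tau> A))"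
    unfolding normal_on_def using f least g
    by (elim allE[of _ "range f"] allE[of _ g] impE) (auto simp: image_iff)
  then show ?thesis by (simp add: tr_def image_image)
qed

lemma proj_tr_nonneg: "proj P \<Longrightarrow> 0 \<le> tr P"
  by (intro tr_nonneg projD(1) proj_positive)

lemma proj_tr_zero: "proj P \<Longrightarrow> tr P = 0 \<Longrightarrow> P = 0"
  by (intro tr_faithful projD(1) proj_positive)

lemma proj_tr_pos: "proj P \<Longrightarrow> P \<noteq> 0 \<Longrightarrow> 0 < tr P"
  using proj_tr_nonneg proj_tr_zero by (metis less_eq_real_def)

end

lemma commute_compose:
  "A \<odot> C = C \<odot> A \<Longrightarrow> B \<odot> C = C \<odot> B \<Longrightarrow> (A \<odot> B) \<odot> C = C \<odot> (A \<odot> B)"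
  by (metis blinfun_compose_assoc)

section \<open>Transporting constructions between operators with equal moments\<close>

lemma op_power_0 [simp]: "op_power A 0 = id_blinfun"
  and op_power_Suc: "op_power A (Suc n) = A \<odot> op_power A n"
  by (simp_all add: op_power_def)

lemma op_power_add: "op_power A (m + n) = op_power A m \<odot> op_power A n"
  by (induction m) (simp_all add: op_power_Suc blinfun_compose_assoc)

lemma op_power_Suc': "op_power A (Suc n) = op_power A n \<odot> A"
  using op_power_add[of A n 1] by (simp add: op_power_Suc)

lemma op_power_in_pair:
  "closed_pair_algebra J \<Longrightarrow> (A, B) \<in> J \<Longrightarrow> (op_power A n, op_power B n) \<in> J"
  by (induction n) (auto simp: op_power_Suc intro: closed_pair_algebraD)

lemma op_power_in: "closed_algebra \<A> \<Longrightarrow> A \<in> \<A> \<Longrightarrow> op_power A n \<in> \<A>"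
  by (induction n) (auto simp: op_power_Suc intro: closed_algebraD)

text \<open>The closed algebra generated by the pair \<open>(S, T)\<close>.  When \<open>S\<close> and \<open>T\<close> have the same moments,
  the two entries of any of its elements have the same trace.\<close>

definition moment_pairs :: "('h::chilbert_space) endo \<Rightarrow> 'h endo \<Rightarrow> ('h endo \<times> 'h endo) set"
  where "moment_pairs S T = closure (span (range (\<lambda>n. (op_power S n, op_power T n))))"

lemma moment_pairs_least:
  assumes "closed V" "subspace V" "\<And>n. (op_power S n, op_power T n) \<in> V"
  shows "moment_pairs S T \<subseteq> V"
  unfolding moment_pairs_def using assms by (intro closure_minimal span_minimal) auto

lemma moment_pairs_generator: "(S, T) \<in> moment_pairs S T"
proof -
  have "(op_power S 1, op_power T 1) \<in> span (range (\<lambda>n. (op_power S n, op_power T n)))"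
    by (intro span_base rangeI)
  then show ?thesis using closure_subset by (force simp: moment_pairs_def op_power_Suc)
qed

lemma closed_pair_algebra_moment_pairs: "closed_pair_algebra (moment_pairs S T)"
proof -
  define g where "g n = (op_power S n, op_power T n)" for n
  define L where "L = span (range g)"
  define pm where "pm p q = (fst p \<odot> fst q, snd p \<odot> snd q)" for p q :: "'a endo \<times> 'a endo"
  have L: "subspace L" unfolding L_def by (rule subspace_span)
  have pm_simps: "pm (p + p') q = pm p q + pm p' q" "pm p (q + q') = pm p q + pm p q'"
    "pm (r *\<^sub>R p) q = r *\<^sub>R pm p q" "pm p (r *\<^sub>R q) = r *\<^sub>R pm p q" "pm 0 q = 0" "pm p 0 = 0"
    for p p' q q' r by (simp_all add: pm_def prod_eq_iff blinfun_compose_distribs)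
  have 1: "pm (g m) q \<in> L" if "q \<in> L" for m q
  proof -
    have "subspace {q. pm (g m) q \<in> L}"
      using L by (auto simp: subspace_def pm_simps)
    moreover have "pm (g m) (g n) = g (m + n)" for n by (simp add: pm_def g_def op_power_add)
    then have "range g \<subseteq> {q. pm (g m) q \<in> L}" by (auto simp: L_def intro: span_base)
    ultimately show ?thesis using that span_minimal unfolding L_def by blast
  qed
  have 2: "pm p q \<in> L" if "p \<in> L" "q \<in> L" for p q
  proof -
    have "subspace {p. pm p q \<in> L}" using L by (auto simp: subspace_def pm_simps)
    moreover have "range g \<subseteq> {p. pm p q \<in> L}" by (intro image_subsetI) (simp add: 1 that)
    ultimately show ?thesis using that(1) span_minimal unfolding L_def by blast
  qed
  have J: "moment_pairs S T = closure L" by (simp add: moment_pairs_def L_def g_def)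
  have cl: "pm p q \<in> closure L" if p: "p \<in> closure L" and q: "q \<in> closure L" for p q
  proof -
    obtain f where f: "\<And>n. f n \<in> L" "f \<longlonglongrightarrow> p" using p unfolding closure_sequential by blast
    obtain h where h: "\<And>n. h n \<in> L" "h \<longlonglongrightarrow> q" using q unfolding closure_sequential by blast
    have "(\<lambda>n. pm (f n) (h n)) \<longlonglongrightarrow> pm p q" unfolding pm_def
      by (intro tendsto_intros tendsto_blinfun_compose f h)
    then show ?thesis unfolding closure_sequential
      by (intro exI[of _ "\<lambda>n. pm (f n) (h n)"]) (simp add: 2 f(1) h(1))
  qed
  have sub: "subspace (closure L)" using L by (rule subspace_closure)
  have "g 0 \<in> L" unfolding L_def by (intro span_base rangeI)
  then have "g 0 \<in> closure L" by (rule subsetD[OF closure_subset])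
  then have "(id_blinfun, id_blinfun) \<in> closure L" by (simp add: g_def)
  moreover have "(A \<odot> C, B \<odot> D) \<in> closure L" if "(A, B) \<in> closure L" "(C, D) \<in> closure L" for A B C D
    using cl[OF that] by (simp add: pm_def)
  ultimately show ?thesis unfolding J closed_pair_algebra_def
    using subspace_add[OF sub] subspace_scale[OF sub] by fastforce
qed

context finite_vn_algebra
begin

text \<open>Having entries in \<open>M\<close> of equal trace is a closed linear condition on pairs, so it suffices to check
  it on the powers.\<close>

lemma moment_pairs_tau:
  assumes S: "S \<in> M" and T: "T \<in> M" and eq: "equi_measurable \<tau> S T" and AB: "(A, B) \<in> moment_pairs S T"
  shows "A \<in> M" "B \<in> M" "\<tau> A = \<tau> B"
proof -
  let ?V = "{p. fst p \<in> M \<and> snd p \<in> M \<and> \<tau> (fst p) = \<tau> (snd p)}"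
  have "closed ?V"
  proof (unfold closed_sequential_limits, intro allI impI, elim conjE)
    fix f l assume f: "\<forall>n. f n \<in> ?V" and l: "f \<longlonglongrightarrow> l"
    have l1: "(\<lambda>n. fst (f n)) \<longlonglongrightarrow> fst l" and l2: "(\<lambda>n. snd (f n)) \<longlonglongrightarrow> snd l"
      using l by (auto intro: tendsto_fst tendsto_snd)
    have m: "fst (f n) \<in> M" "snd (f n) \<in> M" for n using f by auto
    have "(\<lambda>n. \<tau> (fst (f n))) \<longlonglongrightarrow> \<tau> (fst l)" "(\<lambda>n. \<tau> (snd (f n))) \<longlonglongrightarrow> \<tau> (snd l)"
      by (intro tau_tendsto m l1 l2)+
    moreover have "(\<lambda>n. \<tau> (fst (f n))) = (\<lambda>n. \<tau> (snd (f n)))" using f by auto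
    ultimately have "\<tau> (fst l) = \<tau> (snd l)" using LIMSEQ_unique by metis
    then show "l \<in> ?V"
      using closed_sequentially[OF M_closed m(1) l1] closed_sequentially[OF M_closed m(2) l2] by auto
  qed
  moreover have "subspace ?V" by (auto simp: subspace_def in_M tau_simps)
  moreover have "(op_power S n, op_power T n) \<in> ?V" for n
    using eq op_power_in[OF alg] S T by (simp add: equi_measurable_def)
  ultimately have "moment_pairs S T \<subseteq> ?V" by (rule moment_pairs_least)
  then show "A \<in> M" "B \<in> M" "\<tau> A = \<tau> B" using AB by auto
qed

section \<open>Spectral projections\<close>

text \<open>For \<open>a n = \<parallel>(1 - E)\<^sup>n w\<parallel>\<^sup>2\<close>, which decreases, one has \<open>\<parallel>(1 - E)\<^sup>n E w\<parallel>\<^sup>2 \<le> a n - a (n + 1)\<close>.  This gives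
  convergence on the range of \<open>E\<close>, and contractivity extends it to the closure.\<close>

lemma powers_tendsto_zero_on_range:
  assumes E: "positive_op E" "norm E \<le> 1" and z: "z \<in> closure (range E)"
  shows "(\<lambda>n. op_power (id_blinfun - E) n z) \<longlonglongrightarrow> 0"
proof -
  let ?D = "id_blinfun - E"
  have D1: "norm (?D) \<le> 1"
  proof (rule norm_le_of_positive_le)
    show "positive_op ?D" using positive_norm_minus[OF positive_selfadj[OF E(1)] E(2)] by simp
  qed (use positive_nonneg[OF E(1)] in \<open>auto simp: blinfun_lin inner_simps power2_norm_eq_inner\<close>)
  have Dn: "norm (op_power ?D n x) \<le> norm x" for n x
  proof (induction n)
    case (Suc n)
    have "norm (?D (op_power ?D n x)) \<le> norm ?D * norm (op_power ?D n x)" by (rule norm_blinfun)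
    also have "\<dots> \<le> 1 * norm x" using D1 Suc by (intro mult_mono) auto
    finally show ?case by (simp add: op_power_Suc)
  qed simp
  have comm: "op_power ?D n \<odot> E = E \<odot> op_power ?D n" for n
    using op_power_in[OF closed_algebra_commute, of ?D E n] by (simp add: blinfun_compose_distribs)
  have rng: "(\<lambda>n. op_power ?D n (E w)) \<longlonglongrightarrow> 0" for w
  proof -
    define a where "a n = (norm (op_power ?D n w))\<^sup>2" for n
    have step: "(norm (op_power ?D n (E w)))\<^sup>2 \<le> a n - a (Suc n)" for n
    proof -
      let ?y = "op_power ?D n w"
      have "inner (E x) x \<le> 1 * (norm x)\<^sup>2" for x
        using inner_le_norm_blinfun[of E x] E(2) mult_right_mono[OF E(2), of "(norm x)\<^sup>2"] by simp
      from norm_square_le_of_positive_le[OF E(1) this, of ?y]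
      have "(norm (E ?y))\<^sup>2 \<le> inner (E ?y) ?y" by simp
      moreover have "a n - a (Suc n) = 2 * inner (E ?y) ?y - (norm (E ?y))\<^sup>2"
        by (simp add: a_def op_power_Suc blinfun_lin power2_norm_eq_inner inner_simps inner_commute)
      moreover have "op_power ?D n (E w) = E ?y" using arg_cong[OF comm[of n], of "\<lambda>A. A w"] by simp
      ultimately show ?thesis by simp
    qed
    have "decseq a"
      by (rule decseq_SucI) (use step in \<open>smt (verit) zero_le_power2\<close>)
    moreover have "0 \<le> a n" for n by (simp add: a_def)
    ultimately have "convergent a" using decseq_convergent convergentI by metis
    then obtain L where "a \<longlonglongrightarrow> L" by (auto simp: convergent_def)
    then have "(\<lambda>n. a n - a (Suc n)) \<longlonglongrightarrow> L - L" by (intro tendsto_diff LIMSEQ_Suc)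
    then have "(\<lambda>n. a n - a (Suc n)) \<longlonglongrightarrow> 0" by simp
    then have "(\<lambda>n. (norm (op_power ?D n (E w)))\<^sup>2) \<longlonglongrightarrow> 0"
      by (rule Lim_null_comparison[rotated]) (use step in auto)
    then have "(\<lambda>n. sqrt ((norm (op_power ?D n (E w)))\<^sup>2)) \<longlonglongrightarrow> sqrt 0" by (rule tendsto_real_sqrt)
    then show ?thesis by (simp add: tendsto_norm_zero_iff)
  qed
  show ?thesis
  proof (rule LIMSEQ_I)
    fix r :: real assume "0 < r"
    then obtain w where w: "dist (E w) z < r / 2"
      using z unfolding closure_approachable by (metis half_gt_zero rangeE)
    obtain N where N: "\<And>n. n \<ge> N \<Longrightarrow> norm (op_power ?D n (E w)) < r / 2"
      using LIMSEQ_D[OF rng[of w], of "r / 2"] \<open>0 < r\<close> by auto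
    have "norm (op_power ?D n z - 0) < r" if "n \<ge> N" for n
    proof -
      have "op_power ?D n z = op_power ?D n (z - E w) + op_power ?D n (E w)" by (simp add: blinfun_lin)
      then have "norm (op_power ?D n z) \<le> norm (z - E w) + norm (op_power ?D n (E w))"
        by (metis Dn add_mono norm_triangle_le order_refl)
      then show ?thesis using w N[OF that] by (simp add: dist_norm norm_minus_commute)
    qed
    then show "\<exists>no. \<forall>n\<ge>no. norm (op_power ?D n z - 0) < r" by blast
  qed
qed

text \<open>The range projection of \<open>0 \<le> C \<le> c\<close> is the least upper bound of the increasing sequence
  \<open>1 - (1 - C/c)\<^sup>n\<close>.  This is where normality enters: the trace of a range projection is
  determined by the moments.\<close>

lemma tr_range_proj:
  assumes C: "C \<in> M" "positive_op C" and c: "norm C \<le> c" "0 < c"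
  shows "tr (range_proj C) = (SUP n. tr (id_blinfun - op_power (id_blinfun - (1/c) *\<^sub>R C) n))"
proof -
  define E where "E = (1/c) *\<^sub>R C"
  define D where "D = id_blinfun - E"
  define e where "e = range_proj C"
  have E: "E \<in> M" "positive_op E" "norm E \<le> 1"
    using C c by (auto simp: E_def scaleR_in intro: positive_scaleR)
  have D: "D \<in> M" "positive_op D"
    using E positive_norm_minus[OF positive_selfadj[OF E(2)] E(3)] by (auto simp: D_def in_M)
  have DE: "D \<odot> E = E \<odot> D" by (simp add: D_def blinfun_compose_distribs)
  have Dn: "op_power D n \<in> M" "E \<odot> op_power D n = op_power D n \<odot> E" "D \<odot> op_power D n = op_power D n \<odot> D" for n
    using op_power_in[OF alg D(1), of n] op_power_in[OF closed_algebra_commute, of D E n]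
      op_power_in[OF closed_algebra_commute, of D D n] DE by auto
  have Dp: "positive_op (op_power D n)" for n
    by (induction n) (auto simp: positive_id op_power_Suc intro!: positive_compose_commuting D Dn(3))
  have step: "positive_op (op_power D n - op_power D (Suc n))" for n
  proof -
    have "op_power D n - op_power D (Suc n) = E \<odot> op_power D n"
      by (simp add: op_power_Suc D_def blinfun_compose_distribs)
    then show ?thesis using positive_compose_commuting[OF E(2) Dp Dn(2)] by simp
  qed
  have mono: "positive_op (op_power D m - op_power D n)" if "m \<le> n" for m n
    using that
  proof (induction n rule: dec_induct)
    case (step n)
    then show ?case using positive_add[OF step(3) \<open>\<And>n. positive_op (op_power D n - op_power D (Suc n))\<close>[of n]]
      by simp
  qed (simp add: positive_zero)
  have e: "proj e" "e \<odot> C = C" "C \<odot> e = C" "e x \<in> closure (range C)" for x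
    using range_proj[OF C(1)] range_proj_selfadj[OF C(1) positive_selfadj[OF C(2)]] by (auto simp: e_def)
  have rngE: "range E = range C"
  proof -
    have "C x = E (c *\<^sub>R x)" for x using c by (simp add: E_def blinfun_lin)
    moreover have "E x = C ((1/c) *\<^sub>R x)" for x by (simp add: E_def blinfun_lin)
    ultimately show ?thesis by (metis (no_types) image_subset_iff rangeI subset_antisym)
  qed
  have fixed: "op_power D n (x - e x) = x - e x" for n x
  proof -
    have "C (x - e x) = 0" using arg_cong[OF e(3), of "\<lambda>A. A x"] by (simp add: blinfun_lin)
    then have "D (x - e x) = x - e x" by (simp add: D_def E_def blinfun_lin)
    then show ?thesis by (induction n) (simp_all add: op_power_Suc)
  qed
  let ?F = "\<lambda>n. id_blinfun - op_power D n"
  have F: "?F n \<in> M" "positive_op (?F n)" for n using mono[of 0 n] Dn(1) by (auto simp: in_M)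
  have le: "op_le (?F n) e" for n
  proof -
    have 1: "op_power D n \<odot> e = op_power D n - (id_blinfun - e)"
      using fixed[of n] by (auto intro!: blinfun_eqI simp: blinfun_lin algebra_simps)
    then have "e \<odot> op_power D n = op_power D n - (id_blinfun - e)"
    proof -
      have "op_adjoint (id_blinfun :: 'h endo) = id_blinfun" using selfadj_id unfolding selfadj_iff by blast
      then show ?thesis
        using arg_cong[OF 1, of op_adjoint] projD(1,2)[OF e(1)] Dn(1) positive_selfadj[OF Dp]
        by (simp add: op_adjoint_compose op_adjoint_diff bop in_M selfadj_iff)
    qed
    then have "e \<odot> op_power D n \<odot> e = e - ?F n"
      using 1 projD(3)[OF e(1)] by (simp add: blinfun_compose_distribs)
    then show ?thesis unfolding op_le_def using positive_sandwich[OF Dp projD(2)[OF e(1)]] by metis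
  qed
  have lim: "(\<lambda>n. inner (?F n x) x) \<longlonglongrightarrow> inner (e x) x" for x
  proof -
    have "(\<lambda>n. op_power D n (e x)) \<longlonglongrightarrow> 0"
      using powers_tendsto_zero_on_range[OF E(2,3)] e(4) by (simp add: D_def rngE)
    then have "(\<lambda>n. inner (x - (op_power D n (e x) + (x - e x))) x) \<longlonglongrightarrow> inner (x - (0 + (x - e x))) x"
      by (intro tendsto_intros)
    moreover have "x - (op_power D n (e x) + (x - e x)) = ?F n x" for n
      using fixed[of n x] by (simp add: blinfun_lin algebra_simps)
    ultimately show ?thesis by simp
  qed
  have "tr e = (SUP n. tr (?F n))"
    by (rule tr_increasing_limit[OF F _ projD(1,2)[OF e(1)] le lim]) (simp add: op_le_def mono)
  then show ?thesis by (simp add: D_def E_def e_def)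
qed

text \<open>\<open>|Y| + Y\<close> is twice the positive part of \<open>Y = X - l\<close>; its range projection is the spectral projection
  of \<open>X\<close> for the open half-line above \<open>l\<close>.\<close>

definition spec :: "'h endo \<Rightarrow> real \<Rightarrow> 'h endo"
  where "spec X l = range_proj
    (op_sqrt ((X - l *\<^sub>R id_blinfun) \<odot> (X - l *\<^sub>R id_blinfun)) + (X - l *\<^sub>R id_blinfun))"

lemma positive_abs_plus:
  assumes Y: "Y \<in> M" "selfadj Y"
  defines "C \<equiv> op_sqrt (Y \<odot> Y) + Y"
  shows "C \<in> M" "positive_op C" "(op_sqrt (Y \<odot> Y) - Y) \<odot> C = 0"
proof -
  let ?R = "op_sqrt (Y \<odot> Y)"
  have YY: "positive_op (Y \<odot> Y)" by (rule positive_square[OF Y(2)])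
  have R: "?R \<in> M" "positive_op ?R" "?R \<odot> ?R = Y \<odot> Y"
    using Y by (auto intro!: sqrt_in compose_in YY positive_op_sqrt op_sqrt_square)
  have RY: "?R \<odot> Y = Y \<odot> ?R" by (rule op_sqrt_commute[OF YY]) (simp add: blinfun_compose_assoc)
  show CM: "C \<in> M" using R Y by (simp add: C_def in_M)
  show DC: "(?R - Y) \<odot> C = 0" using R(3) RY by (simp add: C_def blinfun_compose_distribs)
  have sa: "selfadj C" unfolding C_def by (intro selfadj_add positive_selfadj[OF R(2)] Y(2))
  \<comment> \<open>on its own range \<open>C\<close> coincides with \<open>2 |Y|\<close>, so it is positive there\<close>
  have "C \<odot> C + (?R - Y) \<odot> C = 2 *\<^sub>R (?R \<odot> C)"
    by (simp add: C_def blinfun_compose_distribs scaleR_2)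
  then have "C \<odot> C = 2 *\<^sub>R (?R \<odot> C)" using DC by simp
  then have "C \<odot> (C \<odot> C) = 2 *\<^sub>R (C \<odot> ?R \<odot> C)" by (simp add: blinfun_compose_distribs blinfun_compose_assoc)
  then have CCC: "positive_op (C \<odot> (C \<odot> C))"
    using positive_scaleR[OF positive_sandwich[OF R(2) sa], of 2] by simp
  have "closed {y. 0 \<le> inner (C y) y}" by (intro closed_Collect_le continuous_intros)
  moreover have "range C \<subseteq> {y. 0 \<le> inner (C y) y}"
    using positive_nonneg[OF CCC] by (auto simp: selfadjD[OF sa] inner_commute)
  ultimately have cl: "closure (range C) \<subseteq> {y. 0 \<le> inner (C y) y}" by (rule closure_minimal[rotated])
  have "0 \<le> inner (C x) x" for x
  proof -
    let ?e = "range_proj C"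
    have e: "C (?e x) = C x" "selfadj ?e" "?e (C x) = C x"
      using arg_cong[OF range_proj_selfadj[OF CM sa], of "\<lambda>A. A x"] range_proj(1)[OF CM]
        arg_cong[OF range_proj(3)[OF CM], of "\<lambda>A. A x"] by (auto dest: projD)
    have "inner (C x) x = inner (C (?e x)) (?e x)" using e by (metis selfadjD)
    then show ?thesis using cl range_proj(2)[OF CM, of x] by auto
  qed
  with sa show "positive_op C" by (simp add: positive_op_iff)
qed

text \<open>On the range of \<open>C = |Y| + Y\<close> one has \<open>|Y| = Y\<close>, because \<open>(|Y| - Y) C = 0\<close>; on its orthogonal
  complement, the kernel of \<open>C\<close>, one has \<open>|Y| = - Y\<close>.\<close>

lemma spec:
  assumes X: "X \<in> M" "selfadj X"
  shows "proj (spec X l)"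
    and "B \<in> M \<Longrightarrow> selfadj B \<Longrightarrow> B \<odot> X = X \<odot> B \<Longrightarrow> B \<odot> spec X l = spec X l \<odot> B"
    and "positive_op ((X - l *\<^sub>R id_blinfun) \<odot> spec X l)"
    and "positive_op ((l *\<^sub>R id_blinfun - X) \<odot> (id_blinfun - spec X l))"
proof -
  define Y where "Y = X - l *\<^sub>R id_blinfun"
  define R where "R = op_sqrt (Y \<odot> Y)"
  define C where "C = R + Y"
  define e where "e = range_proj C"
  have eq: "spec X l = e" by (simp add: spec_def e_def C_def R_def Y_def)
  have Y: "Y \<in> M" "selfadj Y" using X by (auto simp: Y_def in_M intro!: selfadj_diff selfadj_scaleR selfadj_id)
  have YY: "positive_op (Y \<odot> Y)" by (rule positive_square[OF Y(2)])
  have R: "R \<in> M" "positive_op R" unfolding R_def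
    using Y by (auto intro!: sqrt_in compose_in YY positive_op_sqrt)
  have C: "C \<in> M" "positive_op C" "(R - Y) \<odot> C = 0" using positive_abs_plus[OF Y] by (auto simp: C_def R_def)
  have sa: "selfadj C" by (rule positive_selfadj[OF C(2)])
  show pe: "proj (spec X l)" unfolding eq e_def by (rule range_proj(1)[OF C(1)])
  have comm: "B \<odot> e = e \<odot> B" if B: "B \<in> M" "selfadj B" "B \<odot> Y = Y \<odot> B" for B
  proof -
    have "R \<odot> B = B \<odot> R" unfolding R_def
      by (rule op_sqrt_commute[OF YY]) (metis B(3) blinfun_compose_assoc)
    then show ?thesis unfolding e_def using B C(1) sa
      by (intro range_proj_commute) (auto simp: C_def blinfun_compose_distribs)
  qed
  show "B \<odot> spec X l = spec X l \<odot> B" if "B \<in> M" "selfadj B" "B \<odot> X = X \<odot> B"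
    using comm[OF that(1,2)] that(3) by (simp add: eq Y_def blinfun_compose_distribs)
  have Re: "R \<odot> e = e \<odot> R"
    by (rule comm[OF R(1) positive_selfadj[OF R(2)]])
      (unfold R_def, rule op_sqrt_commute[OF YY], simp add: blinfun_compose_assoc)
  have "R \<odot> e = Y \<odot> e"
    using range_proj_kernel[OF C(1) C(3)] by (simp add: e_def blinfun_compose_distribs)
  then show "positive_op ((X - l *\<^sub>R id_blinfun) \<odot> spec X l)"
    using positive_compose_commuting[OF R(2) proj_positive[OF pe]] Re by (simp add: eq Y_def)
  have "C \<odot> e = C" unfolding e_def by (rule range_proj_selfadj[OF C(1) sa])
  then have "R \<odot> (id_blinfun - e) = (- Y) \<odot> (id_blinfun - e)"
    by (simp add: C_def blinfun_compose_distribs algebra_simps)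
  moreover have "positive_op (R \<odot> (id_blinfun - e))"
    using Re by (intro positive_compose_commuting R proj_positive proj_compl pe[unfolded eq])
      (simp add: blinfun_compose_distribs)
  ultimately show "positive_op ((l *\<^sub>R id_blinfun - X) \<odot> (id_blinfun - spec X l))"
    by (simp add: eq Y_def)
qed

text \<open>The operators \<open>|Y| + Y\<close> formed from \<open>S\<close> and from \<open>T\<close>, and the polynomials approximating their range
  projections, are the two entries of pairs in \<open>moment_pairs S T\<close>.\<close>

lemma tr_spec_eq:
  assumes S: "S \<in> M" "selfadj S" and T: "T \<in> M" "selfadj T" and eq: "equi_measurable \<tau> S T"
  shows "tr (spec S l) = tr (spec T l)"
proof -
  let ?J = "moment_pairs S T"
  note J = closed_pair_algebra_moment_pairs[of S T]
  let ?Y = "S - l *\<^sub>R id_blinfun" and ?Z = "T - l *\<^sub>R id_blinfun"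
  let ?C = "op_sqrt (?Y \<odot> ?Y) + ?Y" and ?D = "op_sqrt (?Z \<odot> ?Z) + ?Z"
  have Y: "?Y \<in> M" "selfadj ?Y" "?Z \<in> M" "selfadj ?Z"
    using S T by (auto simp: in_M intro!: selfadj_diff selfadj_scaleR selfadj_id)
  have YZ: "(?Y, ?Z) \<in> ?J" by (intro closed_pair_algebraD[OF J] moment_pairs_generator)
  have "(op_sqrt (?Y \<odot> ?Y), op_sqrt (?Z \<odot> ?Z)) \<in> ?J"
    by (intro op_sqrt_in_pair[OF J] closed_pair_algebraD(5)[OF J YZ YZ] positive_square Y)
  from closed_pair_algebraD(3)[OF J this YZ] have CD: "(?C, ?D) \<in> ?J" .
  define c where "c = norm ?C + norm ?D + 1"
  have c: "norm ?C \<le> c" "norm ?D \<le> c" "0 < c" by (auto simp: c_def add_nonneg_pos)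
  have "(id_blinfun - op_power (id_blinfun - (1/c) *\<^sub>R ?C) n, id_blinfun - op_power (id_blinfun - (1/c) *\<^sub>R ?D) n) \<in> ?J" for n
    by (intro closed_pair_algebraD[OF J] op_power_in_pair[OF J] CD)
  from moment_pairs_tau(3)[OF S(1) T(1) eq this]
  have "tr (id_blinfun - op_power (id_blinfun - (1/c) *\<^sub>R ?C) n)
      = tr (id_blinfun - op_power (id_blinfun - (1/c) *\<^sub>R ?D) n)" for n by (simp add: tr_def)
  then show ?thesis unfolding spec_def
    using tr_range_proj[OF positive_abs_plus(1,2)[OF Y(1,2)] c(1,3)]
      tr_range_proj[OF positive_abs_plus(1,2)[OF Y(3,4)] c(2,3)] by simp
qed

subsection \<open>Approximation by finite sums of projections\<close>

text \<open>For a positive operator and a mesh \<open>d\<close>, the \<open>k\<close>-th slice is the spectral projection of the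
  interval from \<open>k d\<close> (excluded) to \<open>(k + 1) d\<close> (included).  Level \<open>0\<close> is set to \<open>1\<close>, so that the lowest
  slice also contains the kernel and the slices sum to \<open>1\<close>.\<close>

definition level :: "'h endo \<Rightarrow> real \<Rightarrow> nat \<Rightarrow> 'h endo"
  where "level X d k = (if k = 0 then id_blinfun else spec X (real k * d))"

definition slice :: "'h endo \<Rightarrow> real \<Rightarrow> nat \<Rightarrow> 'h endo"
  where "slice X d k = level X d k - level X d (Suc k)"

context
  fixes X :: "'h endo" and d :: real
  assumes X: "X \<in> M" "positive_op X" and d: "0 < d"
begin

lemma level:
  shows "proj (level X d k)"
    and "B \<in> M \<Longrightarrow> selfadj B \<Longrightarrow> B \<odot> X = X \<odot> B \<Longrightarrow> B \<odot> level X d k = level X d k \<odot> B"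
    and "positive_op ((X - (real k * d) *\<^sub>R id_blinfun) \<odot> level X d k)"
    and "positive_op (((real (Suc k) * d) *\<^sub>R id_blinfun - X) \<odot> (id_blinfun - level X d (Suc k)))"
  using spec[OF X(1) positive_selfadj[OF X(2)]] X by (auto simp: level_def proj_id)

lemma level_commute: "level X d j \<odot> level X d k = level X d k \<odot> level X d j"
  and level_commute_self: "X \<odot> level X d k = level X d k \<odot> X"
proof -
  show *: "X \<odot> level X d k = level X d k \<odot> X" for k
    by (rule level(2)[OF X(1) positive_selfadj[OF X(2)] refl])
  show "level X d j \<odot> level X d k = level X d k \<odot> level X d j"
    by (rule level(2)[OF projD(1,2)[OF level(1)] *[symmetric]])
qed

lemma level_Suc: "level X d k \<odot> level X d (Suc k) = level X d (Suc k)"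
proof -
  let ?f = "level X d k" and ?e = "level X d (Suc k)"
  show ?thesis
  proof (cases "k = 0")
    case False
    let ?p = "?e \<odot> (id_blinfun - ?f)"
    have p: "proj ?p"
      by (intro proj_compose level(1) proj_compl) (simp add: blinfun_compose_distribs level_commute)
    \<comment> \<open>on the range of \<open>p\<close> one would have \<open>(k + 1) d \<le> X \<le> k d\<close>\<close>
    have "?p x = 0" for x
    proof -
      let ?y = "?p x"
      have ey: "?e ?y = ?y" using proj_apply[OF level(1)] by simp
      have "?p = (id_blinfun - ?f) \<odot> ?e" by (simp add: blinfun_compose_distribs level_commute)
      then have fy: "(id_blinfun - ?f) ?y = ?y" using proj_apply[OF proj_compl[OF level(1)]] by simp
      have "0 \<le> inner ((X - (real (Suc k) * d) *\<^sub>R id_blinfun) (?e ?y)) ?y"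
        using positive_nonneg[OF level(3)[of "Suc k"], of ?y] by simp
      then have "real (Suc k) * d * inner ?y ?y \<le> inner (X ?y) ?y"
        unfolding ey by (simp only: blinfun_lin inner_simps) simp
      moreover have "0 \<le> inner (((real k * d) *\<^sub>R id_blinfun - X) ((id_blinfun - ?f) ?y)) ?y"
        using positive_nonneg[OF level(4)[of "k - 1"], of ?y] False by simp
      then have "inner (X ?y) ?y \<le> real k * d * inner ?y ?y"
        unfolding fy by (simp only: blinfun_lin inner_simps) simp
      ultimately have "d * inner ?y ?y \<le> 0" by (simp add: algebra_simps)
      then have "inner ?y ?y \<le> 0" using d by (simp add: mult_le_0_iff)
      then show ?thesis by (metis inner_gt_zero_iff not_less)
    qed
    then have "?p = 0" by (intro blinfun_eqI) simp
    then show ?thesis by (simp add: blinfun_compose_distribs level_commute)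
  qed (simp add: level_def)
qed

lemma level_le: "j \<le> k \<Longrightarrow> level X d j \<odot> level X d k = level X d k"
proof (induction k rule: dec_induct)
  case base
  show ?case by (rule projD(3)[OF level(1)])
next
  case (step k)
  then show ?case using level_Suc by (metis blinfun_compose_assoc)
qed

lemma proj_slice: "proj (slice X d k)"
  unfolding slice_def by (intro proj_diff level level_Suc)

lemma slice_commute:
  "B \<in> M \<Longrightarrow> selfadj B \<Longrightarrow> B \<odot> X = X \<odot> B \<Longrightarrow> B \<odot> slice X d k = slice X d k \<odot> B"
  by (simp add: slice_def blinfun_compose_distribs level(2))

lemma slice_orth: assumes "j < k" shows "slice X d j \<odot> slice X d k = 0"
  using level_le[of j k] level_le[of j "Suc k"] level_le[of "Suc j" k] level_le[of "Suc j" "Suc k"] assms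
  by (simp add: slice_def blinfun_compose_distribs)

lemma slice_orthogonal: "j \<noteq> k \<Longrightarrow> slice X d j \<odot> slice X d k = 0"
  by (metis slice_orth proj_orth_commute proj_slice linorder_neqE_nat)

lemma level_vanishes: assumes "norm X < real k * d" shows "level X d k = 0"
proof -
  have k: "k \<noteq> 0" using assms norm_ge_zero[of X] by (metis mult_eq_0_iff not_less of_nat_0)
  have "level X d k x = 0" for x
  proof -
    let ?y = "level X d k x"
    have "0 \<le> inner ((X - (real k * d) *\<^sub>R id_blinfun) (level X d k ?y)) ?y"
      using positive_nonneg[OF level(3)[of k], of ?y] by simp
    then have "real k * d * (norm ?y)\<^sup>2 \<le> inner (X ?y) ?y"
      unfolding proj_apply[OF level(1)] by (simp add: blinfun_lin inner_simps power2_norm_eq_inner)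
    also have "\<dots> \<le> norm X * (norm ?y)\<^sup>2" by (rule inner_le_norm_blinfun)
    finally have "(real k * d - norm X) * (norm ?y)\<^sup>2 \<le> 0" by (simp add: algebra_simps)
    then show ?thesis using assms by (simp add: mult_le_0_iff)
  qed
  then show ?thesis by (intro blinfun_eqI) simp
qed

lemma slice_sum: assumes "norm X < real K * d" shows "(\<Sum>k<K. slice X d k) = id_blinfun"
proof -
  have "(\<Sum>k<K. slice X d k) = level X d 0 - level X d K" unfolding slice_def by (rule sum_lessThan_telescope')
  then show ?thesis using level_vanishes[OF assms] by (simp add: level_def)
qed

text \<open>The difference is the sum of the \<open>(X - k d)\<close> times the \<open>k\<close>-th slice, and each of these lies between
  \<open>0\<close> and \<open>d\<close> times that slice.\<close>

lemma slice_approx: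
  assumes K: "norm X < real K * d" shows "norm (X - (\<Sum>k<K. (real k * d) *\<^sub>R slice X d k)) \<le> d"
proof -
  let ?P = "slice X d" and ?e = "level X d"
  let ?A = "X - (\<Sum>k<K. (real k * d) *\<^sub>R ?P k)"
  have P: "?P k = ?e k \<odot> (id_blinfun - ?e (Suc k))" for k
    by (simp add: slice_def blinfun_compose_distribs level_Suc)
  have comm: "(id_blinfun - ?e k) \<odot> ?e j = ?e j \<odot> (id_blinfun - ?e k)"
    "X \<odot> ?e k = ?e k \<odot> X" for j k
    by (simp_all add: blinfun_compose_distribs level_commute level_commute_self)
  have lo: "positive_op ((X - (real k * d) *\<^sub>R id_blinfun) \<odot> ?P k)" for k
  proof -
    let ?Y = "X - (real k * d) *\<^sub>R id_blinfun"
    have "(?Y \<odot> ?e k) \<odot> (id_blinfun - ?e (Suc k)) = (id_blinfun - ?e (Suc k)) \<odot> (?Y \<odot> ?e k)"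
    proof -
      have "?Y \<odot> (id_blinfun - ?e (Suc k)) = (id_blinfun - ?e (Suc k)) \<odot> ?Y"
        by (simp add: blinfun_compose_distribs level_commute_self algebra_simps)
      then show ?thesis by (rule commute_compose) (rule comm(1)[symmetric])
    qed
    from positive_compose_commuting[OF level(3) proj_positive[OF proj_compl[OF level(1)]] this]
    show ?thesis by (simp add: P blinfun_compose_assoc)
  qed
  have hi: "positive_op (((real (Suc k) * d) *\<^sub>R id_blinfun - X) \<odot> ?P k)" for k
  proof -
    let ?Y = "(real (Suc k) * d) *\<^sub>R id_blinfun - X"
    have "(?Y \<odot> (id_blinfun - ?e (Suc k))) \<odot> ?e k = ?e k \<odot> (?Y \<odot> (id_blinfun - ?e (Suc k)))"
    proof -
      have "?Y \<odot> ?e k = ?e k \<odot> ?Y" by (simp add: blinfun_compose_distribs level_commute_self)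
      then show ?thesis by (rule commute_compose) (rule comm(1))
    qed
    from positive_compose_commuting[OF level(4) proj_positive[OF level(1)] this]
    show ?thesis by (simp add: P comm(1)[symmetric] blinfun_compose_assoc)
  qed
  have id: "(\<Sum>k<K. ?P k) = id_blinfun" by (rule slice_sum[OF K])
  have XP: "X = (\<Sum>k<K. X \<odot> ?P k)"
    using blinfun_compose_sum_right[of X ?P "{..<K}"] id by simp
  have "?A = (\<Sum>k<K. (X - (real k * d) *\<^sub>R id_blinfun) \<odot> ?P k)"
    by (subst XP) (simp add: blinfun_compose_distribs sum_subtractf)
  then have pos: "positive_op ?A" by (simp only: positive_sum[OF lo])
  have "d *\<^sub>R id_blinfun - ?A = (\<Sum>k<K. ((real (Suc k) * d) *\<^sub>R id_blinfun - X) \<odot> ?P k)"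
    by (subst XP, subst id[symmetric])
      (simp add: blinfun_compose_distribs sum_subtractf scaleR_sum_right sum.distrib algebra_simps)
  then have "positive_op (d *\<^sub>R id_blinfun - ?A)" by (simp only: positive_sum[OF hi])
  then show ?thesis using positive_id_minus_iff[OF positive_selfadj[OF pos], of d] d pos
    by (intro norm_le_of_positive_le) auto
qed

end

lemma tr_slice_eq:
  assumes S: "S \<in> M" "positive_op S" and T: "T \<in> M" "positive_op T"
    and eq: "equi_measurable \<tau> S T" and d: "0 < d"
  shows "tr (slice S d k) = tr (slice T d k)"
proof -
  have "tr (level S d k) = tr (level T d k)" for k
    using tr_spec_eq[OF S(1) positive_selfadj[OF S(2)] T(1) positive_selfadj[OF T(2)] eq]
    by (simp add: level_def)
  then show ?thesis using projD(1)[OF level(1)[OF S d]] projD(1)[OF level(1)[OF T d]]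
    by (simp add: slice_def tr_diff)
qed

end

section \<open>Tracial gauge norms are symmetric\<close>

locale gauge_norm = finite_vn_algebra M \<tau>
  for M :: "('h::chilbert_space \<Rightarrow>\<^sub>L 'h) set" and \<tau> :: "('h \<Rightarrow>\<^sub>L 'h) \<Rightarrow> complex" +
  fixes N :: "('h \<Rightarrow>\<^sub>L 'h) \<Rightarrow> real"
  assumes gauge: "tracial_gauge_norm M \<tau> N"
begin

lemma norm_N: "norm_on M N" using gauge by (simp add: tracial_gauge_norm_def)

lemma N_nonneg: "A \<in> M \<Longrightarrow> 0 \<le> N A"
  and N_zero_iff: "A \<in> M \<Longrightarrow> N A = 0 \<longleftrightarrow> A = 0"
  and N_scaleC: "A \<in> M \<Longrightarrow> N (c *\<^sub>C A) = cmod c * N A"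
  and N_triangle: "A \<in> M \<Longrightarrow> B \<in> M \<Longrightarrow> N (A + B) \<le> N A + N B"
  using norm_N by (simp_all add: norm_on_def)

lemma N_abs: "A \<in> M \<Longrightarrow> N A = N (op_abs A)"
  using gauge unfolding tracial_gauge_norm_def by blast

lemma N_equi: "S \<in> M \<Longrightarrow> T \<in> M \<Longrightarrow> positive_op S \<Longrightarrow> positive_op T \<Longrightarrow> equi_measurable \<tau> S T \<Longrightarrow> N S = N T"
  using gauge unfolding tracial_gauge_norm_def by blast

lemma N_scaleR: "A \<in> M \<Longrightarrow> N (r *\<^sub>R A) = \<bar>r\<bar> * N A"
  using N_scaleC[of A "of_real r"] by (simp add: scaleC_of_real)

lemma N_diff: "A \<in> M \<Longrightarrow> B \<in> M \<Longrightarrow> N (A - B) \<le> N A + N B"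
  using N_triangle[of A "(-1) *\<^sub>R B"] N_scaleR[of B "-1"] scaleR_in[of B "-1"] by simp

lemma N_zero: "N 0 = 0" using N_zero_iff[OF zero_in] by simp

lemma N_sum: "(\<And>i. i \<in> I \<Longrightarrow> f i \<in> M) \<Longrightarrow> N (\<Sum>i\<in>I. f i) \<le> (\<Sum>i\<in>I. N (f i))"
proof (induction I rule: infinite_finite_induct)
  case (insert i I)
  then show ?case using N_triangle[of "f i" "\<Sum>i\<in>I. f i"] by (auto simp: sum_in)
qed (simp_all add: N_zero)

lemma N_unitary_left:
  assumes U: "U \<in> M" "op_adjoint U \<odot> U = id_blinfun" and T: "T \<in> M"
  shows "N (U \<odot> T) = N T"
proof -
  have "op_adjoint (U \<odot> T) \<odot> (U \<odot> T) = op_adjoint T \<odot> (op_adjoint U \<odot> U) \<odot> T"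
    using U(1) T by (simp add: op_adjoint_compose bop blinfun_compose_assoc)
  then have "op_adjoint (U \<odot> T) \<odot> (U \<odot> T) = op_adjoint T \<odot> T" using U(2) by simp
  then have "op_abs (U \<odot> T) = op_abs T" by (simp add: op_abs_def)
  then show ?thesis using N_abs U T by (metis compose_in)
qed

text \<open>\<open>T\<^sup>* T\<close> and \<open>T T\<^sup>*\<close> have the same moments, hence so do their square roots.\<close>

lemma N_adjoint:
  assumes T: "T \<in> M" shows "N (op_adjoint T) = N T"
proof -
  let ?Ta = "op_adjoint T"
  let ?A = "T \<odot> ?Ta" and ?B = "?Ta \<odot> T"
  have M: "?Ta \<in> M" "?A \<in> M" "?B \<in> M" using T by (auto simp: in_M)
  have pos: "positive_op ?A" "positive_op ?B"
    using positive_adjoint_self[OF bop[OF T]] positive_adjoint_self[OF bop[OF M(1)]]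
    by (simp_all add: op_adjoint_involutive bop T)
  have pw: "op_power ?A (Suc n) = T \<odot> op_power ?B n \<odot> ?Ta" for n
    by (induction n) (simp_all add: op_power_Suc blinfun_compose_assoc)
  have "\<tau> (op_power ?A n) = \<tau> (op_power ?B n)" for n
  proof (cases n)
    case (Suc m)
    have Bm: "op_power ?B m \<in> M" by (rule op_power_in[OF alg M(3)])
    have "\<tau> (op_power ?A n) = \<tau> ((op_power ?B m \<odot> ?Ta) \<odot> T)"
      unfolding Suc pw using tau_commute[of T "op_power ?B m \<odot> ?Ta"] T M Bm
      by (simp add: compose_in blinfun_compose_assoc)
    also have "\<dots> = \<tau> (op_power ?B n)" by (simp add: Suc op_power_Suc' blinfun_compose_assoc)
    finally show ?thesis .
  qed simp
  then have eq: "equi_measurable \<tau> ?A ?B" by (simp add: equi_measurable_def)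
  note J = closed_pair_algebra_moment_pairs[of ?A ?B]
  have "(op_sqrt ?A, op_sqrt ?B) \<in> moment_pairs ?A ?B"
    by (rule op_sqrt_in_pair[OF J moment_pairs_generator pos])
  from moment_pairs_tau(3)[OF M(2,3) eq op_power_in_pair[OF J this]]
  have eq': "equi_measurable \<tau> (op_sqrt ?A) (op_sqrt ?B)" by (simp add: equi_measurable_def)
  have "N (op_sqrt ?A) = N (op_sqrt ?B)"
    by (rule N_equi) (use M pos eq' in \<open>auto intro: sqrt_in positive_op_sqrt\<close>)
  moreover have "op_abs ?Ta = op_sqrt ?A" by (simp add: op_abs_eq_sqrt op_adjoint_involutive bop T)
  moreover have "op_abs T = op_sqrt ?B" by (simp add: op_abs_eq_sqrt)
  ultimately show ?thesis using N_abs[OF T] N_abs[OF M(1)] by simp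
qed

text \<open>A self-adjoint contraction is the mean of the two unitaries \<open>D \<plusminus> \<i> (1 - D\<^sup>2)\<^sup>1\<^sup>/\<^sup>2\<close>.\<close>

lemma N_selfadj_contraction:
  assumes D: "D \<in> M" "selfadj D" "norm D \<le> 1" and X: "X \<in> M"
  shows "N (D \<odot> X) \<le> N X"
proof -
  have DD: "selfadj (D \<odot> D)" "norm (D \<odot> D) \<le> 1"
  proof -
    show "selfadj (D \<odot> D)" using D by (simp add: selfadj_compose)
    have "norm D * norm D \<le> 1 * 1" using D(3) by (intro mult_mono) auto
    then show "norm (D \<odot> D) \<le> 1" using norm_blinfun_compose[of D D] by simp
  qed
  define A where "A = id_blinfun - D \<odot> D"
  have A: "A \<in> M" "positive_op A" using positive_norm_minus[OF DD] D by (auto simp: A_def in_M)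
  define S where "S = op_sqrt A"
  have S: "S \<in> M" "selfadj S" "S \<odot> S = A"
    using A by (auto simp: S_def sqrt_in op_sqrt_square positive_selfadj positive_op_sqrt)
  have SD: "S \<odot> D = D \<odot> S" unfolding S_def
    by (rule op_sqrt_commute[OF A(2)]) (simp add: A_def blinfun_compose_distribs blinfun_compose_assoc)
  define U where "U = D + \<i> *\<^sub>C S"
  define W where "W = D - \<i> *\<^sub>C S"
  have UW: "U \<in> M" "W \<in> M" using D S by (simp_all add: U_def W_def in_M)
  have b: "D \<in> bounded_operators" "S \<in> bounded_operators" using D S by (simp_all add: bop)
  have Dx: "S (S x) = x - D (D x)" "S (D x) = D (S x)" for x
    using arg_cong[OF S(3), of "\<lambda>B. B x"] arg_cong[OF SD, of "\<lambda>B. B x"] by (simp_all add: A_def blinfun_lin)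
  have 1: "W \<odot> U = id_blinfun" "U \<odot> W = id_blinfun"
    by (rule blinfun_eqI, simp add: U_def W_def blinfun_lin blinfun_apply_scaleC bopD[OF b(1)] bopD[OF b(2)]
        scaleC_add_right scaleC_diff_right scaleC_i_i Dx)+
  have "op_adjoint (\<i> *\<^sub>C S) = - (\<i> *\<^sub>C S)"
  proof -
    have "op_adjoint (\<i> *\<^sub>C S) = (- \<i>) *\<^sub>C S"
      using b(2) S(2) by (simp add: op_adjoint_scaleC selfadj_iff)
    also have "\<dots> = - (\<i> *\<^sub>C S)"
      by (metis mult_minus1 scaleC_scaleC scaleC_of_real of_real_minus of_real_1 scaleR_minus1_left)
    finally show ?thesis .
  qed
  then have "op_adjoint U = W" using D(2) b by (simp add: U_def W_def op_adjoint_add bop_scaleC selfadj_iff)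
  moreover from this have "op_adjoint W = U" using UW by (metis bop op_adjoint_involutive)
  ultimately have N: "N (U \<odot> X) = N X" "N (W \<odot> X) = N X"
    using 1 UW X by (auto intro: N_unitary_left)
  have "D \<odot> X = (1/2) *\<^sub>R (U \<odot> X + W \<odot> X)"
    by (rule blinfun_eqI) (simp add: U_def W_def blinfun_lin scaleR_add_right[symmetric] scaleR_2[symmetric])
  then show ?thesis using N N_triangle[of "U \<odot> X" "W \<odot> X"] UW X
    by (simp add: N_scaleR in_M)
qed

text \<open>Since \<open>|V X| = | |V| X |\<close>, the general case reduces to a self-adjoint contraction.\<close>

lemma N_contraction_left:
  assumes V: "V \<in> M" "norm V \<le> 1" and X: "X \<in> M"
  shows "N (V \<odot> X) \<le> N X"
proof -
  let ?D = "op_abs V"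
  have D: "?D \<in> M" "selfadj ?D" "norm ?D \<le> 1"
    using V by (auto simp: abs_in bop positive_selfadj positive_op_abs norm_op_abs)
  have "op_adjoint (V \<odot> X) \<odot> (V \<odot> X) = op_adjoint X \<odot> (op_adjoint V \<odot> V) \<odot> X"
    using V X by (simp add: op_adjoint_compose bop blinfun_compose_assoc)
  also have "\<dots> = op_adjoint (?D \<odot> X) \<odot> (?D \<odot> X)"
    using D V X by (simp add: op_abs_square[symmetric] op_adjoint_compose bop selfadj_iff blinfun_compose_assoc)
  finally have "op_abs (V \<odot> X) = op_abs (?D \<odot> X)" by (simp add: op_abs_def)
  then have "N (V \<odot> X) = N (?D \<odot> X)" using N_abs V D X by (metis compose_in)
  then show ?thesis using N_selfadj_contraction[OF D X] by simp
qed

lemma N_contraction_right: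
  assumes V: "V \<in> M" "norm V \<le> 1" and X: "X \<in> M"
  shows "N (X \<odot> V) \<le> N X"
proof -
  have "norm (op_adjoint V) \<le> 1" using norm_op_adjoint_le[OF bop[OF V(1)]] V(2) by simp
  then have "N (op_adjoint V \<odot> op_adjoint X) \<le> N (op_adjoint X)"
    using V X by (intro N_contraction_left) (auto simp: adj_in)
  then show ?thesis
    using N_adjoint[of "X \<odot> V"] N_adjoint[OF X] V X by (simp add: op_adjoint_compose bop compose_in)
qed

lemma N_le_norm: assumes "A \<in> M" shows "N A \<le> norm A * N id_blinfun"
proof (cases "A = 0")
  case False
  let ?V = "(1 / norm A) *\<^sub>R A"
  have "N (?V \<odot> id_blinfun) \<le> N id_blinfun"
    by (rule N_contraction_left) (use assms False in \<open>auto simp: in_M\<close>)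
  then show ?thesis using False assms by (simp add: N_scaleR field_simps)
qed (simp add: N_zero)

lemma N_id_pos: "0 < N id_blinfun"
proof -
  have "(id_blinfun :: 'h endo) \<noteq> 0" using tau_id tau_zero by auto
  then show ?thesis using N_nonneg[OF id_in] N_zero_iff[OF id_in] by simp
qed

text \<open>The left-hand side is the mean of \<open>X\<close> and its conjugate by the reflection \<open>2 P - 1\<close>.\<close>

lemma N_reflection_average:
  assumes P: "proj P" and X: "X \<in> M"
  shows "N (P \<odot> X \<odot> P + (id_blinfun - P) \<odot> X \<odot> (id_blinfun - P)) \<le> N X"
proof -
  let ?U = "2 *\<^sub>R P - id_blinfun"
  note PP = projD[OF P]
  have U: "?U \<in> M" "selfadj ?U" "?U \<odot> ?U = id_blinfun"
  proof -
    show "?U \<in> M" using PP by (simp add: in_M)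
    show "selfadj ?U" by (intro selfadj_diff selfadj_scaleR selfadj_id PP)
    show "?U \<odot> ?U = id_blinfun" using PP by (simp add: blinfun_compose_distribs scaleR_2)
  qed
  have "norm ?U \<le> 1"
  proof (rule norm_blinfun_bound)
    fix x
    have "inner (?U x) (?U x) = inner x (?U (?U x))" by (rule selfadjD[OF U(2)])
    also have "?U (?U x) = x" using arg_cong[OF U(3), of "\<lambda>B. B x"] by simp
    finally show "norm (?U x) \<le> 1 * norm x" by (simp add: norm_eq_sqrt_inner)
  qed simp
  then have "N (?U \<odot> X \<odot> ?U) \<le> N X"
    using N_contraction_right[of ?U "?U \<odot> X"] N_contraction_left[of ?U X] U X by (auto simp: compose_in)
  moreover have "P \<odot> X \<odot> P + (id_blinfun - P) \<odot> X \<odot> (id_blinfun - P) = (1/2) *\<^sub>R (X + ?U \<odot> X \<odot> ?U)"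
  proof -
    have "X + ?U \<odot> X \<odot> ?U = 2 *\<^sub>R (P \<odot> X \<odot> P + (id_blinfun - P) \<odot> X \<odot> (id_blinfun - P))"
      by (simp add: scaleR_2 blinfun_compose_distribs algebra_simps)
    then show ?thesis by simp
  qed
  ultimately show ?thesis using N_triangle[of X "?U \<odot> X \<odot> ?U"] U X
    by (simp add: N_scaleR in_M)
qed

text \<open>Averaging over the reflections in the \<open>P i\<close>, one after the other, keeps the diagonal blocks
  \<open>P i X P i\<close> and the commutation already achieved.\<close>

lemma pinching:
  assumes "finite I" and P: "\<And>i. i \<in> I \<Longrightarrow> proj (P i)"
    and orth: "\<And>i j. i \<in> I \<Longrightarrow> j \<in> I \<Longrightarrow> i \<noteq> j \<Longrightarrow> P i \<odot> P j = 0" and X: "X \<in> M"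
  obtains Y where "Y \<in> M" "N Y \<le> N X" "\<And>i. i \<in> I \<Longrightarrow> P i \<odot> Y = Y \<odot> P i"
    "\<And>i. i \<in> I \<Longrightarrow> P i \<odot> Y \<odot> P i = P i \<odot> X \<odot> P i"
proof -
  have "\<exists>Y\<in>M. N Y \<le> N X \<and> (\<forall>i\<in>J. P i \<odot> Y = Y \<odot> P i) \<and> (\<forall>i\<in>I. P i \<odot> Y \<odot> P i = P i \<odot> X \<odot> P i)"
    if "finite J" "J \<subseteq> I" for J
    using that
  proof (induction J)
    case empty
    then show ?case using X by blast
  next
    case (insert j J)
    then obtain Y where Y: "Y \<in> M" "N Y \<le> N X" "\<And>i. i \<in> J \<Longrightarrow> P i \<odot> Y = Y \<odot> P i"
      "\<And>i. i \<in> I \<Longrightarrow> P i \<odot> Y \<odot> P i = P i \<odot> X \<odot> P i" by auto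
    let ?p = "P j" and ?q = "id_blinfun - P j"
    let ?Z = "?p \<odot> Y \<odot> ?p + ?q \<odot> Y \<odot> ?q"
    have p: "proj ?p" "?p \<odot> ?p = ?p" using P insert.prems by (auto dest: projD)
    have pqZ: "?p \<odot> ?q = 0" "?q \<odot> ?p = 0" using p by (simp_all add: blinfun_compose_distribs)
    have "?Z \<in> M" using Y p by (simp add: in_M projD)
    moreover have "N ?Z \<le> N X" using N_reflection_average[OF p(1) Y(1)] Y(2) by simp
    moreover have "P i \<odot> ?Z = ?Z \<odot> P i" if i: "i \<in> insert j J" for i
    proof (cases "i = j")
      case True
      have "?p \<odot> ?Z = ?p \<odot> Y \<odot> ?p" "?Z \<odot> ?p = ?p \<odot> Y \<odot> ?p"
        using p(2) pqZ by (simp_all add: blinfun_compose_distribs(1,2) blinfun_compose_assoc)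
          (simp_all add: blinfun_compose_assoc[symmetric])
      then show ?thesis using True by simp
    next
      case False
      then have 0: "P i \<odot> ?p = 0" "?p \<odot> P i = 0" using i orth insert.prems by auto
      then have "P i \<odot> ?q = P i" "?q \<odot> P i = P i" by (simp_all add: blinfun_compose_distribs)
      moreover have c: "P i \<odot> ?p = ?p \<odot> P i" "P i \<odot> ?q = ?q \<odot> P i" "P i \<odot> Y = Y \<odot> P i"
        using 0 Y(3) i False by (auto simp: blinfun_compose_distribs)
      have "?p \<odot> Y \<odot> ?p \<odot> P i = P i \<odot> (?p \<odot> Y \<odot> ?p)" "?q \<odot> Y \<odot> ?q \<odot> P i = P i \<odot> (?q \<odot> Y \<odot> ?q)"
        by (intro commute_compose c[symmetric])+
      then show ?thesis by (simp add: blinfun_compose_distribs(1,2))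
    qed
    moreover have "P i \<odot> ?Z \<odot> P i = P i \<odot> X \<odot> P i" if i: "i \<in> I" for i
    proof -
      have "P i \<odot> ?Z \<odot> P i = P i \<odot> Y \<odot> P i"
      proof (cases "i = j")
        case True
        have "P i \<odot> ?Z = P i \<odot> Y \<odot> P i"
          using p(2) pqZ by (simp add: True blinfun_compose_distribs(1,2) blinfun_compose_assoc[symmetric])
        then show ?thesis using p(2) by (simp add: True blinfun_compose_assoc)
      next
        case False
        then have 0: "P i \<odot> ?p = 0" "?p \<odot> P i = 0" using i orth insert.prems by auto
        then have q: "P i \<odot> ?q = P i" "?q \<odot> P i = P i" by (simp_all add: blinfun_compose_distribs)
        have "P i \<odot> ?Z = P i \<odot> Y \<odot> ?q"
          using 0 q by (simp add: blinfun_compose_distribs(1,2) blinfun_compose_assoc[symmetric])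
        then show ?thesis using q by (simp add: blinfun_compose_assoc)
      qed
      then show ?thesis using Y(4)[OF i] by simp
    qed
    ultimately show ?case by blast
  qed
  from this[OF assms(1) order_refl] show ?thesis using that by blast
qed

end

section \<open>Subdividing projections into pieces of equal trace\<close>

context finite_vn_algebra
begin

lemma proj_sum:
  assumes "finite I" "\<And>i. i \<in> I \<Longrightarrow> proj (P i)"
    and "\<And>i j. i \<in> I \<Longrightarrow> j \<in> I \<Longrightarrow> i \<noteq> j \<Longrightarrow> P i \<odot> P j = 0"
  shows "proj (\<Sum>i\<in>I. P i)"
  using assms
proof (induction I)
  case (insert i I)
  have "P i \<odot> (\<Sum>i\<in>I. P i) = 0"
    unfolding blinfun_compose_sum_right using insert.hyps insert.prems(2)
    by (intro sum.neutral) auto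
  then show ?case using insert by (auto intro!: proj_add)
qed (simp add: proj_zero)

lemma proj_sum_absorb:
  assumes "finite I" "\<And>i. i \<in> I \<Longrightarrow> proj (P i)"
    and "\<And>i j. i \<in> I \<Longrightarrow> j \<in> I \<Longrightarrow> i \<noteq> j \<Longrightarrow> P i \<odot> P j = 0" and j: "j \<in> I"
  shows "P j \<odot> (\<Sum>i\<in>I. P i) = P j" "(\<Sum>i\<in>I. P i) \<odot> P j = P j"
proof -
  have "P j \<odot> P i = (if i = j then P j else 0)" "P i \<odot> P j = (if i = j then P j else 0)" if "i \<in> I" for i
    using assms(3)[OF that j] assms(3)[OF j that] projD(3)[OF assms(2)[OF j]] by auto
  then show "P j \<odot> (\<Sum>i\<in>I. P i) = P j" "(\<Sum>i\<in>I. P i) \<odot> P j = P j"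
    using assms(1) j by (simp_all add: blinfun_compose_sum_right blinfun_compose_sum_left)
qed

lemma tr_proj_le: assumes "proj P" "proj Q" "P \<odot> Q = Q" shows "tr Q \<le> tr P"
  using proj_positive[OF proj_diff[OF assms]] assms by (intro tr_mono) (auto dest: projD)

lemma proj_eq_of_tr_eq: assumes "proj P" "proj Q" "P \<odot> Q = Q" "tr P = tr Q" shows "P = Q"
  using proj_tr_zero[OF proj_diff[OF assms(1-3)]] assms by (simp add: tr_diff projD)

definition minimal :: "'h endo \<Rightarrow> bool"
  where "minimal P \<longleftrightarrow> proj P \<and> P \<noteq> 0 \<and> (\<forall>Q. proj Q \<longrightarrow> P \<odot> Q = Q \<longrightarrow> Q = 0 \<or> Q = P)"

text \<open>Cut down to a minimal \<open>P\<close>, the spectral projection of \<open>A\<close> at its mean value \<open>c\<close> is \<open>P\<close> or \<open>0\<close>, so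
  \<open>A - c P\<close> has a sign; as its trace vanishes, it is zero.\<close>

lemma minimal_corner_scalar:
  assumes P: "minimal P" and A: "A \<in> M" "positive_op A" "P \<odot> A = A" "A \<odot> P = A"
  shows "A = (tr A / tr P) *\<^sub>R P"
proof -
  define c where "c = tr A / tr P"
  have pP: "proj P" and P0: "P \<noteq> 0" using P by (auto simp: minimal_def)
  note PM = projD[OF pP] and S = spec[OF A(1) positive_selfadj[OF A(2)], where l = c]
  let ?e = "spec A c" and ?D = "A - c *\<^sub>R P"
  have eP: "P \<odot> ?e = ?e \<odot> P" using A(3,4) PM by (intro S(2)) auto
  have D: "?D \<in> M" "(-1) *\<^sub>R ?D \<in> M" using A(1) PM(1) by (simp_all only: in_M)
  have "tr ?D = 0"
    using A(1) PM(1) proj_tr_pos[OF pP P0] by (simp add: tr_diff tr_scaleR scaleR_in c_def)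
  moreover from this have "tr ((-1) *\<^sub>R ?D) = 0" using D(1) by (simp only: tr_scaleR)
  moreover have "positive_op ?D \<or> positive_op ((-1) *\<^sub>R ?D)"
  proof -
    have "proj (?e \<odot> P)" by (intro proj_compose S pP eP[symmetric])
    moreover have "P \<odot> (?e \<odot> P) = ?e \<odot> P" using eP PM(3) by (metis blinfun_compose_assoc)
    ultimately consider "?e \<odot> P = P" | "?e \<odot> P = 0" using P by (auto simp: minimal_def)
    then show ?thesis
    proof cases
      case 1
      have "P \<odot> ((A - c *\<^sub>R id_blinfun) \<odot> ?e) \<odot> P = ?D"
        using 1 A(3,4) PM(3) by (simp add: blinfun_compose_assoc) (simp add: blinfun_compose_distribs A)
      then show ?thesis using positive_sandwich[OF S(3) PM(2)] by simp
    next
      case 2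
      then have "(id_blinfun - ?e) \<odot> P = P" by (simp add: blinfun_compose_distribs)
      then have "P \<odot> ((c *\<^sub>R id_blinfun - A) \<odot> (id_blinfun - ?e)) \<odot> P = (-1) *\<^sub>R ?D"
        using PM(3) by (simp add: blinfun_compose_assoc) (simp add: blinfun_compose_distribs A)
      then show ?thesis using positive_sandwich[OF S(4) PM(2)] by simp
    qed
  qed
  ultimately have "?D = 0" using tr_faithful[OF D(1)] tr_faithful[OF D(2)] by auto
  then show ?thesis by (simp add: c_def)
qed

text \<open>A trace value \<open>u\<close> that can be cut off from every projection of at least that trace.\<close>

definition divisible :: "real \<Rightarrow> bool"
  where "divisible u \<longleftrightarrow> 0 < u \<and>
    (\<forall>F. proj F \<longrightarrow> u \<le> tr F \<longrightarrow> (\<exists>G. proj G \<and> F \<odot> G = G \<and> tr G = u))"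

lemma subdivide:
  assumes u: "divisible u" and F: "proj F" "real m * u \<le> tr F"
  obtains G :: "nat \<Rightarrow> 'h endo" where "\<And>j. j < m \<Longrightarrow> proj (G j)" "\<And>j. j < m \<Longrightarrow> F \<odot> G j = G j"
    "\<And>j. j < m \<Longrightarrow> tr (G j) = u" "\<And>i j. i < m \<Longrightarrow> j < m \<Longrightarrow> i \<noteq> j \<Longrightarrow> G i \<odot> G j = 0"
proof -
  have "\<exists>G. (\<forall>j<m. proj (G j) \<and> F \<odot> G j = G j \<and> tr (G j) = u) \<and> (\<forall>i<m. \<forall>j<m. i \<noteq> j \<longrightarrow> G i \<odot> G j = 0)"
    using F(2)
  proof (induction m)
    case (Suc m)
    have "0 < u" using u by (simp add: divisible_def)
    then have "real m * u \<le> tr F" using Suc.prems by (simp add: algebra_simps)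
    with Suc.IH obtain G where G: "\<And>j. j < m \<Longrightarrow> proj (G j)" "\<And>j. j < m \<Longrightarrow> F \<odot> G j = G j"
      "\<And>j. j < m \<Longrightarrow> tr (G j) = u" "\<And>i j. i < m \<Longrightarrow> j < m \<Longrightarrow> i \<noteq> j \<Longrightarrow> G i \<odot> G j = 0" by blast
    let ?S = "\<Sum>j<m. G j"
    have S: "proj ?S" using G by (intro proj_sum) auto
    have FS: "F \<odot> ?S = ?S" using G(2) by (simp add: blinfun_compose_sum_right)
    have R: "proj (F - ?S)" by (rule proj_diff[OF F(1) S FS])
    have "tr ?S = (\<Sum>j<m. tr (G j))" by (rule tr_sum) (use G(1) projD in auto)
    then have "tr (F - ?S) = tr F - real m * u"
      using S F(1) G(3) by (simp add: tr_diff projD)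
    then have "u \<le> tr (F - ?S)" using Suc.prems by (simp add: algebra_simps)
    then obtain g where g: "proj g" "(F - ?S) \<odot> g = g" "tr g = u"
      using u R by (auto simp: divisible_def)
    have SR: "?S \<odot> (F - ?S) = 0"
      using projD(3)[OF S] proj_le_commute[OF F(1) S FS] by (simp add: blinfun_compose_distribs)
    have "F \<odot> (F - ?S) = F - ?S" using projD(3)[OF F(1)] FS by (simp add: blinfun_compose_distribs)
    then have Fg: "F \<odot> g = g" using g(2) by (metis blinfun_compose_assoc)
    have Gg: "G j \<odot> g = 0" if "j < m" for j
    proof -
      have "G j \<odot> ?S = G j" by (rule proj_sum_absorb(1)) (use G that in auto)
      then have "G j \<odot> g = G j \<odot> ((?S \<odot> (F - ?S)) \<odot> g)" using g(2) by (metis blinfun_compose_assoc)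
      then show ?thesis using SR by simp
    qed
    let ?G = "G(m := g)"
    have "proj (?G j) \<and> F \<odot> ?G j = ?G j \<and> tr (?G j) = u" if "j < Suc m" for j
      using that G g Fg by (auto simp: less_Suc_eq)
    moreover have "?G i \<odot> ?G j = 0" if "i < Suc m" "j < Suc m" "i \<noteq> j" for i j
      using that G(4) Gg proj_orth_commute[OF G(1) g(1) Gg] by (auto simp: less_Suc_eq)
    ultimately show ?case by blast
  qed simp
  then show ?thesis using that by blast
qed

subsection \<open>No minimal projections\<close>

text \<open>The supremum projects onto the closure of the union of the ranges.  That it does not exceed a common
  bound of the traces is normality.\<close>

lemma proj_increasing_sup:
  assumes f: "\<And>n::nat. proj (f n)" and inc: "\<And>n. f (Suc n) \<odot> f n = f n"
  obtains g where "proj g" "\<And>n. g \<odot> f n = f n" "\<And>e. proj e \<Longrightarrow> (\<And>n. e \<odot> f n = f n) \<Longrightarrow> e \<odot> g = g"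
    "\<And>s. (\<And>n. tr (f n) \<le> s) \<Longrightarrow> tr g \<le> s"
proof -
  define S where "S = (\<Union>n. range (f n))"
  have inc': "f n \<odot> f m = f m" if "m \<le> n" for m n
    using that
  proof (induction n rule: dec_induct)
    case base
    show ?case by (rule projD(3)[OF f])
  next
    case (step n)
    then show ?case using inc[of n] by (metis blinfun_compose_assoc)
  qed
  have S_iff: "x \<in> S \<longleftrightarrow> (\<exists>n. f n x = x)" for x
  proof
    assume "x \<in> S"
    then obtain n y where "x = f n y" by (auto simp: S_def)
    then show "\<exists>n. f n x = x" using proj_apply[OF f] by blast
  next
    assume "\<exists>n. f n x = x"
    then show "x \<in> S" unfolding S_def by (metis UN_I UNIV_I rangeI)
  qed
  have fix_mono: "f n x = x" if "f m x = x" "m \<le> n" for m n x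
    using inc'[OF that(2)] that(1) by (metis blinfun_apply_blinfun_compose)
  have sub: "subspace S" unfolding subspace_def
  proof (intro conjI ballI allI)
    show "0 \<in> S" by (simp add: S_iff)
    fix x y assume "x \<in> S" "y \<in> S"
    then obtain m n where "f m x = x" "f n y = y" by (auto simp: S_iff)
    then have "f (max m n) (x + y) = x + y" using fix_mono[of m x "max m n"] fix_mono[of n y "max m n"]
      by (simp add: blinfun_lin)
    then show "x + y \<in> S" unfolding S_iff by blast
  next
    fix c x assume "x \<in> S"
    then obtain n where "f n x = x" by (auto simp: S_iff)
    then have "f n (c *\<^sub>R x) = c *\<^sub>R x" by (simp add: blinfun_lin)
    then show "c *\<^sub>R x \<in> S" unfolding S_iff by blast
  qed
  have "B x \<in> S" if B: "B \<in> commutant M" and x: "x \<in> S" for B x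
  proof -
    obtain n where n: "f n x = x" using x by (auto simp: S_iff)
    have "f n \<odot> B = B \<odot> f n" using B projD(1)[OF f] by (simp add: commutant_def)
    then have "f n (B x) = B x" using n by (metis blinfun_apply_blinfun_compose)
    then show ?thesis unfolding S_iff by blast
  qed
  then obtain g where g: "proj g" "\<And>x. g x \<in> closure S" "\<And>x. x \<in> S \<Longrightarrow> g x = x"
    using proj_onto_closure[OF sub] by blast
  have gf: "g \<odot> f n = f n" for n
  proof (rule blinfun_eqI)
    fix x
    have "f n x \<in> S" unfolding S_def by blast
    then show "(g \<odot> f n) x = f n x" by (simp add: g(3))
  qed
  have least: "e \<odot> g = g" if e: "proj e" "\<And>n. e \<odot> f n = f n" for e
  proof (rule blinfun_eqI)
    fix x
    have "closed {y. e y = y}" by (intro closed_Collect_eq continuous_intros)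
    moreover have "S \<subseteq> {y. e y = y}" using e(2) by (auto simp: S_def) (metis blinfun_apply_blinfun_compose)
    ultimately have "closure S \<subseteq> {y. e y = y}" by (rule closure_minimal[rotated])
    then show "(e \<odot> g) x = g x" using g(2)[of x] by auto
  qed
  have lim: "(\<lambda>n. f n (g x)) \<longlonglongrightarrow> g x" for x
  proof (rule LIMSEQ_I)
    fix r :: real assume "0 < r"
    then obtain z where z: "z \<in> S" "dist z (g x) < r / 2"
      using g(2)[of x] unfolding closure_approachable by (meson half_gt_zero)
    then obtain m where m: "f m z = z" by (auto simp: S_iff)
    have "norm (f n (g x) - g x) < r" if "m \<le> n" for n
    proof -
      have "f n (g x) - g x = f n (g x - z) + (z - g x)" using fix_mono[OF m that] by (simp add: blinfun_lin)
      then have "norm (f n (g x) - g x) \<le> norm (f n (g x - z)) + norm (z - g x)" by (metis norm_triangle_ineq)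
      also have "norm (f n (g x - z)) \<le> 1 * norm (g x - z)"
        by (rule order_trans[OF norm_blinfun]) (intro mult_right_mono proj_norm f, simp)
      finally show ?thesis using z(2) by (simp add: dist_norm norm_minus_commute)
    qed
    then show "\<exists>no. \<forall>n\<ge>no. norm (f n (g x) - g x) < r" by blast
  qed
  have le: "op_le (f m) (f n)" if "m \<le> n" for m n
    unfolding op_le_def by (intro proj_positive proj_diff f inc' that)
  have le_g: "op_le (f n) g" for n
    unfolding op_le_def by (intro proj_positive proj_diff f g gf)
  have fg: "f n (g x) = f n x" for n x
    using proj_le_commute[OF g(1) f gf, of n] by (metis blinfun_apply_blinfun_compose)
  have "tr g = (SUP n. tr (f n))"
  proof (rule tr_increasing_limit[OF projD(1)[OF f] proj_positive[OF f] le projD(1,2)[OF g(1)] le_g])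
    show "(\<lambda>n. inner (f n x) x) \<longlonglongrightarrow> inner (g x) x" for x
      using tendsto_inner[OF lim[of x] tendsto_const[of x]] by (simp add: fg)
  qed
  then have "tr g \<le> s" if "\<And>n. tr (f n) \<le> s" for s using that by (simp add: cSUP_least)
  with g(1) gf least show ?thesis using that by blast
qed

text \<open>A nonzero projection that is not minimal has a nonzero subprojection of at most half its trace.\<close>

lemma small_subprojection:
  assumes nomin: "\<And>P. \<not> minimal P" and e: "proj e" "e \<noteq> 0" and d: "0 < d"
  obtains f where "proj f" "e \<odot> f = f" "f \<noteq> 0" "tr f < d"
proof -
  have "\<exists>f. proj f \<and> e \<odot> f = f \<and> f \<noteq> 0 \<and> tr f \<le> tr e / 2 ^ n" for n
  proof (induction n)
    case 0
    then show ?case using e projD(3) by (intro exI[of _ e]) auto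
  next
    case (Suc n)
    then obtain f where f: "proj f" "e \<odot> f = f" "f \<noteq> 0" "tr f \<le> tr e / 2 ^ n" by blast
    then obtain q where q: "proj q" "f \<odot> q = q" "q \<noteq> 0" "q \<noteq> f"
      using nomin[of f] by (auto simp: minimal_def)
    let ?r = "f - q"
    have r: "proj ?r" "?r \<noteq> 0" using q f proj_diff by auto
    have fr: "f \<odot> ?r = ?r" using q projD(3)[OF f(1)] by (simp add: blinfun_compose_distribs)
    have eq: "e \<odot> q = q" "e \<odot> ?r = ?r" using f(2) q(2) fr by (metis blinfun_compose_assoc)+
    have "tr q + tr ?r = tr f" using q f by (simp add: tr_diff projD)
    then have "tr q \<le> tr f / 2 \<or> tr ?r \<le> tr f / 2" by linarith
    moreover have "tr f / 2 \<le> tr e / 2 ^ Suc n" using f(4) by simp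
    ultimately have "tr q \<le> tr e / 2 ^ Suc n \<or> tr ?r \<le> tr e / 2 ^ Suc n" by linarith
    then show ?case using q r eq by blast
  qed
  moreover obtain n where "tr e / 2 ^ n < d"
  proof -
    obtain n where "tr e / d < 2 ^ n" using real_arch_pow[of 2] by auto
    then show ?thesis using that d by (simp add: field_simps)
  qed
  ultimately show ?thesis using that by (meson order_le_less_trans)
qed

text \<open>Exhaustion: at each step the projection is enlarged nearly as much as the prescribed trace
  permits; if the union were still too small, a small projection could be added to it.\<close>

lemma intermediate_projection:
  assumes nomin: "\<And>P. \<not> minimal P" and e: "proj e" and s: "0 \<le> s" "s \<le> tr e"
  obtains g where "proj g" "e \<odot> g = g" "tr g = s"
proof -
  define ok where "ok h \<longleftrightarrow> proj h \<and> e \<odot> h = h \<and> tr h \<le> s" for h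
  have step: "\<exists>h. ok h \<and> h \<odot> g = g \<and> (\<forall>k. ok k \<longrightarrow> k \<odot> g = g \<longrightarrow> tr k \<le> tr h + inverse (Suc n))"
    if g: "ok g" for g and n :: nat
  proof -
    let ?A = "{tr h | h. ok h \<and> h \<odot> g = g}"
    have ne: "?A \<noteq> {}" using g projD(3) by (auto simp: ok_def)
    have bdd: "bdd_above ?A" by (rule bdd_aboveI[of _ s]) (auto simp: ok_def)
    have "Sup ?A - inverse (Suc n) < Sup ?A" by simp
    then obtain t where t: "t \<in> ?A" "Sup ?A - inverse (Suc n) < t" using less_cSupD[OF ne] by blast
    then obtain h where h: "t = tr h" "ok h" "h \<odot> g = g" by blast
    have "tr k \<le> tr h + inverse (Suc n)" if "ok k" "k \<odot> g = g" for k
    proof -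
      have "tr k \<le> Sup ?A" by (rule cSup_upper[OF _ bdd]) (use that in blast)
      then show ?thesis using t h by simp
    qed
    then show ?thesis using h by blast
  qed
  have ok0: "ok 0" using s by (simp add: ok_def proj_zero tr_zero)
  obtain f where f: "\<And>n. ok (f n)" "\<And>n. f (Suc n) \<odot> f n = f n \<and>
      (\<forall>k. ok k \<longrightarrow> k \<odot> f n = f n \<longrightarrow> tr k \<le> tr (f (Suc n)) + inverse (Suc n))"
  proof -
    have "\<exists>f. \<forall>n. ok (f n) \<and> (f (Suc n) \<odot> f n = f n \<and>
        (\<forall>k. ok k \<longrightarrow> k \<odot> f n = f n \<longrightarrow> tr k \<le> tr (f (Suc n)) + inverse (Suc n)))"
    proof (rule dependent_nat_choice)
      show "\<exists>h. ok h" using ok0 by blast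
      show "\<exists>h. ok h \<and> (h \<odot> g = g \<and> (\<forall>k. ok k \<longrightarrow> k \<odot> g = g \<longrightarrow> tr k \<le> tr h + inverse (Suc n)))"
        if "ok g" for g n using step[OF that] by simp
    qed
    then show ?thesis using that by blast
  qed
  obtain g where g: "proj g" "\<And>n. g \<odot> f n = f n" "\<And>e. proj e \<Longrightarrow> (\<And>n. e \<odot> f n = f n) \<Longrightarrow> e \<odot> g = g"
    "\<And>s. (\<And>n. tr (f n) \<le> s) \<Longrightarrow> tr g \<le> s"
    using proj_increasing_sup[of f] f by (auto simp: ok_def)
  have eg: "e \<odot> g = g" using g(3)[OF e] f(1) by (simp add: ok_def)
  have "tr g \<le> s" using g(4) f(1) by (simp add: ok_def)
  moreover have "\<not> tr g < s"
  proof
    assume lt: "tr g < s"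
    have eg': "proj (e - g)" by (rule proj_diff[OF e g(1) eg])
    moreover have "e - g \<noteq> 0" using lt s by auto
    ultimately obtain r where r: "proj r" "(e - g) \<odot> r = r" "r \<noteq> 0" "tr r < s - tr g"
      using small_subprojection[OF nomin _ _, of "e - g" "s - tr g"] lt by auto
    have "g \<odot> (e - g) = 0" using proj_le_commute[OF e g(1) eg] projD(3)[OF g(1)]
      by (simp add: blinfun_compose_distribs)
    then have gr: "g \<odot> r = 0" using r(2) by (metis blinfun_compose_assoc blinfun_compose_zero(1))
    have "e \<odot> (e - g) = e - g" using projD(3)[OF e] eg by (simp add: blinfun_compose_distribs)
    then have er: "e \<odot> r = r" using r(2) by (metis blinfun_compose_assoc)
    have ok: "ok (g + r)" using proj_add[OF g(1) r(1) gr] eg er r(4) g(1) r(1)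
      by (simp add: ok_def blinfun_compose_distribs tr_add projD)
    have rf: "r \<odot> f n = 0" for n
      using proj_orth_commute[OF g(1) r(1) gr] g(2) by (metis blinfun_compose_assoc blinfun_compose_zero(1))
    have "tr r \<le> inverse (Suc n)" for n
    proof -
      have "tr (g + r) \<le> tr (f (Suc n)) + inverse (Suc n)"
        using f(2)[of n] ok g(2)[of n] rf[of n] by (simp add: blinfun_compose_distribs)
      moreover have "tr (f (Suc n)) \<le> tr g"
        using f(1) by (intro tr_proj_le g) (simp add: ok_def)
      ultimately show ?thesis using g(1) r(1) by (simp add: tr_add projD)
    qed
    moreover have "0 < tr r" using r proj_tr_pos by blast
    ultimately show False using reals_Archimedean[of "tr r"] by (meson not_less)
  qed
  ultimately have "tr g = s" by simp
  then show ?thesis using that g(1) eg by blast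
qed

lemma divisible_diffuse: assumes "\<And>P. \<not> minimal P" "0 < u" shows "divisible u"
  unfolding divisible_def using intermediate_projection[OF assms(1)] assms(2) by (metis less_imp_le)

end

subsection \<open>Minimal projections in an algebra with the weak Dixmier property\<close>

locale weak_dixmier_algebra = finite_vn_algebra M \<tau>
  for M :: "('h::chilbert_space \<Rightarrow>\<^sub>L 'h) set" and \<tau> :: "('h \<Rightarrow>\<^sub>L 'h) \<Rightarrow> complex" +
  assumes weak_dixmier: "weak_Dixmier M \<tau>"
begin

text \<open>Being idempotent is visible in the moments: \<open>\<tau>((S - S\<^sup>2)\<^sup>2) = \<tau>((R - R\<^sup>2)\<^sup>2) = 0\<close>, and \<open>\<tau>\<close> is faithful.\<close>

lemma projection_of_equi_measurable:
  assumes R: "proj R" and S: "S \<in> M" "positive_op S" "equi_measurable \<tau> S R"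
  shows "proj S" "tr S = tr R"
proof -
  note J = closed_pair_algebra_moment_pairs[of S R]
  note RM = projD[OF R]
  have SR: "(S, R) \<in> moment_pairs S R" by (rule moment_pairs_generator)
  show "tr S = tr R" using moment_pairs_tau(3)[OF S(1) RM(1) S(3) SR] by (simp add: tr_def)
  let ?Y = "S - S \<odot> S"
  have "(?Y \<odot> ?Y, (R - R \<odot> R) \<odot> (R - R \<odot> R)) \<in> moment_pairs S R"
    by (intro closed_pair_algebraD[OF J] SR)
  from moment_pairs_tau(3)[OF S(1) RM(1) S(3) this]
  have t: "\<tau> (?Y \<odot> ?Y) = 0" using RM(3) by (simp add: tau_zero)
  have Y: "selfadj ?Y" using positive_selfadj[OF S(2)] by (intro selfadj_diff selfadj_compose) auto
  have YY: "?Y \<odot> ?Y = 0" using S(1) t Y by (intro tau_faithful positive_square) (auto simp: in_M)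
  then have "?Y (?Y x) = 0" for x by (metis blinfun_apply_blinfun_compose zero_blinfun.rep_eq)
  then have "inner (?Y x) (?Y x) = 0" for x using selfadjD[OF Y, of x "?Y x"] by simp
  then have "?Y = 0" by (intro blinfun_eqI) simp
  then show "proj S" using S positive_selfadj by (simp add: proj_def)
qed

text \<open>If every \<open>S\<close> equi-measurable with \<open>R\<close> annihilated the minimal projection \<open>P\<close>, so would
  \<open>\<tau>(R) 1\<close>.  For an \<open>S\<close> with \<open>S P \<noteq> 0\<close>, minimality makes \<open>S P\<close> a multiple of a partial isometry
  from \<open>P\<close> into \<open>S\<close>.\<close>

lemma minimal_trace_below:
  assumes P: "minimal P" and R: "proj R" "R \<noteq> 0"
  obtains S Q where "proj S" "tr S = tr R" "proj Q" "S \<odot> Q = Q" "tr Q = tr P"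
proof -
  have pP: "proj P" and P0: "P \<noteq> 0" using P by (auto simp: minimal_def)
  note PM = projD[OF pP] and RM = projD[OF R(1)]
  let ?E = "{S \<in> M. positive_op S \<and> equi_measurable \<tau> S R}"
  obtain S where S: "S \<in> ?E" "S \<odot> P \<noteq> 0"
  proof (rule ccontr)
    assume "\<not> thesis"
    then have "?E \<subseteq> {A. A \<odot> P = 0}" using that by blast
    moreover have "subspace {A. A \<odot> P = 0}" by (auto simp: subspace_def blinfun_compose_distribs)
    moreover have "closed {A. A \<odot> P = 0}"
      by (intro closed_Collect_eq bounded_bilinear.continuous_on[OF bounded_bilinear_blinfun_compose]
          continuous_intros)
    ultimately have "closure (convex hull ?E) \<subseteq> {A. A \<odot> P = 0}"
      by (intro closure_minimal hull_minimal) (auto intro: subspace_imp_convex)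
    moreover have "\<tau> R *\<^sub>C id_blinfun \<in> closure (convex hull ?E)"
      using weak_dixmier RM(1) proj_positive[OF R(1)] by (simp add: weak_Dixmier_def)
    ultimately have "(tr R *\<^sub>R id_blinfun) \<odot> P = 0"
      using tau_positive[OF RM(1) proj_positive[OF R(1)]] by (auto simp: scaleC_of_real)
    then show False using P0 proj_tr_pos[OF R] by (simp add: blinfun_compose_distribs)
  qed
  have SM: "S \<in> M" and pS: "proj S" and trS: "tr S = tr R"
    using S projection_of_equi_measurable[OF R(1)] by auto
  note SS = projD[OF pS]
  let ?A = "P \<odot> S \<odot> P"
  define c where "c = tr ?A / tr P"
  have PP: "P \<odot> (P \<odot> X) = P \<odot> X" "S \<odot> (S \<odot> X) = S \<odot> X" for X :: "'h endo"
    using PM(3) SS(3) by (metis blinfun_compose_assoc)+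
  have posA: "positive_op ?A" by (intro positive_sandwich proj_positive pS PM)
  have A: "?A = c *\<^sub>R P" unfolding c_def
    by (rule minimal_corner_scalar[OF P _ posA])
      (use PM SS PP in \<open>auto simp: in_M blinfun_compose_assoc\<close>)
  have A0: "?A \<noteq> 0"
  proof
    assume "?A = 0"
    have *: "op_adjoint (S \<odot> P) \<odot> (S \<odot> P) = ?A"
      using PM SS PP by (simp add: op_adjoint_compose bop selfadj_iff blinfun_compose_assoc)
    have "op_adjoint (S \<odot> P) ((S \<odot> P) x) = 0" for x
      using * \<open>?A = 0\<close> by (metis blinfun_apply_blinfun_compose zero_blinfun.rep_eq)
    then have "inner ((S \<odot> P) x) ((S \<odot> P) x) = 0" for x
      using inner_op_adjoint[OF bop[OF compose_in[OF SM PM(1)]], of x "(S \<odot> P) x"] by simp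
    then have "S \<odot> P = 0" by (intro blinfun_eqI) simp
    then show False using S by simp
  qed
  then have c0: "c \<noteq> 0" using A by auto
  let ?Q = "(1/c) *\<^sub>R (S \<odot> P \<odot> S)"
  have "(S \<odot> P \<odot> S) \<odot> (S \<odot> P \<odot> S) = S \<odot> ?A \<odot> S" using SS(3) PP by (simp add: blinfun_compose_assoc)
  also have "\<dots> = c *\<^sub>R (S \<odot> P \<odot> S)" by (simp add: A blinfun_compose_distribs)
  finally have "?Q \<odot> ?Q = ?Q" using c0 by (simp add: blinfun_compose_distribs)
  moreover have "selfadj ?Q"
    using positive_sandwich[OF proj_positive[OF pP] SS(2)] by (intro selfadj_scaleR positive_selfadj)
  ultimately have Q: "proj ?Q" using SM PM(1) by (simp add: proj_def in_M)
  have "S \<odot> ?Q = ?Q" using PP by (simp add: blinfun_compose_distribs blinfun_compose_assoc)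
  moreover have "tr ?Q = tr P"
  proof -
    have "tr (S \<odot> P \<odot> S) = tr (P \<odot> S)"
      using tr_commute[of S "P \<odot> S"] SM PM SS by (simp add: compose_in blinfun_compose_assoc)
    also have "\<dots> = tr ?A"
      using tr_commute[of P "P \<odot> S"] SM PM PP by (simp add: compose_in blinfun_compose_assoc)
    also have "\<dots> = c * tr P" using PM(1) by (simp add: A tr_scaleR)
    finally show ?thesis using c0 SM PM by (simp add: tr_scaleR compose_in)
  qed
  ultimately show ?thesis using that pS trS Q by blast
qed

lemma minimal_trace_le: "minimal P \<Longrightarrow> proj R \<Longrightarrow> R \<noteq> 0 \<Longrightarrow> tr P \<le> tr R"
  by (metis minimal_trace_below tr_proj_le)

text \<open>Replacing \<open>R\<close> by \<open>S - Q\<close> lowers the trace by exactly \<open>\<tau>(P)\<close>, which can happen only finitely often.\<close>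

lemma trace_multiple_of_minimal:
  assumes P: "minimal P" and R: "proj R" shows "\<exists>n::nat. tr R = real n * tr P"
proof -
  have t: "0 < tr P" using P proj_tr_pos by (auto simp: minimal_def)
  have "\<exists>n::nat. tr R = real n * tr P" if "proj R" "tr R \<le> real m * tr P" for R m
    using that
  proof (induction m arbitrary: R)
    case 0
    then show ?case using proj_tr_nonneg[of R] by (intro exI[of _ 0]) auto
  next
    case (Suc m)
    show ?case
    proof (cases "R = 0")
      case False
      then obtain S Q where SQ: "proj S" "tr S = tr R" "proj Q" "S \<odot> Q = Q" "tr Q = tr P"
        using minimal_trace_below[OF P Suc.prems(1)] by blast
      have pd: "proj (S - Q)" and tS: "tr (S - Q) = tr R - tr P"
        using proj_diff SQ by (auto simp: tr_diff projD)
      then have "tr (S - Q) \<le> real m * tr P" using Suc.prems(2) by (simp add: algebra_simps)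
      from Suc.IH[OF pd this] obtain n where "tr (S - Q) = real n * tr P" by blast
      then show ?thesis using tS by (intro exI[of _ "Suc n"]) (simp add: algebra_simps)
    qed (auto simp: tr_zero intro!: exI[of _ 0])
  qed
  moreover obtain m :: nat where "tr R / tr P < real m" using reals_Archimedean2 by blast
  then have "tr R \<le> real m * tr P" using t by (simp add: field_simps)
  ultimately show ?thesis using R by blast
qed

text \<open>Below \<open>F\<close>, a nonzero projection of least trace is minimal, and any two minimal projections have the
  same trace.\<close>

lemma divisible_minimal: assumes P: "minimal P" shows "divisible (tr P)"
  unfolding divisible_def
proof (intro conjI allI impI)
  show t: "0 < tr P" using P proj_tr_pos by (auto simp: minimal_def)
  fix F assume F: "proj F" "tr P \<le> tr F"
  let ?sub = "\<lambda>n G. proj G \<and> F \<odot> G = G \<and> G \<noteq> 0 \<and> tr G = real n * tr P"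
  have "F \<noteq> 0" using F t by (auto simp: tr_zero)
  then have ex: "\<exists>n. \<exists>G. ?sub n G" using trace_multiple_of_minimal[OF P F(1)] F(1) projD(3) by blast
  define n where "n = (LEAST n. \<exists>G. ?sub n G)"
  obtain G where G: "?sub n G" using LeastI_ex[OF ex] unfolding n_def by blast
  have "minimal G" unfolding minimal_def
  proof (intro conjI allI impI)
    fix Q assume Q: "proj Q" "G \<odot> Q = Q"
    show "Q = 0 \<or> Q = G"
    proof (cases "Q = 0")
      case False
      obtain k where k: "tr Q = real k * tr P" using trace_multiple_of_minimal[OF P Q(1)] by blast
      have "F \<odot> Q = Q" using G Q by (metis blinfun_compose_assoc)
      then have "n \<le> k" unfolding n_def using Q k False by (intro Least_le) blast
      then have "tr G \<le> tr Q" using G k t by simp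
      moreover have "tr Q \<le> tr G" using tr_proj_le G Q by blast
      ultimately show ?thesis using proj_eq_of_tr_eq[of G Q] G Q by auto
    qed simp
  qed (use G in auto)
  then have "tr G = tr P"
    using minimal_trace_le[OF P, of G] minimal_trace_le[of G P] G P
    by (intro antisym) (auto simp: minimal_def)
  then show "\<exists>G. proj G \<and> F \<odot> G = G \<and> tr G = tr P" using G by blast
qed

text \<open>Either there is a minimal projection, and all traces are multiples of its trace, or there is
  none, and any trace can be cut off.  In both cases a given projection has a subdivision whose
  unit leaves remainders as small as desired.\<close>

lemma fine_division:
  assumes P: "proj P" "P \<noteq> 0" and d: "0 < d"
  obtains u n where "divisible u" "tr P = real n * u"
    "u \<le> d \<or> (\<forall>F. proj F \<longrightarrow> (\<exists>m::nat. tr F = real m * u))"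
proof (cases "\<exists>Q. minimal Q")
  case True
  then show ?thesis using that divisible_minimal trace_multiple_of_minimal P(1) by metis
next
  case False
  have t: "0 < tr P" using P proj_tr_pos by blast
  obtain n :: nat where n: "tr P / d < real n" using reals_Archimedean2 by blast
  then have n0: "0 < real n" using t d by (meson divide_pos_pos less_trans)
  have "divisible (tr P / real n)" using False t n0 by (intro divisible_diffuse) auto
  moreover have "tr P = real n * (tr P / real n)" "tr P / real n \<le> d" using n n0 d by (auto simp: field_simps)
  ultimately show ?thesis using that by blast
qed

text \<open>Finitely many orthogonal projections are refined by pieces of one and the same trace, up to
  remainders of trace at most \<open>d\<close>.  The remainders together are again a union of such pieces, which
  carry the index \<open>K\<close>.\<close>

lemma equal_trace_refinement:
  fixes F :: "nat \<Rightarrow> 'h endo"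
  assumes F: "\<And>k. proj (F k)" "\<And>j k. j \<noteq> k \<Longrightarrow> F j \<odot> F k = 0" "(\<Sum>k<K. F k) = P" "P \<noteq> 0" and d: "0 < d"
  obtains G :: "nat \<Rightarrow> nat \<Rightarrow> 'h endo" and m u where
    "\<And>k j. k \<le> K \<Longrightarrow> j < m k \<Longrightarrow> proj (G k j) \<and> tr (G k j) = u"
    "\<And>k l i j. k \<le> K \<Longrightarrow> l \<le> K \<Longrightarrow> i < m k \<Longrightarrow> j < m l \<Longrightarrow> (k, i) \<noteq> (l, j) \<Longrightarrow> G k i \<odot> G l j = 0"
    "\<And>k j. k < K \<Longrightarrow> j < m k \<Longrightarrow> F k \<odot> G k j = G k j"
    "(\<Sum>k\<le>K. \<Sum>j<m k. G k j) = P" "\<And>k. k < K \<Longrightarrow> tr (F k) - real (m k) * u \<le> d"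
proof -
  have P: "proj P" unfolding F(3)[symmetric] using F by (intro proj_sum) auto
  obtain u n where u: "divisible u" "tr P = real n * u"
    and frac: "u \<le> d \<or> (\<forall>F. proj F \<longrightarrow> (\<exists>m::nat. tr F = real m * u))"
    using fine_division[OF P F(4) d] by metis
  have u0: "0 < u" using u(1) by (simp add: divisible_def)
  define m where "m k = nat \<lfloor>tr (F k) / u\<rfloor>" for k
  have m: "real (m k) * u \<le> tr (F k)" "tr (F k) - real (m k) * u \<le> d" for k
  proof -
    have nn: "0 \<le> tr (F k) / u" using proj_tr_nonneg[OF F(1)] u0 by simp
    then have mk: "real (m k) = of_int \<lfloor>tr (F k) / u\<rfloor>" by (simp add: m_def)
    have "real (m k) \<le> tr (F k) / u" "tr (F k) / u < real (m k) + 1" unfolding mk by linarith+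
    then have 1: "real (m k) * u \<le> tr (F k)" "tr (F k) - real (m k) * u < u"
      using u0 by (simp_all add: field_simps)
    show "real (m k) * u \<le> tr (F k)" by fact
    show "tr (F k) - real (m k) * u \<le> d"
    proof (cases "u \<le> d")
      case False
      then obtain l :: nat where l: "tr (F k) = real l * u" using frac F(1) by blast
      then have "m k = l" using u0 by (simp add: m_def)
      then show ?thesis using l d by simp
    qed (use 1 in simp)
  qed
  have "\<exists>G. (\<forall>j<m k. proj (G j) \<and> F k \<odot> G j = G j \<and> tr (G j) = u) \<and>
      (\<forall>i<m k. \<forall>j<m k. i \<noteq> j \<longrightarrow> G i \<odot> G j = 0)" for k
    using subdivide[OF u(1) F(1) m(1), of k] by metis
  then obtain G where "\<forall>k. (\<forall>j<m k. proj (G k j) \<and> F k \<odot> G k j = G k j \<and> tr (G k j) = u) \<and>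
      (\<forall>i<m k. \<forall>j<m k. i \<noteq> j \<longrightarrow> G k i \<odot> G k j = 0)" by metis
  then have G: "\<And>k j. j < m k \<Longrightarrow> proj (G k j)" "\<And>k j. j < m k \<Longrightarrow> F k \<odot> G k j = G k j"
    "\<And>k j. j < m k \<Longrightarrow> tr (G k j) = u"
    and Go: "\<And>k i j. i < m k \<Longrightarrow> j < m k \<Longrightarrow> i \<noteq> j \<Longrightarrow> G k i \<odot> G k j = 0" by blast+
  have GF: "G k j \<odot> F k = G k j" if "j < m k" for k j using proj_le_commute[OF F(1) G(1,2)] that by blast
  have GG: "G k i \<odot> G l j = 0" if "i < m k" "j < m l" "(k, i) \<noteq> (l, j)" for k l i j
  proof (cases "k = l")
    case False
    have "G k i \<odot> G l j = G k i \<odot> (F k \<odot> F l) \<odot> G l j"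
      using GF[OF that(1)] G(2)[OF that(2)] by (metis blinfun_compose_assoc)
    then show ?thesis using F(2)[OF False] by simp
  qed (use Go that in auto)
  define g where "g = (\<Sum>k<K. \<Sum>j<m k. G k j)"
  have g_eq: "g = (\<Sum>p\<in>(SIGMA k:{..<K}. {..<m k}). G (fst p) (snd p))"
    unfolding g_def by (subst sum.Sigma) (auto simp: case_prod_unfold)
  have pg: "proj g" unfolding g_eq using G(1) GG by (intro proj_sum) (auto simp: prod_eq_iff)
  have "P \<odot> G k j = G k j" if "k < K" "j < m k" for k j
  proof -
    have "P \<odot> F k = F k" unfolding F(3)[symmetric] by (rule proj_sum_absorb(2)) (use F that in auto)
    then show ?thesis using G(2)[OF that(2)] by (metis blinfun_compose_assoc)
  qed
  then have Pg: "P \<odot> g = g" by (simp add: g_def blinfun_compose_sum_right)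
  define R where "R = P - g"
  have R: "proj R" unfolding R_def by (rule proj_diff[OF P pg Pg])
  have Gg: "G k i \<odot> g = G k i" if "k < K" "i < m k" for k i
    using proj_sum_absorb(1)[of "SIGMA k:{..<K}. {..<m k}" "\<lambda>p. G (fst p) (snd p)" "(k, i)"] G(1) GG that
    by (auto simp: g_eq prod_eq_iff)
  have GR: "G k i \<odot> R = 0" if "k < K" "i < m k" for k i
  proof -
    have "g \<odot> R = 0" using projD(3)[OF pg] proj_le_commute[OF P pg Pg] by (simp add: R_def blinfun_compose_distribs)
    then show ?thesis using Gg[OF that] by (metis blinfun_compose_assoc blinfun_compose_zero(2))
  qed
  have "tr g = (\<Sum>k<K. real (m k) * u)"
  proof -
    have GM: "G k j \<in> M" if "j < m k" for k j using G(1)[OF that] by (rule projD)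
    have "tr g = (\<Sum>k<K. \<Sum>j<m k. tr (G k j))"
      unfolding g_def using GM by (subst tr_sum) (auto intro!: sum.cong tr_sum sum_in)
    then show ?thesis using G(3) by simp
  qed
  then have trR: "tr R = real n * u - (\<Sum>k<K. real (m k)) * u"
    using u(2) projD(1)[OF P] projD(1)[OF pg] by (simp add: R_def tr_diff sum_distrib_right)
  then have "(\<Sum>k<K. real (m k)) * u \<le> real n * u" using proj_tr_nonneg[OF R] by simp
  then have "(\<Sum>k<K. m k) \<le> n" using u0 by (simp add: of_nat_sum[symmetric] del: of_nat_sum)
  moreover define l where "l = n - (\<Sum>k<K. m k)"
  ultimately have trR: "tr R = real l * u" using trR by (simp add: of_nat_diff algebra_simps)
  obtain H where H: "\<And>j. j < l \<Longrightarrow> proj (H j)" "\<And>j. j < l \<Longrightarrow> R \<odot> H j = H j"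
    "\<And>j. j < l \<Longrightarrow> tr (H j) = u" "\<And>i j. i < l \<Longrightarrow> j < l \<Longrightarrow> i \<noteq> j \<Longrightarrow> H i \<odot> H j = 0"
    using subdivide[OF u(1) R, of l] trR by auto
  have sumH: "(\<Sum>j<l. H j) = R"
  proof (rule proj_eq_of_tr_eq[symmetric])
    show "proj (\<Sum>j<l. H j)" using H by (intro proj_sum) auto
    show "R \<odot> (\<Sum>j<l. H j) = (\<Sum>j<l. H j)" using H(2) by (simp add: blinfun_compose_sum_right)
    have "tr (\<Sum>j<l. H j) = (\<Sum>j<l. tr (H j))" by (rule tr_sum) (use H(1) projD in auto)
    then show "tr R = tr (\<Sum>j<l. H j)" using H(3) trR by simp
  qed (rule R)
  have GH: "G k i \<odot> H j = 0" if "k < K" "i < m k" "j < l" for k i j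
    using GR[OF that(1,2)] H(2)[OF that(3)] by (metis blinfun_compose_assoc blinfun_compose_zero(1))
  have HG: "H j \<odot> G k i = 0" if "k < K" "i < m k" "j < l" for k i j
    using proj_orth_commute[OF G(1) H(1) GH] that by blast
  let ?m = "m(K := l)" and ?G = "G(K := H)"
  show ?thesis
  proof (rule that[of ?m ?G u])
    show "?G k i \<odot> ?G k' j = 0" if "k \<le> K" "k' \<le> K" "i < ?m k" "j < ?m k'" "(k, i) \<noteq> (k', j)" for k k' i j
      using that GG GH HG H(4) by (cases "k = K"; cases "k' = K") auto
    have "(\<Sum>k\<le>K. \<Sum>j<?m k. ?G k j) = (\<Sum>k<K. \<Sum>j<m k. G k j) + (\<Sum>j<l. H j)"
      by (simp add: lessThan_Suc_atMost[symmetric])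
    then show "(\<Sum>k\<le>K. \<Sum>j<?m k. ?G k j) = P" by (simp add: sumH R_def g_def[symmetric])
  qed (use G H m in \<open>auto split: if_splits\<close>)
qed

end

section \<open>Conditional expectations do not increase the norm\<close>

lemma blinfun_orthogonal_sum_compose:
  fixes E :: "'i \<Rightarrow> ('a::real_normed_vector) endo"
  assumes "finite I" "\<And>i. i \<in> I \<Longrightarrow> E i \<odot> E i = E i"
    and "\<And>i j. i \<in> I \<Longrightarrow> j \<in> I \<Longrightarrow> i \<noteq> j \<Longrightarrow> E i \<odot> E j = 0"
  shows "(\<Sum>i\<in>I. a i *\<^sub>R E i) \<odot> (\<Sum>i\<in>I. b i *\<^sub>R E i) = (\<Sum>i\<in>I. (a i * b i) *\<^sub>R E i)"
proof -
  have "(\<Sum>i\<in>I. a i *\<^sub>R E i) \<odot> (\<Sum>j\<in>I. b j *\<^sub>R E j)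
      = (\<Sum>i\<in>I. \<Sum>j\<in>I. if j = i then (a i * b i) *\<^sub>R E i else 0)"
    unfolding blinfun_compose_sum_left blinfun_compose_sum_right
    by (intro sum.cong refl) (auto simp: blinfun_compose_distribs assms(2,3))
  also have "\<dots> = (\<Sum>i\<in>I. (a i * b i) *\<^sub>R E i)"
    using assms(1) by (intro sum.cong refl) simp
  finally show ?thesis .
qed

lemma op_power_orthogonal_sum:
  fixes E :: "'i \<Rightarrow> ('a::chilbert_space) endo"
  assumes I: "finite I" "\<And>i. i \<in> I \<Longrightarrow> E i \<odot> E i = E i"
    "\<And>i j. i \<in> I \<Longrightarrow> j \<in> I \<Longrightarrow> i \<noteq> j \<Longrightarrow> E i \<odot> E j = 0"
    and Y: "\<And>i. i \<in> I \<Longrightarrow> E i \<odot> Y = 0" "\<And>i. i \<in> I \<Longrightarrow> Y \<odot> E i = 0"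
  shows "op_power ((\<Sum>i\<in>I. a i *\<^sub>R E i) + Y) (Suc m) = (\<Sum>i\<in>I. (a i ^ Suc m) *\<^sub>R E i) + op_power Y (Suc m)"
proof (induction m)
  case (Suc m)
  have "(\<Sum>i\<in>I. a i *\<^sub>R E i) \<odot> op_power Y (Suc m) = 0"
    unfolding blinfun_compose_sum_left
    by (intro sum.neutral ballI) (simp add: blinfun_compose_distribs op_power_Suc blinfun_compose_assoc[symmetric] Y(1))
  moreover have "Y \<odot> (\<Sum>i\<in>I. (a i ^ Suc m) *\<^sub>R E i) = 0"
    unfolding blinfun_compose_sum_right
    by (intro sum.neutral ballI) (simp add: blinfun_compose_distribs Y(2))
  moreover have "(\<Sum>i\<in>I. a i *\<^sub>R E i) \<odot> (\<Sum>i\<in>I. (a i ^ Suc m) *\<^sub>R E i)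
      = (\<Sum>i\<in>I. (a i * a i ^ Suc m) *\<^sub>R E i)"
    by (rule blinfun_orthogonal_sum_compose) (use I in auto)
  ultimately show ?case
    unfolding op_power_Suc[of _ "Suc m"] Suc.IH blinfun_compose_distribs(1,2) by simp
qed (simp add: op_power_Suc)

lemma bij_betw_cyclic_shift: "bij_betw (\<lambda>i. (i + s) mod n) {..<n} {..<n :: nat}"
proof (cases "n = 0")
  case False
  have "k \<in> (\<lambda>i. (i + s) mod n) ` {..<n}" if "k < n" for k
  proof (rule image_eqI)
    have "s mod n < n" using False by simp
    have "((k + (n - s mod n)) mod n + s) mod n = (k + (n - s mod n) + s mod n) mod n"
      by (simp add: mod_simps)
    also have "\<dots> = (k + n) mod n" using \<open>s mod n < n\<close> by simp
    also have "\<dots> = k" using that by simp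
    finally show "k = ((k + (n - s mod n)) mod n + s) mod n" by simp
  qed (use False in auto)
  then have "(\<lambda>i. (i + s) mod n) ` {..<n} = {..<n}" using False by auto
  then show ?thesis unfolding bij_betw_def by (metis finite_lessThan finite_surj_inj subset_refl)
qed (simp add: bij_betw_def)

context finite_vn_algebra
begin

lemma tau_op_power_orthogonal_sum:
  assumes I: "finite I" "\<And>i. i \<in> I \<Longrightarrow> proj (E i)"
    "\<And>i j. i \<in> I \<Longrightarrow> j \<in> I \<Longrightarrow> i \<noteq> j \<Longrightarrow> E i \<odot> E j = 0"
    and Y: "Y \<in> M" "\<And>i. i \<in> I \<Longrightarrow> E i \<odot> Y = 0" "\<And>i. i \<in> I \<Longrightarrow> Y \<odot> E i = 0"
  shows "\<tau> (op_power ((\<Sum>i\<in>I. a i *\<^sub>R E i) + Y) n)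
    = (if n = 0 then 1 else of_real (\<Sum>i\<in>I. a i ^ n * tr (E i)) + \<tau> (op_power Y n))"
proof (cases n)
  case (Suc m)
  have "\<tau> (op_power ((\<Sum>i\<in>I. a i *\<^sub>R E i) + Y) n) = \<tau> ((\<Sum>i\<in>I. (a i ^ n) *\<^sub>R E i) + op_power Y n)"
    unfolding Suc by (subst op_power_orthogonal_sum) (use I Y projD(3) in auto)
  also have "\<dots> = (\<Sum>i\<in>I. \<tau> ((a i ^ n) *\<^sub>R E i)) + \<tau> (op_power Y n)"
    using projD(1)[OF I(2)] op_power_in[OF alg Y(1)] by (simp add: tau_add sum_in scaleR_in tau_sum)
  also have "(\<Sum>i\<in>I. \<tau> ((a i ^ n) *\<^sub>R E i)) = of_real (\<Sum>i\<in>I. a i ^ n * tr (E i))"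
    unfolding of_real_sum
    by (intro sum.cong refl) (simp add: tau_scaleR projD(1)[OF I(2)] tau_positive proj_positive I(2))
  finally show ?thesis using Suc by simp
qed (simp add: tau_id)

end

context gauge_norm
begin

text \<open>Permuting the coefficients of projections of equal trace does not change the moments.  The
  mean over all cyclic permutations has constant coefficients.\<close>

lemma N_equal_trace_average:
  assumes J: "finite J" "\<And>i. i \<in> J \<Longrightarrow> proj (E i)" "\<And>i. i \<in> J \<Longrightarrow> tr (E i) = u"
    "\<And>i j. i \<in> J \<Longrightarrow> j \<in> J \<Longrightarrow> i \<noteq> j \<Longrightarrow> E i \<odot> E j = 0"
    and Y: "Y \<in> M" "positive_op Y" "\<And>i. i \<in> J \<Longrightarrow> E i \<odot> Y = 0" "\<And>i. i \<in> J \<Longrightarrow> Y \<odot> E i = 0"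
    and a: "\<And>i. i \<in> J \<Longrightarrow> 0 \<le> a i"
  shows "N (((\<Sum>i\<in>J. a i) / card J) *\<^sub>R (\<Sum>i\<in>J. E i) + Y) \<le> N ((\<Sum>i\<in>J. a i *\<^sub>R E i) + Y)"
proof (cases "J = {}")
  case False
  define n where "n = card J"
  have n: "0 < n" using False J(1) by (simp add: n_def card_gt_0_iff)
  obtain h where h: "bij_betw h {..<n} J"
    using ex_bij_betw_nat_finite[OF J(1)] by (auto simp: n_def atLeast0LessThan)
  have hJ: "h i \<in> J" if "i < n" for i using h that by (auto simp: bij_betw_def)
  have hne: "h i \<noteq> h j" if "i < n" "j < n" "i \<noteq> j" for i j
    using h that by (auto simp: bij_betw_def inj_on_def)
  define F where "F i = E (h i)" for i
  define b where "b i = a (h i)" for i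
  have F: "proj (F i)" "tr (F i) = u" "F i \<odot> Y = 0" "Y \<odot> F i = 0" "F i \<in> M" if "i < n" for i
    using J hJ[OF that] Y projD by (auto simp: F_def)
  have Fo: "F i \<odot> F j = 0" if "i < n" "j < n" "i \<noteq> j" for i j
    using J(4) hJ hne that by (auto simp: F_def)
  define A where "A s = (\<Sum>i<n. b ((i + s) mod n) *\<^sub>R F i) + Y" for s
  have AM: "A s \<in> M" for s unfolding A_def using F Y by (intro add_in sum_in scaleR_in) auto
  have Apos: "positive_op (A s)" for s unfolding A_def
  proof (intro positive_add positive_sum positive_scaleR Y(2))
    show "positive_op (F i)" if "i \<in> {..<n}" for i using F(1) that by (intro proj_positive) simp
    show "0 \<le> b ((i + s) mod n)" for i using a[OF hJ] n by (simp add: b_def)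
  qed
  have shift: "(\<Sum>i<n. g ((i + s) mod n)) = (\<Sum>i<n. g i)" for g :: "nat \<Rightarrow> real" and s
    by (rule sum.reindex_bij_betw[OF bij_betw_cyclic_shift])
  have "\<tau> (op_power (A s) m) = \<tau> (op_power (A 0) m)" for s m
  proof -
    have "\<tau> (op_power (A s) m)
        = (if m = 0 then 1 else of_real (\<Sum>i<n. b ((i + s) mod n) ^ m * u) + \<tau> (op_power Y m))" for s
      unfolding A_def using F Fo Y by (subst tau_op_power_orthogonal_sum) auto
    then show ?thesis using shift[of "\<lambda>i. b i ^ m * u"] by simp
  qed
  then have NA: "N (A s) = N (A 0)" for s
    by (intro N_equi AM Apos) (simp add: equi_measurable_def)
  have "(1 / n) *\<^sub>R (\<Sum>s<n. A s) = (\<Sum>i<n. ((\<Sum>s<n. b ((i + s) mod n)) / n) *\<^sub>R F i) + Y"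
  proof -
    have "(\<Sum>s<n. A s) = (\<Sum>i<n. (\<Sum>s<n. b ((i + s) mod n)) *\<^sub>R F i) + real n *\<^sub>R Y"
      unfolding A_def sum.distrib
      by (subst sum.swap) (simp add: scaleR_left.sum sum_constant_scaleR)
    then show ?thesis using n by (simp add: scaleR_add_right scaleR_sum_right)
  qed
  also have "\<dots> = (\<Sum>i<n. ((\<Sum>s<n. b s) / n) *\<^sub>R F i) + Y"
    using shift[of b] by (simp add: add.commute)
  also have "\<dots> = ((\<Sum>s<n. b s) / n) *\<^sub>R (\<Sum>i<n. F i) + Y" by (simp add: scaleR_sum_right)
  also have "(\<Sum>s<n. b s) = (\<Sum>i\<in>J. a i)" unfolding b_def by (rule sum.reindex_bij_betw[OF h])
  also have "(\<Sum>i<n. F i) = (\<Sum>i\<in>J. E i)" unfolding F_def by (rule sum.reindex_bij_betw[OF h])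
  finally have eq: "(1 / n) *\<^sub>R (\<Sum>s<n. A s) = ((\<Sum>i\<in>J. a i) / n) *\<^sub>R (\<Sum>i\<in>J. E i) + Y" .
  have "N (((\<Sum>i\<in>J. a i) / n) *\<^sub>R (\<Sum>i\<in>J. E i) + Y) = (1 / n) * N (\<Sum>s<n. A s)"
  proof -
    have "(\<Sum>s<n. A s) \<in> M" by (rule sum_in) (rule AM)
    from N_scaleR[OF this, of "1 / n"] have "N (((\<Sum>i\<in>J. a i) / n) *\<^sub>R (\<Sum>i\<in>J. E i) + Y)
        = \<bar>1 / real n\<bar> * N (\<Sum>s<n. A s)" unfolding eq .
    moreover have "\<bar>1 / real n\<bar> = 1 / n" by simp
    ultimately show ?thesis by (simp only:)
  qed
  also have "\<dots> \<le> (1 / n) * (\<Sum>s<n. N (A s))"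
    by (rule mult_left_mono[OF N_sum[OF AM]]) simp
  also have "(\<Sum>s<n. N (A s)) = (\<Sum>s<n. N (A 0))" by (intro sum.cong NA refl)
  also have "(1 / n) * \<dots> = (1 / n) * (real n * N (A 0))" by simp
  also have "\<dots> = N (A 0)" using n by simp
  also have "A 0 = (\<Sum>i\<in>J. a i *\<^sub>R E i) + Y"
    unfolding A_def b_def F_def using sum.reindex_bij_betw[OF h, of "\<lambda>j. a j *\<^sub>R E j"] by simp
  finally show ?thesis by (simp add: n_def)
qed simp

end

locale weak_dixmier_gauge = weak_dixmier_algebra M \<tau> + gauge_norm M \<tau> N
  for M :: "('h::chilbert_space \<Rightarrow>\<^sub>L 'h) set" and \<tau> :: "('h \<Rightarrow>\<^sub>L 'h) \<Rightarrow> complex"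
    and N :: "('h \<Rightarrow>\<^sub>L 'h) \<Rightarrow> real"
begin

text \<open>On the range of \<open>P\<close>, approximate \<open>X\<close> by finitely many multiples of projections, cut these into
  pieces of equal trace, set \<open>X\<close> to zero on the small remainders (a contraction), and average.\<close>

lemma N_average_corner:
  assumes X: "X \<in> M" "positive_op X" and P: "proj P" "P \<noteq> 0" and comm: "X \<odot> P = P \<odot> X"
  shows "N ((tr (X \<odot> P) / tr P) *\<^sub>R P + X \<odot> (id_blinfun - P)) \<le> N X"
proof (rule field_le_epsilon)
  fix e :: real assume e: "0 < e"
  define t where "t = tr P"
  define Y where "Y = X \<odot> (id_blinfun - P)"
  note PM = projD[OF P(1)]
  have t: "0 < t" using proj_tr_pos[OF P] by (simp add: t_def)
  \<comment> \<open>with mesh \<open>d\<close>, all errors together amount to at most \<open>d C\<close>\<close>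
  define C where "C = N id_blinfun + 2 * N P / t"
  have C: "0 \<le> C" using N_nonneg[OF id_in] N_nonneg[OF PM(1)] t by (simp add: C_def)
  define d where "d = e / (C + 1)"
  have d: "0 < d" using e C by (simp add: d_def)
  obtain K :: nat where "norm X / d < real K" using reals_Archimedean2 by blast
  then have K: "norm X < real K * d" using d by (simp add: field_simps)
  then have K0: "0 < real K" using norm_ge_zero[of X] d by (metis le_less_trans zero_less_mult_pos2)
  define S where "S = slice X d"
  define F where "F k = S k \<odot> P" for k
  have S: "proj (S k)" "P \<odot> S k = S k \<odot> P" "S k \<in> M" for k
    using proj_slice[OF X d] slice_commute[OF X d PM(1,2) comm[symmetric]] by (auto simp: S_def projD)
  have F: "proj (F k)" "F k \<in> M" "P \<odot> F k = F k" for k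
  proof -
    show "proj (F k)" unfolding F_def by (intro proj_compose S P S(2)[symmetric])
    then show "F k \<in> M" by (rule projD)
    show "P \<odot> F k = F k" unfolding F_def using S(2) PM(3) by (metis blinfun_compose_assoc)
  qed
  have Fo: "F j \<odot> F k = 0" if "j \<noteq> k" for j k
  proof -
    have "F j \<odot> F k = (S j \<odot> S k) \<odot> P" unfolding F_def using S(2) PM(3) by (metis blinfun_compose_assoc)
    then show ?thesis using slice_orthogonal[OF X d that] by (simp add: S_def)
  qed
  have sumF: "(\<Sum>k<K. F k) = P"
    using slice_sum[OF X d K] by (simp add: F_def S_def blinfun_compose_sum_left[symmetric])
  \<comment> \<open>the remainders have trace at most \<open>1 / K\<^sup>2\<close>, against \<open>K\<close> coefficients below \<open>K d\<close>\<close>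
  obtain G m u where G: "\<And>k j. k \<le> K \<Longrightarrow> j < m k \<Longrightarrow> proj (G k j) \<and> tr (G k j) = u"
    "\<And>k l i j. k \<le> K \<Longrightarrow> l \<le> K \<Longrightarrow> i < m k \<Longrightarrow> j < m l \<Longrightarrow> (k, i) \<noteq> (l, j) \<Longrightarrow> G k i \<odot> G l j = 0"
    "\<And>k j. k < K \<Longrightarrow> j < m k \<Longrightarrow> F k \<odot> G k j = G k j"
    and sumG: "(\<Sum>k\<le>K. \<Sum>j<m k. G k j) = P"
    and rem: "\<And>k. k < K \<Longrightarrow> tr (F k) - real (m k) * u \<le> 1 / (real K)\<^sup>2"
    by (rule equal_trace_refinement[OF F(1) Fo sumF P(2), of "1 / (real K)\<^sup>2"]) (use K0 in auto)
  define g where "g k = (\<Sum>j<m k. G k j)" for k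
  define r where "r k = F k - g k" for k
  have g: "proj (g k)" "F k \<odot> g k = g k" "tr (g k) = real (m k) * u" if k: "k < K" for k
  proof -
    show "proj (g k)" unfolding g_def using G(1,2) k by (intro proj_sum) auto
    show "F k \<odot> g k = g k" using G(3) k by (simp add: g_def blinfun_compose_sum_right)
    have "tr (g k) = (\<Sum>j<m k. tr (G k j))" unfolding g_def by (rule tr_sum) (use G(1) k projD in auto)
    then show "tr (g k) = real (m k) * u" using G(1) k by simp
  qed
  have r: "proj (r k)" "F k \<odot> r k = r k" "r k \<odot> F k = r k" "tr (r k) = tr (F k) - real (m k) * u" if k: "k < K" for k
  proof -
    show pr: "proj (r k)" unfolding r_def by (rule proj_diff[OF F(1) g(1,2)[OF k]])
    show Fr: "F k \<odot> r k = r k" using projD(3)[OF F(1)] g(2)[OF k] by (simp add: r_def blinfun_compose_distribs)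
    show "r k \<odot> F k = r k" by (rule proj_le_commute[OF F(1) pr Fr])
    show "tr (r k) = tr (F k) - real (m k) * u"
      using F(2) projD(1)[OF g(1)[OF k]] g(3)[OF k] by (simp add: r_def tr_diff)
  qed
  have rF: "r l \<odot> F k = (if l = k then r k else 0)" if "l < K" for k l
    using r(3)[OF that] Fo by (metis blinfun_compose_assoc blinfun_compose_zero(2))
  define R where "R = (\<Sum>k<K. r k)"
  have R: "proj R" unfolding R_def
  proof (rule proj_sum)
    show "r i \<odot> r j = 0" if "i \<in> {..<K}" "j \<in> {..<K}" "i \<noteq> j" for i j
      using rF[of i j] r(2)[of j] that by (metis blinfun_compose_assoc blinfun_compose_zero(1) lessThan_iff)
  qed (use r in auto)
  have RF: "R \<odot> F k = r k" if "k < K" for k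
    using that by (simp add: R_def blinfun_compose_sum_left rF)
  have PR: "P \<odot> R = R"
  proof -
    have "P \<odot> r k = r k" if "k < K" for k using F(3) r(2)[OF that] by (metis blinfun_compose_assoc)
    then show ?thesis by (simp add: R_def blinfun_compose_sum_right)
  qed
  have RP: "R \<odot> P = R" by (rule proj_le_commute[OF P(1) R PR])
  define J where "J = (SIGMA k:{..K}. {..<m k})"
  have finJ: "finite J" by (simp add: J_def)
  define E where "E p = G (fst p) (snd p)" for p
  define a where "a p = (if fst p < K then real (fst p) * d else 0)" for p :: "nat \<times> nat"
  have sumE: "(\<Sum>p\<in>J. E p) = P"
    unfolding J_def E_def sumG[symmetric] by (subst sum.Sigma) (auto simp: case_prod_unfold)
  have sumaE: "(\<Sum>p\<in>J. a p *\<^sub>R E p) = (\<Sum>k<K. (real k * d) *\<^sub>R g k)"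
  proof -
    have "(\<Sum>p\<in>J. a p *\<^sub>R E p) = (\<Sum>k\<le>K. \<Sum>j<m k. a (k, j) *\<^sub>R E (k, j))"
      unfolding J_def by (subst sum.Sigma) auto
    then show ?thesis by (simp add: a_def E_def g_def scaleR_sum_right lessThan_Suc_atMost[symmetric])
  qed
  have suma: "(\<Sum>p\<in>J. a p) = (\<Sum>k<K. real k * d * real (m k))"
  proof -
    have "(\<Sum>p\<in>J. a p) = (\<Sum>k\<le>K. \<Sum>j<m k. a (k, j))" unfolding J_def by (subst sum.Sigma) auto
    then show ?thesis by (simp add: a_def lessThan_Suc_atMost[symmetric] mult.commute)
  qed
  have pE: "proj (E p)" "tr (E p) = u" if "p \<in> J" for p
    using G(1) that by (auto simp: J_def E_def)
  have Eo: "E p \<odot> E q = 0" if "p \<in> J" "q \<in> J" "p \<noteq> q" for p q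
    using G(2) that by (auto simp: J_def E_def prod_eq_iff)
  have EP: "E p \<odot> P = E p" "P \<odot> E p = E p" if "p \<in> J" for p
    using proj_sum_absorb[of J E p] pE(1) Eo that by (simp_all add: sumE finJ)
  have PY: "P \<odot> Y = 0" "Y \<odot> P = 0"
  proof -
    show "Y \<odot> P = 0" using PM(3) by (simp add: Y_def blinfun_compose_distribs blinfun_compose_assoc)
    show "P \<odot> Y = 0" using PM(3) comm by (simp add: Y_def blinfun_compose_distribs)
      (metis blinfun_compose_assoc)
  qed
  have Y: "Y \<in> M" "positive_op Y"
  proof -
    show "Y \<in> M" using X PM by (simp add: Y_def in_M)
    show "positive_op Y" unfolding Y_def
      by (intro positive_compose_commuting X proj_positive proj_compl P) (simp add: blinfun_compose_distribs comm)
  qed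
  have EY: "E p \<odot> Y = 0" "Y \<odot> E p = 0" if "p \<in> J" for p
    using EP[OF that] PY by (metis blinfun_compose_assoc blinfun_compose_zero)+
  define b where "b = (\<Sum>p\<in>J. a p) / card J"
  have avg: "N (b *\<^sub>R P + Y) \<le> N ((\<Sum>k<K. (real k * d) *\<^sub>R g k) + Y)"
    unfolding b_def sumE[symmetric] sumaE[symmetric]
    using pE Eo Y EY d by (intro N_equal_trace_average) (auto simp: J_def a_def)
  define X' where "X' = (\<Sum>k<K. (real k * d) *\<^sub>R F k) + Y"
  have X'M: "X' \<in> M" using F(2) Y by (simp add: X'_def in_M)
  define D where "D = X - (\<Sum>k<K. (real k * d) *\<^sub>R S k)"
  have DM: "D \<in> M" using X S(3) by (simp add: D_def in_M)
  have DP: "D \<odot> P = X \<odot> P - (\<Sum>k<K. (real k * d) *\<^sub>R F k)"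
    by (simp add: D_def F_def blinfun_compose_sum_left blinfun_compose_distribs)
  have nD: "norm (D \<odot> P) \<le> d"
  proof -
    have "norm D * norm P \<le> d * 1"
      using slice_approx[OF X d K] proj_norm[OF P(1)] d by (intro mult_mono) (auto simp: D_def S_def)
    then show ?thesis using norm_blinfun_compose[of D P] by simp
  qed
  have "X' = X - D \<odot> P" unfolding DP by (simp add: X'_def Y_def blinfun_compose_distribs)
  then have "N X' \<le> N X + N (D \<odot> P)" using N_diff X DM PM by (simp add: compose_in)
  also have "N (D \<odot> P) \<le> d * N id_blinfun"
    using N_le_norm[of "D \<odot> P"] nD DM PM mult_right_mono[OF nD N_nonneg[OF id_in]] by (simp add: compose_in)
  finally have NX': "N X' \<le> N X + d * N id_blinfun" by simp
  have "(id_blinfun - R) \<odot> X' = (\<Sum>k<K. (real k * d) *\<^sub>R g k) + Y"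
  proof -
    have "R \<odot> (\<Sum>k<K. (real k * d) *\<^sub>R F k) = (\<Sum>k<K. (real k * d) *\<^sub>R r k)"
      unfolding blinfun_compose_sum_right by (intro sum.cong) (auto simp: blinfun_compose_distribs RF)
    moreover have "R \<odot> Y = 0" using RP PY(1) by (metis blinfun_compose_assoc blinfun_compose_zero(2))
    ultimately show ?thesis
      by (simp add: X'_def blinfun_compose_distribs r_def sum_subtractf scaleR_diff_right)
  qed
  moreover have "N ((id_blinfun - R) \<odot> X') \<le> N X'"
    by (intro N_contraction_left proj_norm proj_compl R X'M projD)
  ultimately have 1: "N (b *\<^sub>R P + Y) \<le> N X + d * N id_blinfun" using avg NX' by simp
  define c where "c = tr (X \<odot> P) / t"
  have 2: "\<bar>c - b\<bar> \<le> 2 * d / t"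
  proof -
    have "t = real (card J) * u"
    proof -
      have "tr (\<Sum>p\<in>J. E p) = (\<Sum>p\<in>J. tr (E p))" by (rule tr_sum) (use pE(1) projD in auto)
      then show ?thesis using pE(2) by (simp add: sumE t_def)
    qed
    then have "b * t = (\<Sum>p\<in>J. a p) * u" using t by (auto simp: b_def)
    also have "\<dots> = (\<Sum>k<K. real k * d * (tr (F k) - tr (r k)))"
      by (simp add: suma sum_distrib_right sum_distrib_left r(4) algebra_simps)
    finally have bt: "b * t = (\<Sum>k<K. real k * d * tr (F k)) - (\<Sum>k<K. real k * d * tr (r k))"
      by (simp add: sum_subtractf algebra_simps)
    have "tr (D \<odot> P) = tr (X \<odot> P) - (\<Sum>k<K. real k * d * tr (F k))"
      unfolding DP using X PM F(2) by (simp add: tr_diff tr_sum tr_scaleR in_M)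
    then have ct: "c * t - b * t = tr (D \<odot> P) + (\<Sum>k<K. real k * d * tr (r k))"
      using t bt by (simp add: c_def)
    have "\<bar>tr (D \<odot> P)\<bar> \<le> d"
      using tau_norm_bound[of "D \<odot> P"] nD abs_Re_le_cmod[of "\<tau> (D \<odot> P)"] DM PM by (simp add: tr_def compose_in)
    moreover have "0 \<le> (\<Sum>k<K. real k * d * tr (r k))"
      using d r(1) proj_tr_nonneg by (intro sum_nonneg mult_nonneg_nonneg) auto
    moreover have "(\<Sum>k<K. real k * d * tr (r k)) \<le> d"
    proof -
      have "(\<Sum>k<K. real k * d * tr (r k)) \<le> (\<Sum>k<K. real K * d * (1 / (real K)\<^sup>2))"
        using d rem r(4) proj_tr_nonneg[OF r(1)] by (intro sum_mono mult_mono) auto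
      also have "\<dots> = d" using K0 by (simp add: power2_eq_square)
      finally show ?thesis .
    qed
    ultimately have "\<bar>c * t - b * t\<bar> \<le> 2 * d" using ct by linarith
    moreover have "\<bar>c * t - b * t\<bar> = \<bar>c - b\<bar> * t" using t by (simp add: abs_mult left_diff_distrib[symmetric])
    ultimately show ?thesis using t by (simp add: field_simps)
  qed
  have "c *\<^sub>R P + Y = (b *\<^sub>R P + Y) + (c - b) *\<^sub>R P" by (simp add: scaleR_left_diff_distrib)
  then have "N (c *\<^sub>R P + Y) \<le> N (b *\<^sub>R P + Y) + N ((c - b) *\<^sub>R P)"
    using Y PM by (metis N_triangle add_in scaleR_in)
  also have "N ((c - b) *\<^sub>R P) \<le> 2 * d / t * N P"
    using 2 N_nonneg[OF PM(1)] PM by (simp only: N_scaleR) (intro mult_right_mono, auto)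
  finally have "N (c *\<^sub>R P + Y) \<le> N X + d * C" using 1 by (simp add: C_def algebra_simps)
  also have "d * C \<le> d * (C + 1)" using d by simp
  also have "d * (C + 1) = e" using C by (simp add: d_def)
  finally show "N ((tr (X \<odot> P) / tr P) *\<^sub>R P + X \<odot> (id_blinfun - P)) \<le> N X + e"
    by (simp add: c_def Y_def t_def)
qed

text \<open>The \<open>P i\<close> are treated one at a time; the averages already formed are not affected.\<close>

lemma N_average_partition:
  assumes I: "finite I" "\<And>i. i \<in> I \<Longrightarrow> proj (P i)"
    "\<And>i j. i \<in> I \<Longrightarrow> j \<in> I \<Longrightarrow> i \<noteq> j \<Longrightarrow> P i \<odot> P j = 0" and sum: "(\<Sum>i\<in>I. P i) = id_blinfun"
    and X: "X \<in> M" "positive_op X" "\<And>i. i \<in> I \<Longrightarrow> X \<odot> P i = P i \<odot> X"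
  shows "N (\<Sum>i\<in>I. (tr (X \<odot> P i) / tr (P i)) *\<^sub>R P i) \<le> N X"
proof -
  define x where "x i = tr (X \<odot> P i) / tr (P i)" for i
  have xpos: "0 \<le> x i" if "i \<in> I" for i
  proof -
    have "positive_op (X \<odot> P i)" by (intro positive_compose_commuting X(2) proj_positive I(2) X(3) that)
    then show ?thesis unfolding x_def
      using that I(2) X(1) by (intro divide_nonneg_nonneg tr_nonneg proj_tr_nonneg) (auto simp: in_M projD)
  qed
  have "N ((\<Sum>i\<in>J. x i *\<^sub>R P i) + X \<odot> (id_blinfun - (\<Sum>i\<in>J. P i))) \<le> N X" if "finite J" "J \<subseteq> I" for J
    using that
  proof (induction J)
    case (insert j J)
    let ?Z = "(\<Sum>i\<in>J. x i *\<^sub>R P i) + X \<odot> (id_blinfun - (\<Sum>i\<in>J. P i))"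
    have j: "j \<in> I" "j \<notin> J" and JI: "J \<subseteq> I" using insert by auto
    have oJ: "P i \<odot> P j = 0" "P j \<odot> P i = 0" if "i \<in> J" for i
      using I(3)[of i j] I(3)[of j i] j JI that by auto
    have sJ: "(\<Sum>i\<in>J. P i) \<odot> P j = 0" "P j \<odot> (\<Sum>i\<in>J. P i) = 0" "(\<Sum>i\<in>J. x i *\<^sub>R P i) \<odot> P j = 0" "P j \<odot> (\<Sum>i\<in>J. x i *\<^sub>R P i) = 0"
      unfolding blinfun_compose_sum_left blinfun_compose_sum_right
      by (auto intro!: sum.neutral simp: blinfun_compose_distribs oJ)
    have pJ: "proj (\<Sum>i\<in>J. P i)" using I JI finite_subset[OF JI I(1)] by (intro proj_sum) auto
    have XJ: "X \<odot> (\<Sum>i\<in>J. P i) = (\<Sum>i\<in>J. P i) \<odot> X"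
      unfolding blinfun_compose_sum_left blinfun_compose_sum_right using X(3) JI by (intro sum.cong) auto
    have Z: "?Z \<in> M" "positive_op ?Z"
    proof -
      show "?Z \<in> M" using I X JI by (auto simp: projD subset_iff intro!: in_M)
      have "positive_op (X \<odot> (id_blinfun - (\<Sum>i\<in>J. P i)))"
        by (intro positive_compose_commuting X proj_positive proj_compl pJ) (simp add: blinfun_compose_distribs XJ)
      then show "positive_op ?Z"
        using xpos JI proj_positive[OF I(2)] by (auto intro!: positive_add positive_sum positive_scaleR)
    qed
    have ZP: "?Z \<odot> P j = X \<odot> P j"
      by (simp add: blinfun_compose_distribs sJ blinfun_compose_assoc)
    have PZ: "P j \<odot> ?Z = P j \<odot> X"
      by (simp add: blinfun_compose_distribs sJ XJ) (simp add: blinfun_compose_assoc[symmetric] sJ)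
    show ?case
    proof (cases "P j = 0")
      case True
      then show ?thesis using insert j by simp
    next
      case False
      have "N ((tr (?Z \<odot> P j) / tr (P j)) *\<^sub>R P j + ?Z \<odot> (id_blinfun - P j)) \<le> N ?Z"
        by (rule N_average_corner[OF Z I(2)[OF j(1)] False]) (simp only: ZP PZ X(3)[OF j(1)])
      moreover have "(tr (?Z \<odot> P j) / tr (P j)) *\<^sub>R P j + ?Z \<odot> (id_blinfun - P j)
          = (\<Sum>i\<in>insert j J. x i *\<^sub>R P i) + X \<odot> (id_blinfun - (\<Sum>i\<in>insert j J. P i))"
      proof -
        have "?Z \<odot> (id_blinfun - P j) = ?Z \<odot> id_blinfun - ?Z \<odot> P j"
          by (rule blinfun_compose_distribs(4))
        then have "?Z \<odot> (id_blinfun - P j) = ?Z - X \<odot> P j" by (simp only: ZP id_blinfun_compose)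
        then show ?thesis unfolding ZP using j insert.hyps
          by (simp add: x_def blinfun_compose_distribs)
      qed
      ultimately show ?thesis using insert j by auto
    qed
  qed simp
  from this[OF I(1) order_refl] show ?thesis using sum by (simp add: x_def)
qed

text \<open>\<open>|B P| = |B| P\<close>, since \<open>P\<close> commutes with \<open>|B|\<close>.\<close>

lemma tau_proj_abs_bound:
  assumes B: "B \<in> M" and P: "proj P" and comm: "B \<odot> P = P \<odot> B" "op_abs B \<odot> P = P \<odot> op_abs B"
  shows "cmod (\<tau> (P \<odot> B)) \<le> tr (op_abs B \<odot> P)"
proof -
  note PM = projD[OF P]
  have R: "op_abs B \<in> M" "positive_op (op_abs B)" using B by (auto simp: abs_in bop positive_op_abs)
  have "op_abs (B \<odot> P) = op_abs B \<odot> P"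
  proof (rule op_abs_eqI)
    show "positive_op (op_abs B \<odot> P)" by (intro positive_compose_commuting R proj_positive P comm)
    have "(op_abs B \<odot> P) \<odot> (op_abs B \<odot> P) = P \<odot> (op_abs B \<odot> op_abs B) \<odot> P"
      using comm(2) by (metis blinfun_compose_assoc)
    then show "(op_abs B \<odot> P) \<odot> (op_abs B \<odot> P) = op_adjoint (B \<odot> P) \<odot> (B \<odot> P)"
      using B PM by (simp add: op_abs_square bop op_adjoint_compose selfadj_iff blinfun_compose_assoc)
  qed
  moreover have "cmod (\<tau> (id_blinfun \<odot> (B \<odot> P))) \<le> norm (id_blinfun :: 'h endo) * tr (op_abs (B \<odot> P))"
    using B PM by (intro tau_compose_abs_bound) (auto simp: in_M)
  moreover have "norm (id_blinfun :: 'h endo) * tr (op_abs (B \<odot> P)) \<le> 1 * tr (op_abs (B \<odot> P))"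
    using B PM by (intro mult_right_mono norm_blinfun_id_le tr_nonneg) (auto simp: in_M bop positive_op_abs)
  ultimately show ?thesis by (simp add: comm)
qed

text \<open>The form in which weak Dixmier enters the duality: pairings with a combination of the \<open>P i\<close>
  are dominated by pairings with an element \<open>\<Sum> x i P i\<close> of smaller norm.\<close>

lemma conditional_expectation:
  assumes I: "finite I" "\<And>i. i \<in> I \<Longrightarrow> proj (P i)"
    "\<And>i j. i \<in> I \<Longrightarrow> j \<in> I \<Longrightarrow> i \<noteq> j \<Longrightarrow> P i \<odot> P j = 0" and sum: "(\<Sum>i\<in>I. P i) = id_blinfun"
    and X: "X \<in> M"
  obtains x where "\<And>i. i \<in> I \<Longrightarrow> 0 \<le> x i" "\<And>i. i \<in> I \<Longrightarrow> cmod (\<tau> (P i \<odot> X)) \<le> x i * tr (P i)"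
    "N (\<Sum>i\<in>I. x i *\<^sub>R P i) \<le> N X"
proof -
  obtain Y where Y: "Y \<in> M" "N Y \<le> N X" "\<And>i. i \<in> I \<Longrightarrow> P i \<odot> Y = Y \<odot> P i"
    "\<And>i. i \<in> I \<Longrightarrow> P i \<odot> Y \<odot> P i = P i \<odot> X \<odot> P i"
    by (rule pinching[of I P X]) (use I X in auto)
  let ?R = "op_abs Y"
  have R: "?R \<in> M" "positive_op ?R" using Y by (auto simp: abs_in bop positive_op_abs)
  have comm: "?R \<odot> P i = P i \<odot> ?R" if i: "i \<in> I" for i
  proof -
    have p: "P i \<in> bounded_operators" "op_adjoint (P i) = P i" using I(2)[OF i] by (auto simp: proj_def selfadj_iff)
    have "op_adjoint (P i \<odot> Y) = op_adjoint (Y \<odot> P i)" using Y(3)[OF i] by simp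
    then have "op_adjoint Y \<odot> P i = P i \<odot> op_adjoint Y" using p Y(1) by (simp add: op_adjoint_compose bop)
    then show ?thesis unfolding op_abs_eq_sqrt using Y(1,3) i
      by (intro op_sqrt_commute positive_adjoint_self commute_compose) (auto simp: bop)
  qed
  define x where "x i = tr (?R \<odot> P i) / tr (P i)" for i
  have RP: "0 \<le> tr (?R \<odot> P i)" if "i \<in> I" for i
  proof (rule tr_nonneg)
    show "?R \<odot> P i \<in> M" using that I(2) R by (simp add: in_M projD)
    show "positive_op (?R \<odot> P i)" by (intro positive_compose_commuting R(2) proj_positive I(2) comm that)
  qed
  have "cmod (\<tau> (P i \<odot> X)) \<le> x i * tr (P i)" if i: "i \<in> I" for i
  proof (cases "P i = 0")
    case False
    note PM = projD[OF I(2)[OF i]]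
    have sandwich: "\<tau> (P i \<odot> A \<odot> P i) = \<tau> (P i \<odot> A)" if "A \<in> M" for A
      using tau_commute[of "P i \<odot> A" "P i"] PM that by (simp add: in_M blinfun_compose_assoc[symmetric])
    have "\<tau> (P i \<odot> X) = \<tau> (P i \<odot> Y)" using sandwich[OF X] sandwich[OF Y(1)] Y(4)[OF i] by simp
    also have "cmod \<dots> \<le> tr (?R \<odot> P i)" using tau_proj_abs_bound[OF Y(1) I(2)[OF i]] Y(3)[OF i] comm[OF i] by simp
    also have "\<dots> = x i * tr (P i)" using proj_tr_pos[OF I(2)[OF i] False] by (simp add: x_def)
    finally show ?thesis .
  qed (simp add: tau_zero tr_zero)
  moreover have "0 \<le> x i" if "i \<in> I" for i unfolding x_def using RP I(2) that proj_tr_nonneg by simp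
  moreover have "N (\<Sum>i\<in>I. x i *\<^sub>R P i) \<le> N X"
  proof -
    have "N (\<Sum>i\<in>I. (tr (?R \<odot> P i) / tr (P i)) *\<^sub>R P i) \<le> N ?R"
      by (rule N_average_partition) (use I sum R comm in auto)
    then show ?thesis using N_abs[OF Y(1)] Y(2) by (simp add: x_def)
  qed
  ultimately show ?thesis using that by blast
qed

end

section \<open>Norming functionals on finite-dimensional subspaces\<close>

lemma linear_functional_off_span:
  fixes C :: "'a::real_vector set"
  assumes "z \<notin> span C"
  obtains g :: "'a \<Rightarrow> real" where "linear g" "g z = 1" "\<And>x. x \<in> span C \<Longrightarrow> g x = 0"
proof -
  obtain B where B: "B \<subseteq> span C" "independent B" "span C \<subseteq> span B"
    using maximal_independent_subset[of "span C"] by metis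
  have "span B \<subseteq> span (span C)" by (rule span_mono[OF B(1)])
  then have sB: "span B = span C" using B(3) unfolding span_span by (rule subset_antisym)
  have indep: "independent (insert z B)" using B(2) assms sB by (simp add: independent_insertI)
  from linear_independent_extend[OF indep, of "\<lambda>x. if x = z then 1 else (0::real)"]
  obtain g :: "'a \<Rightarrow> real" where g: "linear g" "\<forall>x\<in>insert z B. g x = (if x = z then 1 else 0)"
    by (elim exE conjE)
  have "g x = 0" if "x \<in> B" for x using g(2) that assms sB span_base by fastforce
  then have "g x = 0" if "x \<in> span C" for x
    using linear_eq_0_on_span[OF g(1)] that sB by blast
  then show ?thesis using that g by auto
qed

text \<open>The Hahn--Banach theorem, extending the functional by one dimension at a time.  The seminorm is
  controlled only on a subspace \<open>W\<close>, because a gauge norm is one only on \<open>M\<close>.\<close>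

lemma norming_functional:
  fixes q :: "'a::real_vector \<Rightarrow> real"
  assumes W: "subspace W" "finite B" "B \<subseteq> W" "v \<in> W"
    and q: "\<And>x y. x \<in> W \<Longrightarrow> y \<in> W \<Longrightarrow> q (x + y) \<le> q x + q y"
      "\<And>x r. x \<in> W \<Longrightarrow> q (r *\<^sub>R x) = \<bar>r\<bar> * q x" "\<And>x. x \<in> W \<Longrightarrow> 0 \<le> q x"
  obtains f where "linear f" "f v = q v" "\<And>x. x \<in> span (insert v B) \<Longrightarrow> f x \<le> q x"
proof -
  have "\<exists>f. linear f \<and> f v = q v \<and> (\<forall>x\<in>span (insert v B). f x \<le> q x)"
    using W(2,3)
  proof (induction B)
    case empty
    have "\<exists>f. linear f \<and> f v = q v"
    proof (cases "v = 0")
      case True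
      have "q v = 0" using q(2)[OF W(4), of 0] True by simp
      then show ?thesis using True by (intro exI[of _ "\<lambda>_. 0"]) (simp add: module_hom_zero)
    next
      case False
      then have "v \<notin> span {}" by simp
      then obtain g :: "'a \<Rightarrow> real" where "linear g" "g v = 1" using linear_functional_off_span by blast
      then have "linear (\<lambda>x. q v *\<^sub>R g x)" by (intro linear_compose_scale_right)
      moreover have "q v *\<^sub>R g v = q v" using \<open>g v = 1\<close> by simp
      ultimately show ?thesis by blast
    qed
    then obtain f where f: "linear f" "f v = q v" by blast
    have "f x \<le> q x" if x: "x \<in> span {v}" for x
    proof -
      obtain r where "x = r *\<^sub>R v" using x by (auto simp: span_singleton)
      then have "f x = r * q v" "q x = \<bar>r\<bar> * q v" using f q(2)[OF W(4)] by (simp_all add: linear_cmul)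
      then show ?thesis using q(3)[OF W(4)] by (simp add: mult_right_mono)
    qed
    then show ?case using f by blast
  next
    case (insert z B)
    then obtain f where f: "linear f" "f v = q v" "\<And>x. x \<in> span (insert v B) \<Longrightarrow> f x \<le> q x" by auto
    let ?C = "insert v B"
    have zW: "z \<in> W" using insert.prems by simp
    have CW: "span ?C \<subseteq> W" by (rule span_minimal) (use insert.prems W in auto)
    show ?case
    proof (cases "z \<in> span ?C")
      case True
      then have "span (insert v (insert z B)) = span ?C"
        by (metis insert_commute span_redundant)
      then show ?thesis using f by auto
    next
      case False
      then obtain g :: "'a \<Rightarrow> real" where g: "linear g" "g z = 1" "\<And>x. x \<in> span ?C \<Longrightarrow> g x = 0"
        using linear_functional_off_span by blast
      have key: "f x - q (x - z) \<le> q (y + z) - f y" if "x \<in> span ?C" "y \<in> span ?C" for x y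
      proof -
        have "f x + f y = f (x + y)" using f(1) by (simp add: linear_add)
        also have "\<dots> \<le> q (x + y)" using f(3) that by (simp add: span_add)
        also have "x + y = (x - z) + (y + z)" by simp
        also have "q \<dots> \<le> q (x - z) + q (y + z)"
          using that CW zW W(1) by (intro q subspace_diff subspace_add) auto
        finally show ?thesis by simp
      qed
      define c where "c = (SUP x\<in>span ?C. f x - q (x - z))"
      have ne: "span ?C \<noteq> {}" using span_zero by blast
      have lo: "f x - q (x - z) \<le> c" if "x \<in> span ?C" for x
        unfolding c_def using that key[OF _ span_zero] by (intro cSUP_upper bdd_aboveI2) auto
      have hi: "c \<le> q (y + z) - f y" if "y \<in> span ?C" for y
        unfolding c_def using ne key that by (intro cSUP_least) auto
      define h where "h x = f x + (c - f z) * g x" for x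
      have lh: "linear h" unfolding h_def using linear_compose_add[OF f(1) linear_compose_scale_right[OF g(1), of "c - f z"]] by simp
      have hx: "h (x + t *\<^sub>R z) = f x + t * c" if "x \<in> span ?C" for x t
        using f(1) g that by (simp add: h_def linear_add linear_cmul algebra_simps)
      have "h x \<le> q x" if x: "x \<in> span (insert z ?C)" for x
      proof -
        obtain t where t: "x - t *\<^sub>R z \<in> span ?C" using x by (auto simp: span_insert)
        define y where "y = x - t *\<^sub>R z"
        have y: "y \<in> span ?C" "x = y + t *\<^sub>R z" using t by (simp_all add: y_def)
        have yW: "y \<in> W" using y CW by blast
        have "f y + t * c \<le> q (y + t *\<^sub>R z)"
        proof (cases t "0::real" rule: linorder_cases)
          case equal
          then show ?thesis using f(3) y by simp
        next
          case greater
          have s: "(1/t) *\<^sub>R y \<in> span ?C" using y by (simp add: span_scale)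
          then have "t * c \<le> t * (q ((1/t) *\<^sub>R y + z) - f ((1/t) *\<^sub>R y))"
            using hi greater by (intro mult_left_mono) auto
          also have "\<dots> = q (t *\<^sub>R ((1/t) *\<^sub>R y + z)) - f y"
            using q(2)[of "(1/t) *\<^sub>R y + z" t] greater s CW zW W(1) f(1)
            by (simp add: subspace_add subset_iff linear_cmul right_diff_distrib)
          also have "t *\<^sub>R ((1/t) *\<^sub>R y + z) = y + t *\<^sub>R z" using greater by (simp add: scaleR_add_right)
          finally show ?thesis by simp
        next
          case less
          define w where "w = (- 1 / t) *\<^sub>R y"
          have s: "w \<in> span ?C" unfolding w_def using y by (simp only: span_scale)
          have fw: "(- t) * f w = f y" unfolding w_def linear_cmul[OF f(1)] using less by simp
          have qw: "(- t) * q (w - z) = q ((- t) *\<^sub>R (w - z))"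
            using q(2)[of "w - z" "- t"] less subspace_diff[OF W(1) subsetD[OF CW s] zW] by simp
          have "(- t) * (f w - q (w - z)) \<le> (- t) * c" using lo[OF s] less by (intro mult_left_mono) auto
          then have "f y - q ((- t) *\<^sub>R (w - z)) \<le> (- t) * c" by (simp only: right_diff_distrib fw qw)
          moreover have "(- t) *\<^sub>R (w - z) = y + t *\<^sub>R z"
            using less by (simp add: w_def scaleR_diff_right)
          ultimately show ?thesis by simp
        qed
        then show ?thesis using hx y by simp
      qed
      moreover have "h v = q v" using hx[of v 0] f(2) by (simp add: span_base)
      ultimately show ?thesis using lh by (auto simp: insert_commute)
    qed
  qed
  then show ?thesis using that by blast
qed

section \<open>The dual norm\<close>

context weak_dixmier_gauge
begin

abbreviation dual :: "'h endo \<Rightarrow> real" where "dual \<equiv> dual_norm M \<tau> N"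

text \<open>The average of \<open>|X|\<close> over the trivial partition is \<open>\<tau>(|X|) 1\<close>.\<close>

lemma norm_ge_trace_abs:
  assumes X: "X \<in> M" shows "tr (op_abs X) * N id_blinfun \<le> N X"
proof -
  have R: "op_abs X \<in> M" "positive_op (op_abs X)" using X by (auto simp: abs_in bop positive_op_abs)
  have "(id_blinfun :: 'h endo) \<noteq> 0" using N_id_pos N_zero by auto
  then have "N ((tr (op_abs X \<odot> id_blinfun) / tr id_blinfun) *\<^sub>R id_blinfun
      + op_abs X \<odot> (id_blinfun - id_blinfun)) \<le> N (op_abs X)"
    by (intro N_average_corner R proj_id) simp_all
  then show ?thesis using N_abs[OF X] tr_nonneg[OF R] by (simp add: tr_id N_scaleR id_in)
qed

lemma pairing_norm_bound:
  assumes T: "T \<in> M" and X: "X \<in> M" "N X \<le> 1"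
  shows "cmod (\<tau> (T \<odot> X)) \<le> norm T / N id_blinfun"
proof -
  have "tr (op_abs X) \<le> 1 / N id_blinfun"
    using norm_ge_trace_abs[OF X(1)] X(2) N_id_pos by (simp add: field_simps)
  then have "norm T * tr (op_abs X) \<le> norm T * (1 / N id_blinfun)" by (intro mult_left_mono) auto
  then show ?thesis using tau_compose_abs_bound[OF T X(1)] by simp
qed

lemma bdd_above_dual_values: "T \<in> M \<Longrightarrow> bdd_above (dual_values M \<tau> N T)"
  unfolding dual_values_def using pairing_norm_bound by (intro bdd_aboveI[of _ "norm T / N id_blinfun"]) auto

lemma dual_values_nonempty: "dual_values M \<tau> N T \<noteq> {}"
  unfolding dual_values_def using zero_in N_zero by (auto intro!: exI[of _ 0])

lemma dual_upper: "T \<in> M \<Longrightarrow> X \<in> M \<Longrightarrow> N X \<le> 1 \<Longrightarrow> cmod (\<tau> (T \<odot> X)) \<le> dual T"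
  unfolding dual_norm_def by (rule cSup_upper[OF _ bdd_above_dual_values]) (auto simp: dual_values_def)

lemma dual_least: "(\<And>X. X \<in> M \<Longrightarrow> N X \<le> 1 \<Longrightarrow> cmod (\<tau> (T \<odot> X)) \<le> c) \<Longrightarrow> dual T \<le> c"
  unfolding dual_norm_def by (rule cSup_least[OF dual_values_nonempty]) (auto simp: dual_values_def)

lemma dual_nonneg: "T \<in> M \<Longrightarrow> 0 \<le> dual T"
  using dual_upper[of T 0] by (simp add: zero_in N_zero tau_zero)

lemma dual_pairing:
  assumes T: "T \<in> M" and X: "X \<in> M" shows "cmod (\<tau> (T \<odot> X)) \<le> dual T * N X"
proof (cases "X = 0")
  case False
  then have NX: "0 < N X" using N_nonneg[OF X] N_zero_iff[OF X] by simp
  have "cmod (\<tau> (T \<odot> ((1 / N X) *\<^sub>R X))) \<le> dual T"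
    using NX X by (intro dual_upper T) (auto simp: scaleR_in N_scaleR)
  moreover have "T \<odot> ((1 / N X) *\<^sub>R X) = (1 / N X) *\<^sub>R (T \<odot> X)" by (simp add: blinfun_compose_distribs)
  ultimately have "cmod (\<tau> (T \<odot> X)) / N X \<le> dual T"
    using NX X T by (simp add: tau_scaleR compose_in norm_divide)
  then show ?thesis using NX by (simp add: field_simps)
qed (simp add: tau_zero N_zero)

lemma norm_on_dual: "norm_on M dual"
  unfolding norm_on_def
proof (intro conjI ballI allI)
  fix A assume A: "A \<in> M"
  show "0 \<le> dual A" by (rule dual_nonneg[OF A])
  show "dual A = 0 \<longleftrightarrow> A = 0"
  proof
    assume "dual A = 0"
    then have "\<tau> (A \<odot> op_adjoint A) = 0" using dual_pairing[OF A adj_in[OF A]] by simp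
    then have "\<tau> (op_adjoint A \<odot> A) = 0" using tau_commute[OF A adj_in[OF A]] by simp
    then have 0: "op_adjoint A \<odot> A = 0"
      using A by (intro tau_faithful positive_adjoint_self) (auto simp: in_M bop)
    have "inner (A x) (A x) = 0" for x
    proof -
      have "op_adjoint A (A x) = 0" using 0 by (metis blinfun_apply_blinfun_compose zero_blinfun.rep_eq)
      then show ?thesis using inner_op_adjoint[OF bop[OF A], of x "A x"] by simp
    qed
    then show "A = 0" by (intro blinfun_eqI) simp
  next
    assume "A = 0"
    then have "dual A \<le> 0" by (intro dual_least) (simp add: tau_zero)
    then show "dual A = 0" using dual_nonneg[OF A] by simp
  qed
  have scale_le: "dual (c *\<^sub>C B) \<le> cmod c * dual B" if B: "B \<in> M" for c B
  proof (rule dual_least)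
    fix X assume X: "X \<in> M" "N X \<le> 1"
    have "(c *\<^sub>C B) \<odot> X = c *\<^sub>C (B \<odot> X)" by (rule blinfun_eqI) (simp add: blinfun_apply_scaleC)
    then have "cmod (\<tau> ((c *\<^sub>C B) \<odot> X)) = cmod c * cmod (\<tau> (B \<odot> X))"
      using B X by (simp add: tau_scaleC compose_in norm_mult)
    also have "\<dots> \<le> cmod c * dual B" by (intro mult_left_mono dual_upper B X) simp
    finally show "cmod (\<tau> ((c *\<^sub>C B) \<odot> X)) \<le> cmod c * dual B" .
  qed
  show "dual (c *\<^sub>C A) = cmod c * dual A" for c
  proof (cases "c = 0")
    case True
    then show ?thesis using scale_le[OF A, of c] dual_nonneg[OF scaleC_in[OF A, of c]] by simp
  next
    case False
    have "inverse c *\<^sub>C c *\<^sub>C A = of_real 1 *\<^sub>C A" using False by (simp add: scaleC_scaleC)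
    then have "inverse c *\<^sub>C c *\<^sub>C A = A" by (simp only: scaleC_of_real scaleR_one)
    then have "dual A \<le> cmod (inverse c) * dual (c *\<^sub>C A)" 
      using scale_le[OF scaleC_in[OF A, of c], of "inverse c"] by simp
    then have "cmod c * dual A \<le> dual (c *\<^sub>C A)" using False by (simp add: norm_divide norm_inverse field_simps)
    then show ?thesis using scale_le[OF A, of c] by simp
  qed
next
  fix A B assume A: "A \<in> M" and B: "B \<in> M"
  show "dual (A + B) \<le> dual A + dual B"
  proof (rule dual_least)
    fix X assume X: "X \<in> M" "N X \<le> 1"
    have "cmod (\<tau> ((A + B) \<odot> X)) \<le> cmod (\<tau> (A \<odot> X)) + cmod (\<tau> (B \<odot> X))"
      using A B X by (simp add: blinfun_compose_distribs tau_add compose_in norm_triangle_ineq)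
    also have "\<dots> \<le> dual A + dual B" by (intro add_mono dual_upper A B X)
    finally show "cmod (\<tau> ((A + B) \<odot> X)) \<le> dual A + dual B" .
  qed
qed

lemma pairing_perturb:
  assumes "S \<in> M" "T \<in> M" "norm (S - T) \<le> e" and X: "X \<in> M" "N X \<le> 1"
  shows "cmod (\<tau> (S \<odot> X)) \<le> cmod (\<tau> (T \<odot> X)) + e / N id_blinfun"
proof -
  have "\<tau> (S \<odot> X) = \<tau> (T \<odot> X) + \<tau> ((S - T) \<odot> X)"
    using assms by (simp add: blinfun_compose_distribs tau_diff compose_in)
  then have "cmod (\<tau> (S \<odot> X)) \<le> cmod (\<tau> (T \<odot> X)) + cmod (\<tau> ((S - T) \<odot> X))"
    by (metis norm_triangle_ineq)
  also have "cmod (\<tau> ((S - T) \<odot> X)) \<le> norm (S - T) / N id_blinfun"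
    using assms by (intro pairing_norm_bound) (auto simp: diff_in)
  also have "\<dots> \<le> e / N id_blinfun" using assms(3) N_id_pos by (simp add: divide_right_mono)
  finally show ?thesis by simp
qed

text \<open>Both \<open>T\<close> and \<open>|T|\<close> are, up to small errors, contractions times the other one, and a contraction
  can be moved around the trace to the test operator.\<close>

lemma dual_le_of_approximate_factor:
  assumes S: "S \<in> M" and T: "T \<in> M"
    and V: "\<And>e. 0 < e \<Longrightarrow> \<exists>V\<in>M. norm V \<le> 1 \<and> norm (S - V \<odot> T) \<le> e"
  shows "dual S \<le> dual T"
proof (rule dual_least, rule field_le_epsilon)
  fix X and e :: real assume X: "X \<in> M" "N X \<le> 1" and e: "0 < e"
  obtain W where W: "W \<in> M" "norm W \<le> 1" "norm (S - W \<odot> T) \<le> e * N id_blinfun"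
    using V[of "e * N id_blinfun"] e N_id_pos by auto
  have "cmod (\<tau> (S \<odot> X)) \<le> cmod (\<tau> ((W \<odot> T) \<odot> X)) + e * N id_blinfun / N id_blinfun"
    by (intro pairing_perturb S compose_in W T X)
  also have "\<tau> ((W \<odot> T) \<odot> X) = \<tau> (T \<odot> (X \<odot> W))"
    using tau_commute[of W "T \<odot> X"] W T X by (simp add: compose_in blinfun_compose_assoc)
  also have "cmod \<dots> \<le> dual T"
    using N_contraction_right[OF W(1,2) X(1)] X W T by (intro dual_upper) (auto simp: compose_in)
  finally show "cmod (\<tau> (S \<odot> X)) \<le> dual T + e" using N_id_pos by simp
qed

lemma dual_abs:
  assumes T: "T \<in> M" shows "dual T = dual (op_abs T)"
proof (rule antisym)
  have polar: "\<exists>V\<in>M. norm V \<le> 1 \<and> norm (T - V \<odot> op_abs T) \<le> e \<and> norm (op_abs T - op_adjoint V \<odot> T) \<le> e"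
    if "0 < e" for e
    using approximate_polar_decomposition[OF bop[OF T] that alg T abs_in[OF T]] by metis
  show "dual T \<le> dual (op_abs T)"
    using polar by (intro dual_le_of_approximate_factor T abs_in) blast
  show "dual (op_abs T) \<le> dual T"
  proof (intro dual_le_of_approximate_factor T abs_in)
    fix e :: real assume "0 < e"
    then obtain V where "V \<in> M" "norm V \<le> 1" "norm (op_abs T - op_adjoint V \<odot> T) \<le> e" using polar by blast
    then show "\<exists>W\<in>M. norm W \<le> 1 \<and> norm (op_abs T - W \<odot> T) \<le> e"
      using norm_op_adjoint_le[OF bop] adj_in by (intro bexI[of _ "op_adjoint V"]) (auto intro: order_trans)
  qed
qed

text \<open>Up to the mesh, \<open>S\<close> and \<open>T\<close> are combinations, with equal coefficients, of their slices \<open>P k\<close> and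
  \<open>Q k\<close>, which have equal traces.  The expectation \<open>\<Sum> x k P k\<close> of a test operator for \<open>S\<close> has the same
  moments as \<open>\<Sum> x k Q k\<close>, which is a test operator for \<open>T\<close> giving at least
  the same value.\<close>

lemma dual_equi_le:
  assumes S: "S \<in> M" "positive_op S" and T: "T \<in> M" "positive_op T" and eq: "equi_measurable \<tau> S T"
  shows "dual S \<le> dual T"
proof (rule dual_least, rule field_le_epsilon)
  fix X and e :: real assume X: "X \<in> M" "N X \<le> 1" and e: "0 < e"
  define d where "d = e * N id_blinfun / 2"
  have d: "0 < d" using e N_id_pos by (simp add: d_def)
  obtain K :: nat where "(norm S + norm T) / d < real K" using reals_Archimedean2 by blast
  then have "norm S + norm T < real K * d" using d by (simp add: field_simps)
  then have K: "norm S < real K * d" "norm T < real K * d"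
    using norm_ge_zero[of S] norm_ge_zero[of T] by linarith+
  define P where "P = slice S d"
  define Q where "Q = slice T d"
  have P: "proj (P k)" "P k \<in> M" "positive_op (P k)" and Q: "proj (Q k)" "Q k \<in> M" "positive_op (Q k)" for k
    using proj_slice[OF S d] proj_slice[OF T d] by (auto simp: P_def Q_def projD proj_positive)
  have PQ: "tr (P k) = tr (Q k)" for k unfolding P_def Q_def by (rule tr_slice_eq[OF S T eq d])
  have orth: "P j \<odot> P k = 0" "Q j \<odot> Q k = 0" if "j \<noteq> k" for j k
    using slice_orthogonal[OF S d that] slice_orthogonal[OF T d that] by (auto simp: P_def Q_def)
  let ?S = "\<Sum>k<K. (real k * d) *\<^sub>R P k" and ?T = "\<Sum>k<K. (real k * d) *\<^sub>R Q k"
  have ST: "?S \<in> M" "?T \<in> M" using P Q by (auto intro!: in_M)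
  have app: "norm (S - ?S) \<le> d" "norm (?T - T) \<le> d"
    using slice_approx[OF S d K(1)] slice_approx[OF T d K(2)] by (auto simp: P_def Q_def norm_minus_commute)
  obtain x where x: "\<And>k. k \<in> {..<K} \<Longrightarrow> 0 \<le> x k" "\<And>k. k \<in> {..<K} \<Longrightarrow> cmod (\<tau> (P k \<odot> X)) \<le> x k * tr (P k)"
    "N (\<Sum>k<K. x k *\<^sub>R P k) \<le> N X"
  proof (rule conditional_expectation[of "{..<K}" P X])
    show "(\<Sum>k<K. P k) = id_blinfun" unfolding P_def by (rule slice_sum[OF S d K(1)])
  qed (use P orth X in auto)
  define Y where "Y = (\<Sum>k<K. x k *\<^sub>R Q k)"
  have YM: "Y \<in> M" using Q by (auto simp: Y_def intro!: in_M)
  have "equi_measurable \<tau> Y (\<Sum>k<K. x k *\<^sub>R P k)"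
    unfolding equi_measurable_def
  proof
    fix n
    have "\<tau> (op_power ((\<Sum>k<K. x k *\<^sub>R Q k) + 0) n) = \<tau> (op_power ((\<Sum>k<K. x k *\<^sub>R P k) + 0) n)"
      using P Q orth by (subst (1 2) tau_op_power_orthogonal_sum) (auto simp: zero_in PQ)
    then show "\<tau> (op_power Y n) = \<tau> (op_power (\<Sum>k<K. x k *\<^sub>R P k) n)" by (simp add: Y_def)
  qed
  moreover have "positive_op Y" "positive_op (\<Sum>k<K. x k *\<^sub>R P k)"
    unfolding Y_def using x(1) P Q by (auto intro!: positive_sum positive_scaleR)
  ultimately have "N Y = N (\<Sum>k<K. x k *\<^sub>R P k)"
    using YM P by (intro N_equi) (auto intro!: in_M)
  then have NY: "N Y \<le> 1" using x(3) X by simp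
  have "cmod (\<tau> (S \<odot> X)) \<le> cmod (\<tau> (?S \<odot> X)) + d / N id_blinfun"
    by (rule pairing_perturb[OF S(1) ST(1) app(1) X])
  also have "cmod (\<tau> (?S \<odot> X)) \<le> (\<Sum>k<K. real k * d * (x k * tr (P k)))"
  proof -
    have "\<tau> (?S \<odot> X) = (\<Sum>k<K. of_real (real k * d) * \<tau> (P k \<odot> X))"
      unfolding blinfun_compose_sum_left using P X
      by (subst tau_sum) (auto simp: in_M blinfun_compose_distribs tau_scaleR)
    also have "cmod \<dots> \<le> (\<Sum>k<K. cmod (of_real (real k * d) * \<tau> (P k \<odot> X)))" by (rule norm_sum)
    also have "\<dots> \<le> (\<Sum>k<K. real k * d * (x k * tr (P k)))"
      using d x(2) by (intro sum_mono) (simp add: norm_mult mult_left_mono)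
    finally show ?thesis .
  qed
  also have "(\<Sum>k<K. real k * d * (x k * tr (P k))) \<le> cmod (\<tau> (?T \<odot> Y))"
  proof -
    have "?T \<odot> Y = (\<Sum>k<K. (real k * d * x k) *\<^sub>R Q k)"
      unfolding Y_def by (rule blinfun_orthogonal_sum_compose) (use Q orth projD in auto)
    then have "\<tau> (?T \<odot> Y) = (\<Sum>k<K. \<tau> ((real k * d * x k) *\<^sub>R Q k))"
      using Q by (simp add: tau_sum in_M)
    also have "\<dots> = of_real (\<Sum>k<K. real k * d * (x k * tr (P k)))"
      unfolding of_real_sum by (intro sum.cong refl) (simp add: tau_scaleR Q tau_positive PQ)
    finally show ?thesis by (simp only: norm_of_real abs_ge_self)
  qed
  also have "cmod (\<tau> (?T \<odot> Y)) \<le> cmod (\<tau> (T \<odot> Y)) + d / N id_blinfun"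
    by (rule pairing_perturb[OF ST(2) T(1) app(2) YM NY])
  also have "cmod (\<tau> (T \<odot> Y)) \<le> dual T" by (rule dual_upper[OF T(1) YM NY])
  finally show "cmod (\<tau> (S \<odot> X)) \<le> dual T + e" using N_id_pos by (simp add: d_def field_simps)
qed

lemma tracial_gauge_norm_dual: "tracial_gauge_norm M \<tau> dual"
proof -
  have "dual S = dual T" if "S \<in> M" "T \<in> M" "positive_op S" "positive_op T" "equi_measurable \<tau> S T" for S T
    using that by (intro antisym dual_equi_le) (auto simp: equi_measurable_def)
  then show ?thesis unfolding tracial_gauge_norm_def using norm_on_dual dual_abs by blast
qed

text \<open>A functional norming \<open>S = \<Sum> c i P i\<close> on the span of the \<open>P i\<close> is the pairing with some
  \<open>W = \<Sum> w i P i\<close>; by the conditional expectation, \<open>W\<close> has dual norm at most \<open>1\<close> on all of \<open>M\<close>.\<close>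

lemma norming_element:
  fixes P :: "'i \<Rightarrow> 'h endo" and c :: "'i \<Rightarrow> real"
  assumes I: "finite I" "\<And>i. i \<in> I \<Longrightarrow> proj (P i)"
    "\<And>i j. i \<in> I \<Longrightarrow> j \<in> I \<Longrightarrow> i \<noteq> j \<Longrightarrow> P i \<odot> P j = 0" and sum: "(\<Sum>i\<in>I. P i) = id_blinfun"
  defines "S \<equiv> (\<Sum>i\<in>I. c i *\<^sub>R P i)"
  obtains W where "W \<in> M" "dual W \<le> 1" "\<tau> (S \<odot> W) = of_real (N S)"
proof -
  have PM: "P i \<in> M" if "i \<in> I" for i using I(2)[OF that] by (rule projD)
  have SM: "S \<in> M" unfolding S_def using PM by (intro in_M)
  obtain f where f: "linear f" "f S = N S" "\<And>x. x \<in> span (insert S (P ` I)) \<Longrightarrow> f x \<le> N x"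
  proof (rule norming_functional[of M "P ` I" S N])
    show "subspace M" by (auto simp: subspace_def in_M)
  qed (use I PM SM in \<open>auto intro: N_triangle N_nonneg simp: N_scaleR\<close>)
  have fsum: "f (\<Sum>i\<in>I. y i *\<^sub>R P i) = (\<Sum>i\<in>I. y i * f (P i))" for y
    using f(1) by (simp add: linear_sum linear_cmul)
  define w where "w i = f (P i) / tr (P i)" for i
  have w: "w i * tr (P i) = f (P i)" if "i \<in> I" for i
  proof (cases "tr (P i) = 0")
    case True
    then show ?thesis using proj_tr_zero[OF I(2)[OF that]] linear_0[OF f(1)] by simp
  qed (simp add: w_def)
  define W where "W = (\<Sum>i\<in>I. w i *\<^sub>R P i)"
  have WM: "W \<in> M" unfolding W_def using PM by (intro in_M)
  have "dual W \<le> 1"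
  proof (rule dual_least)
    fix X assume X: "X \<in> M" "N X \<le> 1"
    obtain x where x: "\<And>i. i \<in> I \<Longrightarrow> 0 \<le> x i" "\<And>i. i \<in> I \<Longrightarrow> cmod (\<tau> (P i \<odot> X)) \<le> x i * tr (P i)"
      "N (\<Sum>i\<in>I. x i *\<^sub>R P i) \<le> N X"
      by (rule conditional_expectation[of I P X]) (use I sum X in auto)
    define s where "s i = sgn (f (P i))" for i
    define D where "D = (\<Sum>i\<in>I. s i *\<^sub>R P i)"
    have DM: "D \<in> M" unfolding D_def using PM by (intro in_M)
    have Dsa: "selfadj D" unfolding D_def by (intro selfadj_sum selfadj_scaleR projD(2) I(2))
    have D1: "norm D \<le> 1"
    proof (rule norm_blinfun_bound)
      fix v
      have "D \<odot> D = (\<Sum>i\<in>I. (s i * s i) *\<^sub>R P i)" unfolding D_def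
        by (rule blinfun_orthogonal_sum_compose) (use I projD in auto)
      then have "inner (D v) (D v) = inner v ((\<Sum>i\<in>I. (s i * s i) *\<^sub>R P i) v)"
        using selfadjD[OF Dsa, of v "D v"] by (metis blinfun_apply_blinfun_compose)
      also have "\<dots> = (\<Sum>i\<in>I. s i * s i * inner v (P i v))"
        by (simp add: blinfun.sum_left blinfun_lin inner_sum_right)
      also have "\<dots> \<le> (\<Sum>i\<in>I. 1 * inner v (P i v))"
      proof (intro sum_mono mult_right_mono)
        show "s i * s i \<le> 1" for i by (simp add: s_def sgn_if)
        show "0 \<le> inner v (P i v)" if "i \<in> I" for i
          using positive_nonneg[OF proj_positive[OF I(2)[OF that]], of v] by (simp add: inner_commute)
      qed
      also have "\<dots> = inner v ((\<Sum>i\<in>I. P i) v)" by (simp add: blinfun.sum_left inner_sum_right)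
      finally have "(norm (D v))\<^sup>2 \<le> (norm v)\<^sup>2" by (simp add: sum power2_norm_eq_inner)
      then show "norm (D v) \<le> 1 * norm v" using power2_le_imp_le by auto
    qed simp
    let ?Z = "\<Sum>i\<in>I. x i *\<^sub>R P i"
    have ZM: "?Z \<in> M" using PM by (intro in_M)
    have DZ: "D \<odot> ?Z = (\<Sum>i\<in>I. (s i * x i) *\<^sub>R P i)" unfolding D_def
      by (rule blinfun_orthogonal_sum_compose) (use I projD in auto)
    have "\<tau> (W \<odot> X) = (\<Sum>i\<in>I. of_real (w i) * \<tau> (P i \<odot> X))"
      unfolding W_def blinfun_compose_sum_left using PM X
      by (subst tau_sum) (auto simp: in_M blinfun_compose_distribs tau_scaleR)
    also have "cmod \<dots> \<le> (\<Sum>i\<in>I. cmod (of_real (w i) * \<tau> (P i \<odot> X)))" by (rule norm_sum)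
    also have "\<dots> \<le> (\<Sum>i\<in>I. \<bar>w i\<bar> * (x i * tr (P i)))"
      using x(2) by (intro sum_mono) (simp add: norm_mult mult_left_mono)
    also have "\<dots> = (\<Sum>i\<in>I. s i * x i * f (P i))"
    proof (intro sum.cong refl)
      fix i assume i: "i \<in> I"
      have "\<bar>w i\<bar> * tr (P i) = \<bar>f (P i)\<bar>" using w[OF i] proj_tr_nonneg[OF I(2)[OF i]] by (metis abs_mult abs_of_nonneg)
      also have "\<dots> = s i * f (P i)" by (simp add: s_def abs_sgn mult.commute)
      finally show "\<bar>w i\<bar> * (x i * tr (P i)) = s i * x i * f (P i)" by (simp add: mult_ac)
    qed
    also have "\<dots> = f (D \<odot> ?Z)" by (simp add: DZ fsum)
    also have "\<dots> \<le> N (D \<odot> ?Z)"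
    proof (rule f(3))
      show "D \<odot> ?Z \<in> span (insert S (P ` I))" unfolding DZ by (intro span_sum span_scale span_base) auto
    qed
    also have "\<dots> \<le> N ?Z" by (rule N_contraction_left[OF DM D1 ZM])
    finally show "cmod (\<tau> (W \<odot> X)) \<le> 1" using x(3) X by simp
  qed
  moreover have "\<tau> (S \<odot> W) = of_real (N S)"
  proof -
    have "S \<odot> W = (\<Sum>i\<in>I. (c i * w i) *\<^sub>R P i)" unfolding S_def W_def
      by (rule blinfun_orthogonal_sum_compose) (use I projD in auto)
    then have "\<tau> (S \<odot> W) = (\<Sum>i\<in>I. \<tau> ((c i * w i) *\<^sub>R P i))" using PM by (simp add: tau_sum in_M)
    also have "\<dots> = of_real (\<Sum>i\<in>I. c i * f (P i))"
      unfolding of_real_sum using w I(2)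
      by (intro sum.cong refl) (simp add: tau_scaleR PM tau_positive proj_positive mult.assoc flip: of_real_mult)
    also have "(\<Sum>i\<in>I. c i * f (P i)) = N S" using fsum[of c] f(2) by (simp add: S_def)
    finally show ?thesis .
  qed
  ultimately show ?thesis using that WM by blast
qed

end

text \<open>The dual norm is itself a tracial gauge norm, so everything said of \<open>N\<close> applies to it.  The bidual
  is trivially at most \<open>N\<close>; equality holds for combinations of slices, hence by continuity for positive
  operators, hence for all, as both norms depend only on \<open>|T|\<close>.\<close>

lemma (in weak_dixmier_gauge) bidual_eq:
  "bdd_above (dual_values M \<tau> dual T)" "dual_norm M \<tau> dual T = N T" if T: "T \<in> M"
proof -
  interpret D: weak_dixmier_gauge M \<tau> dual
    by unfold_locales (rule tracial_gauge_norm_dual)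
  show "bdd_above (dual_values M \<tau> dual T)" by (rule D.bdd_above_dual_values[OF T])
  have le: "D.dual A \<le> N A" if A: "A \<in> M" for A
  proof (rule D.dual_least)
    fix X assume X: "X \<in> M" "dual X \<le> 1"
    have "cmod (\<tau> (A \<odot> X)) \<le> dual X * N A" using dual_pairing[OF X(1) A] tau_commute[OF A X(1)] by simp
    also have "\<dots> \<le> 1 * N A" by (intro mult_right_mono X N_nonneg A)
    finally show "cmod (\<tau> (A \<odot> X)) \<le> N A" by simp
  qed
  interpret DD: gauge_norm M \<tau> D.dual
    by unfold_locales (rule D.tracial_gauge_norm_dual)
  have ge: "N A \<le> D.dual A" if A: "A \<in> M" "positive_op A" for A
  proof (rule field_le_epsilon)
    fix e :: real assume e: "0 < e"
    define d where "d = e / (2 * N id_blinfun)"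
    have d: "0 < d" using e N_id_pos by (simp add: d_def)
    obtain K :: nat where "norm A / d < real K" using reals_Archimedean2 by blast
    then have K: "norm A < real K * d" using d by (simp add: field_simps)
    let ?A = "\<Sum>k<K. (real k * d) *\<^sub>R slice A d k"
    have sM: "slice A d k \<in> M" for k using proj_slice[OF A d] by (rule projD)
    have AM: "?A \<in> M" using sM by (intro in_M)
    obtain W where W: "W \<in> M" "dual W \<le> 1" "\<tau> (?A \<odot> W) = of_real (N ?A)"
    proof (rule norming_element[of "{..<K}" "slice A d" "\<lambda>k. real k * d"])
      show "(\<Sum>k<K. slice A d k) = id_blinfun" by (rule slice_sum[OF A d K])
    qed (use proj_slice[OF A d] slice_orthogonal[OF A d] in auto)
    have 1: "N ?A \<le> D.dual ?A"
      using D.dual_upper[OF AM W(1,2)] N_nonneg[OF AM] by (simp add: W(3))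
    have app: "N (A - ?A) \<le> d * N id_blinfun"
      by (rule order_trans[OF N_le_norm[OF diff_in[OF A(1) AM]]])
        (rule mult_right_mono[OF slice_approx[OF A d K] N_nonneg[OF id_in]])
    have "N A \<le> N ?A + N (A - ?A)" using N_triangle[of ?A "A - ?A"] A AM by (simp add: diff_in)
    also have "N ?A \<le> D.dual ?A" by (rule 1)
    also have "D.dual ?A \<le> D.dual A + D.dual (A - ?A)"
      using DD.N_diff[of A "A - ?A"] A AM by (simp add: diff_in)
    also have "D.dual (A - ?A) \<le> N (A - ?A)" using A AM by (intro le) (simp add: diff_in)
    finally have "N A \<le> D.dual A + 2 * (d * N id_blinfun)" using app by simp
    then show "N A \<le> D.dual A + e" using N_id_pos by (simp add: d_def)
  qed
  have "N T = N (op_abs T)" by (rule N_abs[OF T])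
  also have "\<dots> = D.dual (op_abs T)"
    using le ge abs_in[OF T] positive_op_abs[OF bop[OF T]] by (intro antisym) auto
  also have "\<dots> = D.dual T" by (rule DD.N_abs[OF T, symmetric])
  finally show "dual_norm M \<tau> dual T = N T" by simp
qed

theorem theoremC:
  fixes M :: "('h::chilbert_space \<Rightarrow>\<^sub>L 'h) set"
    and \<tau> :: "('h \<Rightarrow>\<^sub>L 'h) \<Rightarrow> complex"
    and N :: "('h \<Rightarrow>\<^sub>L 'h) \<Rightarrow> real"
  assumes "finite_von_neumann_algebra M \<tau>"
    and "weak_Dixmier M \<tau>"
    and "tracial_gauge_norm M \<tau> N"
  shows "(\<forall>T\<in>M. bdd_above (dual_values M \<tau> N T)) \<and>
    tracial_gauge_norm M \<tau> (dual_norm M \<tau> N) \<and>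
    (\<forall>T\<in>M. bdd_above (dual_values M \<tau> (dual_norm M \<tau> N) T)) \<and>
    (\<forall>T\<in>M. dual_norm M \<tau> (dual_norm M \<tau> N) T = N T)"
proof -
  interpret weak_dixmier_gauge M \<tau> N using assms by unfold_locales
  show ?thesis
    by (intro conjI ballI tracial_gauge_norm_dual bdd_above_dual_values bidual_eq)
qed

end
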